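(* Let $\alpha>1$, and let the control system, the channel with $K_C$ uses per control sample, and the coding-and-control scheme with parameter $\mathrm{SDR}_0>0$ be as described in the context. If $$\alpha^2 < 1+\mathrm{SDR}_0,$$ then the control system is stabilizable using this scheme, and the infinite-horizon average stage LQG cost $\bar J^{\mathrm r}$ that the scheme achieves satisfies $$\bar J^{\mathrm r} \le \bar J^{\mathrm t} + \frac{Q+(\alpha^2-1)S}{1+\mathrm{SDR}_0-\alpha^2}\,\bigl(P^{\mathrm t}-\bar P^{\mathrm t}\bigr),\qquad \bar J^{\mathrm t} = Q\,\bar P^{\mathrm t} + S\,\bigl(P^{\mathrm t}-\bar P^{\mathrm t}\bigr).$$ Here $\bar J^{\mathrm t}$ is the average stage LQG cost achievable at the observer (i.e. when the controller has access to the observer's state estimates, with no communication channel in between). The quantities $P^{\mathrm t}$ and $\bar P^{\mathrm t}$ are the infinite-horizon values (limits as $t\to\infty$) of $P^{\mathrm t}_{t|t-1}$ and $P^{\mathrm t}_{t|t}$, respectively. $S$ and $P^{\mathrm t}$ are the positive solutions of $$S^2-\bigl[Q+(\alpha^2-1)R\bigr]S-QR=0,\qquad (P^{\mathrm t})^2-\bigl[(\alpha^2-1)V+W\bigr]P^{\mathrm t}-VW=0,$$ and $$\bar P^{\mathrm t}=\frac{P^{\mathrm t}V}{P^{\mathrm t}+V}.$$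
   Context: **System.** The scalar plant is $x_{t+1}=\alpha x_t+w_t+u_t$ with $\alpha>1$ known. The noises $w_t$ are i.i.d. $N(0,W)$ with $W>0$, $x_0\sim N(0,P_0)$, and $u_t$ is the control. The observer measures $y_t=x_t+v_t$, where the $v_t$ are i.i.d. $N(0,V)$ with $V\ge 0$. Observed samples are $t=1,2,\dots,T$, and $u_0=0$. The observer and the controller are connected by the channel $b_i=a_i+n_i$, where the $n_i$ are i.i.d. $N(0,1/\mathrm{SNR})$. The channel input is subject to a unit average power constraint, so the $K_C$ inputs used at one sample time have average expected power at most $1$: $\frac1{K_C}\sum\mathbb E[a_i^2]\le 1$. Exactly $K_C$ channel uses (an integer $K_C\ge1$) are available per control sample. The variables $x_0$, $\{w_t\}$, $\{v_t\}$, $\{n_i\}$ are mutually independent. The observer knows all past control signals. **Cost.** For non-negative constants $F,Q,R$, $$\bar J_T=\frac1T\,\mathbb E\Bigl[F x_{T+1}^2+\sum_{t=1}^T(Qx_t^2+Ru_t^2)\Bigr].$$ The infinite-horizon average stage LQG cost is $\lim_{T\to\infty}\bar J_T$ (to be read as $\limsup$ if the limit does not exist), where for each $T$ the scheme is run with the horizon-$T$ gains below. The system is *stabilizable using the scheme* if the second moments $\mathbb E[x_t^2]$, $t\le T+1$, remain bounded uniformly in $t$ and in the horizon $T$. **Observer's estimates (Kalman filter).** Put $\hat x^{\mathrm t}_{0|0}=0$, $P^{\mathrm t}_{1|0}=\alpha^2P_0+W$ and, for $t\ge1$, $$K^{\mathrm t}_t=\frac{P^{\mathrm t}_{t|t-1}}{P^{\mathrm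 t}_{t|t-1}+V},\quad \hat x^{\mathrm t}_{t|t}=\alpha\hat x^{\mathrm t}_{t-1|t-1}+u_{t-1}+K^{\mathrm t}_t\bigl(y_t-\alpha\hat x^{\mathrm t}_{t-1|t-1}-u_{t-1}\bigr),$$ $$P^{\mathrm t}_{t|t}=K^{\mathrm t}_tV,\quad P^{\mathrm t}_{t+1|t}=\alpha^2P^{\mathrm t}_{t|t-1}(1-K^{\mathrm t}_t)+W.$$ $P^{\mathrm t}_{t|t}$ and $P^{\mathrm t}_{t|t-1}$ are the mean square errors of the observer's filtered estimate and one-step prediction of $x_t$. **The coding-and-control scheme.** Put $\hat x^{\mathrm r}_{0|0}=0$ and $P^{\mathrm r}_{1|0}=\alpha^2P_0+W$. At each time $t\ge1$: * The receiver prediction is $\hat x^{\mathrm r}_{t|t-1}=\alpha\hat x^{\mathrm r}_{t-1|t-1}+u_{t-1}$; it is also known to the observer. * The observer forms $s_t=\hat x^{\mathrm t}_{t|t}-\hat x^{\mathrm r}_{t|t-1}$ and normalizes it: $\bar s_t=s_t/\sqrt{P^{\mathrm r}_{t|t-1}-P^{\mathrm t}_{t|t}}$. * The observer maps $\bar s_t$ to $K_C$ channel inputs, meeting the power constraint, and sends them. The controller maps the corresponding $K_C$ channel outputs to an estimate $\hat{\bar s}_t=\bar s_t+n^{\mathrm{eff}}_t$. The code is a *bounded-distortion joint source–channel code* with parameter $\mathrm{SDR}_0$ at the given SNR: $\mathbb E[\bar s_t\,n^{\mathrm{eff}}_t]=0$ (correlation-sense unbiasedness), and the mean square of $n^{\mathrm{eff}}_t$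 given any value of the input $\bar s_t$ is at most $1/\mathrm{SDR}_0$. * The controller sets $\hat s_t=\sqrt{P^{\mathrm r}_{t|t-1}-P^{\mathrm t}_{t|t}}\;\hat{\bar s}_t$ and $\hat x^{\mathrm r}_{t|t}=\hat x^{\mathrm r}_{t|t-1}+\frac{\mathrm{SDR}_0}{1+\mathrm{SDR}_0}\hat s_t$, and applies $u_t=-L_t\hat x^{\mathrm r}_{t|t}$. * The numbers $P^{\mathrm r}_{t|t-1}$ (the scheme's value for the receiver's prediction error) obey $P^{\mathrm r}_{t+1|t}=\frac{\alpha^2}{1+\mathrm{SDR}_0}\bigl(P^{\mathrm r}_{t|t-1}+\mathrm{SDR}_0\,P^{\mathrm t}_{t|t}\bigr)+W$. **Gains.** For horizon $T$, $$L_t=\frac{\alpha S_{t+1}}{S_{t+1}+R},\qquad S_t=\frac{\alpha^2RS_{t+1}}{S_{t+1}+R}+Q,\qquad S_{T+1}=F,$$ and it is assumed that the gains $L_t$ are well defined and nonzero. *)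

theory Defs
  imports "HOL-Probability.Probability"
begin

text \<open>The case \<open>s2 = 0\<close> is the point mass at \<open>0\<close>; a noise-free observer (\<open>V = 0\<close>) is allowed.\<close>

definition centered_gaussian :: "real \<Rightarrow> real measure" where
  "centered_gaussian s2 =
     (if s2 = 0 then return borel 0 else density lborel (\<lambda>x. ennreal (normal_density 0 (sqrt s2) x)))"

datatype noise_index = Initial | Process nat | Measurement nat | Channel nat nat

primrec noise_family ::
  "('a \<Rightarrow> real) \<Rightarrow> (nat \<Rightarrow> 'a \<Rightarrow> real) \<Rightarrow> (nat \<Rightarrow> 'a \<Rightarrow> real) \<Rightarrow> (nat \<Rightarrow> nat \<Rightarrow> 'a \<Rightarrow> real)
    \<Rightarrow> noise_index \<Rightarrow> 'a \<Rightarrow> real" where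
  "noise_family x0 w v n Initial = x0"
| "noise_family x0 w v n (Process t) = w t"
| "noise_family x0 w v n (Measurement t) = v t"
| "noise_family x0 w v n (Channel t i) = n t i"

text \<open>
  \<open>n t i\<close> is the channel noise of the \<open>i\<close>-th of the \<open>KC\<close> channel uses (\<open>i < KC\<close>) that belong
  to control sample \<open>t\<close>.
\<close>

locale gaussian_noises = prob_space M for M :: "'a measure" +
  fixes P0 W V SNR :: real and KC :: nat
    and x0 :: "'a \<Rightarrow> real" and w v :: "nat \<Rightarrow> 'a \<Rightarrow> real" and n :: "nat \<Rightarrow> nat \<Rightarrow> 'a \<Rightarrow> real"
  assumes independent:
      "indep_vars (\<lambda>_. borel) (noise_family x0 w v n)
         ({Initial} \<union> range Process \<union> Measurement ` {1..}
            \<union> {Channel t i | t i. 1 \<le> t \<and> i < KC})"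
    and initial_law: "distr M borel x0 = centered_gaussian P0"
    and process_law: "\<And>t. distr M borel (w t) = centered_gaussian W"
    and measurement_law: "\<And>t. 1 \<le> t \<Longrightarrow> distr M borel (v t) = centered_gaussian V"
    and channel_law:
      "\<And>t i. 1 \<le> t \<Longrightarrow> i < KC \<Longrightarrow> distr M borel (n t i) = centered_gaussian (1 / SNR)"

text \<open>\<open>P\<^sup>t\<close> at \<open>t|t-1\<close> for \<open>t \<ge> 1\<close>; the value at index \<open>0\<close> is unused.\<close>

fun kf_pred_mse :: "real \<Rightarrow> real \<Rightarrow> real \<Rightarrow> real \<Rightarrow> nat \<Rightarrow> real" where
  "kf_pred_mse \<alpha> W V P0 0 = 0"
| "kf_pred_mse \<alpha> W V P0 (Suc 0) = \<alpha>\<^sup>2 * P0 + W"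
| "kf_pred_mse \<alpha> W V P0 (Suc (Suc t)) =
     (let P = kf_pred_mse \<alpha> W V P0 (Suc t) in \<alpha>\<^sup>2 * P * (1 - P / (P + V)) + W)"

definition kf_gain :: "real \<Rightarrow> real \<Rightarrow> real \<Rightarrow> real \<Rightarrow> nat \<Rightarrow> real" where
  "kf_gain \<alpha> W V P0 t = kf_pred_mse \<alpha> W V P0 t / (kf_pred_mse \<alpha> W V P0 t + V)"

text \<open>\<open>P\<^sup>t\<close> at \<open>t|t\<close>.\<close>

definition kf_filt_mse :: "real \<Rightarrow> real \<Rightarrow> real \<Rightarrow> real \<Rightarrow> nat \<Rightarrow> real" where
  "kf_filt_mse \<alpha> W V P0 t = kf_gain \<alpha> W V P0 t * V"

text \<open>\<open>P\<^sup>r\<close> at \<open>t|t-1\<close> for \<open>t \<ge> 1\<close>; the value at index \<open>0\<close> is unused.\<close>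

fun rcv_pred_mse :: "real \<Rightarrow> real \<Rightarrow> real \<Rightarrow> real \<Rightarrow> real \<Rightarrow> nat \<Rightarrow> real" where
  "rcv_pred_mse \<alpha> W V P0 SDR 0 = 0"
| "rcv_pred_mse \<alpha> W V P0 SDR (Suc 0) = \<alpha>\<^sup>2 * P0 + W"
| "rcv_pred_mse \<alpha> W V P0 SDR (Suc (Suc t)) =
     \<alpha>\<^sup>2 / (1 + SDR)
       * (rcv_pred_mse \<alpha> W V P0 SDR (Suc t) + SDR * kf_filt_mse \<alpha> W V P0 (Suc t)) + W"

text \<open>
  The Riccati recursion runs backwards from \<open>S\<close> at \<open>T + 1\<close>, so it is indexed by the number of
  remaining steps.
\<close>

primrec riccati :: "real \<Rightarrow> real \<Rightarrow> real \<Rightarrow> real \<Rightarrow> nat \<Rightarrow> real" where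
  "riccati \<alpha> F Q R 0 = F"
| "riccati \<alpha> F Q R (Suc k) =
     \<alpha>\<^sup>2 * R * riccati \<alpha> F Q R k / (riccati \<alpha> F Q R k + R) + Q"

definition cost_to_go :: "real \<Rightarrow> real \<Rightarrow> real \<Rightarrow> real \<Rightarrow> nat \<Rightarrow> nat \<Rightarrow> real" where
  "cost_to_go \<alpha> F Q R T t = riccati \<alpha> F Q R (T + 1 - t)"

definition lqg_gain :: "real \<Rightarrow> real \<Rightarrow> real \<Rightarrow> real \<Rightarrow> nat \<Rightarrow> nat \<Rightarrow> real" where
  "lqg_gain \<alpha> F Q R T t =
     \<alpha> * cost_to_go \<alpha> F Q R T (t + 1) / (cost_to_go \<alpha> F Q R T (t + 1) + R)"

definition gains_well_defined_nonzero :: "real \<Rightarrow> real \<Rightarrow> real \<Rightarrow> real \<Rightarrow> bool" where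
  "gains_well_defined_nonzero \<alpha> F Q R \<longleftrightarrow>
     (\<forall>T\<ge>1. \<forall>t\<in>{1..T}. cost_to_go \<alpha> F Q R T (t + 1) + R \<noteq> 0 \<and> lqg_gain \<alpha> F Q R T t \<noteq> 0)"

text \<open>
  The signals of one run over a fixed horizon.  \<open>obs_est t\<close> is the observer's filtered estimate
  of \<open>state t\<close>.
\<close>

record 'a loop =
  state :: "nat \<Rightarrow> 'a \<Rightarrow> real"
  meas :: "nat \<Rightarrow> 'a \<Rightarrow> real"
  control :: "nat \<Rightarrow> 'a \<Rightarrow> real"
  obs_est :: "nat \<Rightarrow> 'a \<Rightarrow> real"

definition plant_and_observer ::
  "'a measure \<Rightarrow> real \<Rightarrow> real \<Rightarrow> real \<Rightarrow> real \<Rightarrow> ('a \<Rightarrow> real) \<Rightarrow> (nat \<Rightarrow> 'a \<Rightarrow> real)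
    \<Rightarrow> (nat \<Rightarrow> 'a \<Rightarrow> real) \<Rightarrow> nat \<Rightarrow> ('a, 'z) loop_scheme \<Rightarrow> bool" where
  "plant_and_observer M \<alpha> W V P0 x0 w v T r \<longleftrightarrow>
     (\<forall>\<omega>\<in>space M.
        state r 0 \<omega> = x0 \<omega> \<and> control r 0 \<omega> = 0 \<and> obs_est r 0 \<omega> = 0 \<and>
        (\<forall>t\<le>T. state r (t + 1) \<omega> = \<alpha> * state r t \<omega> + w t \<omega> + control r t \<omega>) \<and>
        (\<forall>t\<in>{1..T}.
           meas r t \<omega> = state r t \<omega> + v t \<omega> \<and>
           obs_est r t \<omega> = \<alpha> * obs_est r (t - 1) \<omega> + control r (t - 1) \<omega>
             + kf_gain \<alpha> W V P0 t
                 * (meas r t \<omega> - \<alpha> * obs_est r (t - 1) \<omega> - control r (t - 1) \<omega>)))"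

text \<open>
  Expectations of non-negative quantities are Lebesgue integrals with values in \<open>[0, \<infinity>]\<close>, so that
  a non-integrable cost counts as \<open>\<infinity>\<close> and not as \<open>0\<close>.
\<close>

definition horizon_cost ::
  "'a measure \<Rightarrow> real \<Rightarrow> real \<Rightarrow> real \<Rightarrow> nat \<Rightarrow> ('a, 'z) loop_scheme \<Rightarrow> ereal" where
  "horizon_cost M F Q R T r =
     enn2ereal (\<integral>\<^sup>+ \<omega>. ennreal (F * (state r (T + 1) \<omega>)\<^sup>2
        + (\<Sum>t=1..T. Q * (state r t \<omega>)\<^sup>2 + R * (control r t \<omega>)\<^sup>2)) \<partial>M) / ereal (real T)"

text \<open>\<open>r T\<close> is the run over horizon \<open>T\<close>.\<close>

definition average_cost ::
  "'a measure \<Rightarrow> real \<Rightarrow> real \<Rightarrow> real \<Rightarrow> (nat \<Rightarrow> ('a, 'z) loop_scheme) \<Rightarrow> ereal" where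
  "average_cost M F Q R r = limsup (\<lambda>T. horizon_cost M F Q R T (r T))"

definition stabilized :: "'a measure \<Rightarrow> (nat \<Rightarrow> ('a, 'z) loop_scheme) \<Rightarrow> bool" where
  "stabilized M r \<longleftrightarrow>
     (\<exists>B::real. \<forall>T\<ge>1. \<forall>t\<le>T + 1. (\<integral>\<^sup>+ \<omega>. ennreal ((state (r T) t \<omega>)\<^sup>2) \<partial>M) \<le> ennreal B)"

text \<open>
  The cost achievable at the observer is the infimum over all causal control laws acting on the
  observer's estimates; the law may also depend on the horizon.
\<close>

definition observer_controlled ::
  "'a measure \<Rightarrow> real \<Rightarrow> real \<Rightarrow> real \<Rightarrow> real \<Rightarrow> ('a \<Rightarrow> real) \<Rightarrow> (nat \<Rightarrow> 'a \<Rightarrow> real)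
    \<Rightarrow> (nat \<Rightarrow> 'a \<Rightarrow> real) \<Rightarrow> nat \<Rightarrow> 'a loop \<Rightarrow> bool" where
  "observer_controlled M \<alpha> W V P0 x0 w v T r \<longleftrightarrow>
     plant_and_observer M \<alpha> W V P0 x0 w v T r \<and>
     (\<exists>\<phi>. \<forall>t\<in>{1..T}.
        \<phi> t \<in> borel_measurable (Pi\<^sub>M {1..t} (\<lambda>_. borel)) \<and>
        (\<forall>\<omega>\<in>space M. control r t \<omega> = \<phi> t (\<lambda>i\<in>{1..t}. obs_est r i \<omega>)))"

definition observer_cost ::
  "'a measure \<Rightarrow> real \<Rightarrow> real \<Rightarrow> real \<Rightarrow> real \<Rightarrow> real \<Rightarrow> real \<Rightarrow> real \<Rightarrow> ('a \<Rightarrow> real)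
    \<Rightarrow> (nat \<Rightarrow> 'a \<Rightarrow> real) \<Rightarrow> (nat \<Rightarrow> 'a \<Rightarrow> real) \<Rightarrow> ereal" where
  "observer_cost M \<alpha> W V P0 F Q R x0 w v =
     Inf {average_cost M F Q R r | r. \<forall>T\<ge>1. observer_controlled M \<alpha> W V P0 x0 w v T (r T)}"

definition observer_lqg_controlled ::
  "'a measure \<Rightarrow> real \<Rightarrow> real \<Rightarrow> real \<Rightarrow> real \<Rightarrow> real \<Rightarrow> real \<Rightarrow> real \<Rightarrow> ('a \<Rightarrow> real)
    \<Rightarrow> (nat \<Rightarrow> 'a \<Rightarrow> real) \<Rightarrow> (nat \<Rightarrow> 'a \<Rightarrow> real) \<Rightarrow> nat \<Rightarrow> 'a loop \<Rightarrow> bool" where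
  "observer_lqg_controlled M \<alpha> W V P0 F Q R x0 w v T r \<longleftrightarrow>
     plant_and_observer M \<alpha> W V P0 x0 w v T r \<and>
     (\<forall>\<omega>\<in>space M. \<forall>t\<in>{1..T}. control r t \<omega> = - lqg_gain \<alpha> F Q R T t * obs_est r t \<omega>)"

record 'a coded_loop = "'a loop" +
  rcv_pred :: "nat \<Rightarrow> 'a \<Rightarrow> real"
  rcv_est :: "nat \<Rightarrow> 'a \<Rightarrow> real"
  source :: "nat \<Rightarrow> 'a \<Rightarrow> real"
  norm_source :: "nat \<Rightarrow> 'a \<Rightarrow> real"
  chan_in :: "nat \<Rightarrow> nat \<Rightarrow> 'a \<Rightarrow> real"
  chan_out :: "nat \<Rightarrow> nat \<Rightarrow> 'a \<Rightarrow> real"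
  norm_source_est :: "nat \<Rightarrow> 'a \<Rightarrow> real"
  source_est :: "nat \<Rightarrow> 'a \<Rightarrow> real"

text \<open>
  \<open>enc t s i\<close> is the \<open>i\<close>-th channel input for the source value \<open>s\<close> at time \<open>t\<close>, and \<open>dec t\<close> maps
  the \<open>KC\<close> channel outputs at time \<open>t\<close> to an estimate of the source value.
\<close>

definition coding_and_control ::
  "'a measure \<Rightarrow> real \<Rightarrow> real \<Rightarrow> real \<Rightarrow> real \<Rightarrow> real \<Rightarrow> real \<Rightarrow> real \<Rightarrow> nat \<Rightarrow> real
    \<Rightarrow> ('a \<Rightarrow> real) \<Rightarrow> (nat \<Rightarrow> 'a \<Rightarrow> real) \<Rightarrow> (nat \<Rightarrow> 'a \<Rightarrow> real) \<Rightarrow> (nat \<Rightarrow> nat \<Rightarrow> 'a \<Rightarrow> real)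
    \<Rightarrow> (nat \<Rightarrow> real \<Rightarrow> nat \<Rightarrow> real) \<Rightarrow> (nat \<Rightarrow> (nat \<Rightarrow> real) \<Rightarrow> real)
    \<Rightarrow> nat \<Rightarrow> 'a coded_loop \<Rightarrow> bool" where
  "coding_and_control M \<alpha> W V P0 F Q R KC SDR x0 w v n enc dec T r \<longleftrightarrow>
     plant_and_observer M \<alpha> W V P0 x0 w v T r \<and>
     (\<forall>\<omega>\<in>space M.
        rcv_est r 0 \<omega> = 0 \<and>
        (\<forall>t\<in>{1..T}.
           let c = sqrt (rcv_pred_mse \<alpha> W V P0 SDR t - kf_filt_mse \<alpha> W V P0 t) in
           rcv_pred r t \<omega> = \<alpha> * rcv_est r (t - 1) \<omega> + control r (t - 1) \<omega> \<and>
           source r t \<omega> = obs_est r t \<omega> - rcv_pred r t \<omega> \<and>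
           norm_source r t \<omega> = source r t \<omega> / c \<and>
           (\<forall>i<KC. chan_in r t i \<omega> = enc t (norm_source r t \<omega>) i \<and>
                   chan_out r t i \<omega> = chan_in r t i \<omega> + n t i \<omega>) \<and>
           norm_source_est r t \<omega> = dec t (\<lambda>i\<in>{..<KC}. chan_out r t i \<omega>) \<and>
           source_est r t \<omega> = c * norm_source_est r t \<omega> \<and>
           rcv_est r t \<omega> = rcv_pred r t \<omega> + SDR / (1 + SDR) * source_est r t \<omega> \<and>
           control r t \<omega> = - lqg_gain \<alpha> F Q R T t * rcv_est r t \<omega>))"

definition power_constraint :: "'a measure \<Rightarrow> nat \<Rightarrow> nat \<Rightarrow> 'a coded_loop \<Rightarrow> bool" where
  "power_constraint M KC T r \<longleftrightarrow>
     (\<forall>t\<in>{1..T}. (\<Sum>i<KC. \<integral>\<^sup>+ \<omega>. ennreal ((chan_in r t i \<omega>)\<^sup>2) \<partial>M) / of_nat KC \<le> 1)"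

text \<open>
  The channel noise of sample \<open>t\<close> is independent of the code's input at time \<open>t\<close>, so the mean
  square of the effective noise given the input value \<open>s\<close> is the integral, over the channel noise
  alone, with \<open>s\<close> held fixed.  In the unbiasedness condition integrability is not at stake: the
  input has a finite second moment in every run of the scheme, and the distortion bound gives
  the effective noise one.
\<close>

definition bounded_distortion_code ::
  "'a measure \<Rightarrow> nat \<Rightarrow> real \<Rightarrow> (nat \<Rightarrow> nat \<Rightarrow> 'a \<Rightarrow> real)
    \<Rightarrow> (nat \<Rightarrow> real \<Rightarrow> nat \<Rightarrow> real) \<Rightarrow> (nat \<Rightarrow> (nat \<Rightarrow> real) \<Rightarrow> real)
    \<Rightarrow> nat \<Rightarrow> 'a coded_loop \<Rightarrow> bool" where
  "bounded_distortion_code M KC SDR n enc dec T r \<longleftrightarrow>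
     (\<forall>t\<in>{1..T}.
        (\<forall>i<KC. (\<lambda>s. enc t s i) \<in> borel_measurable borel) \<and>
        dec t \<in> borel_measurable (Pi\<^sub>M {..<KC} (\<lambda>_. borel)) \<and>
        (\<integral>\<omega>. norm_source r t \<omega> * (norm_source_est r t \<omega> - norm_source r t \<omega>) \<partial>M) = 0 \<and>
        (\<forall>s. (\<integral>\<^sup>+ \<omega>. ennreal ((dec t (\<lambda>i\<in>{..<KC}. enc t s i + n t i \<omega>) - s)\<^sup>2) \<partial>M)
               \<le> ennreal (1 / SDR)))"

end

theory Submission
  imports Defs
begin

text \<open>
  The estimation error \<open>x - x\<^sup>t\<close> of the observer does not depend on the controls, and Gaussianity
  makes it independent of everything the observer and the controller know. Completing the square
  in the Riccati recursion therefore writes the expected cost of every run as a term that no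
  control law can influence plus a weighted sum of \<open>E (u + L x\<^sup>t)\<^sup>2\<close>. This sum vanishes for the LQG law, which
  settles the cost at the observer. In the coded loop \<open>u + L x\<^sup>t = L d\<close>, where \<open>d = x\<^sup>t - x\<^sup>r\<close>; unbiasedness and
  the distortion bound give \<open>E d\<^sup>2 \<le> (P\<^sup>r - Pbar\<^sup>t) / (1 + SDR)\<close> at each time, the right-hand side obeys a
  linear recursion with factor \<open>\<alpha>\<^sup>2 / (1 + SDR) < 1\<close>, and a Cesaro argument for the time-reversed
  Riccati weights gives the limit.
\<close>

subsection \<open>Riccati recursions and Cesaro means\<close>


text \<open>Independence is obtained at the level of the noises instead: step by step the primary
  noises are traded for an equivalent independent family made of the current filter error, the
  innovations and the noises still untouched. Every estimate and control of either loop is a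
  measurable function of innovations and channel noises only. Stability does not follow from the
  cost bound, since a time average controls no single stage and \<open>Q\<close> may vanish. It
  rests on the closed-loop factor \<alpha> - L_t = \<alpha> R / (S_{t+1} + R), whose limit is at
  most 1/\<alpha> by the Riccati fixed-point equation. Near the end of the horizon the gains can be
  far from their limit, but only during a number of steps that does not depend on T. In the excess
  cost, Q + (\<alpha>^2 - 1) S is the limit of (S_{t+1} + R) L_t^2, and the denominator is (1 + SDR)
  times 1 - \<alpha>^2 / (1 + SDR).\<close>

lemma cesaro_mean:
  fixes a :: "nat \<Rightarrow> real"
  assumes "a \<longlonglongrightarrow> l"
  shows "(\<lambda>T. (\<Sum>t<T. a t) / real T) \<longlonglongrightarrow> l"
proof (rule LIMSEQ_I)
  fix e :: real assume e: "e > 0"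
  obtain N where N: "\<And>n. n \<ge> N \<Longrightarrow> \<bar>a n - l\<bar> < e / 2"
    using LIMSEQ_D[OF assms, of "e/2"] e by auto
  define C where "C = (\<Sum>t<N. \<bar>a t - l\<bar>)"
  obtain N' :: nat where N': "real N' > 2 * C / e" using reals_Archimedean2 by blast
  have C0: "C \<ge> 0" unfolding C_def by (simp add: sum_nonneg)
  show "\<exists>no. \<forall>n\<ge>no. norm ((\<Sum>t<n. a t) / real n - l) < e"
  proof (intro exI allI impI)
    fix T assume T: "T \<ge> Suc (N + N')"
    then have T0: "real T > 0" by simp
    have "(\<Sum>t<T. a t) / real T - l = (\<Sum>t<T. a t - l) / real T"
      using T0 by (simp add: sum_subtractf field_simps)
    then have "\<bar>(\<Sum>t<T. a t) / real T - l\<bar> = \<bar>\<Sum>t<T. a t - l\<bar> / real T"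
      using T0 by simp
    also have "\<dots> \<le> (\<Sum>t<T. \<bar>a t - l\<bar>) / real T"
      using T0 by (intro divide_right_mono sum_abs) auto
    also have "(\<Sum>t<T. \<bar>a t - l\<bar>) = C + (\<Sum>t=N..<T. \<bar>a t - l\<bar>)"
      unfolding C_def using T by (subst sum.atLeastLessThan_concat[of 0 N T, symmetric, unfolded atLeast0LessThan]) auto
    also have "(\<Sum>t=N..<T. \<bar>a t - l\<bar>) \<le> (\<Sum>t=N..<T. e/2)"
      using N by (intro sum_mono) (auto intro: less_imp_le)
    also have "\<dots> = real (T - N) * (e/2)" by simp
    also have "\<dots> \<le> real T * (e/2)" using e by (intro mult_right_mono) auto
    finally have "\<bar>(\<Sum>t<T. a t) / real T - l\<bar> \<le> (C + real T * (e/2)) / real T"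
      using T0 by (simp add: divide_right_mono)
    also have "\<dots> = C / real T + e/2" using T0 by (simp add: field_simps)
    also have "C / real T < e/2"
    proof -
      have "2 * C / e < real T" using N' T by linarith
      then show ?thesis using e T0 by (simp add: field_simps)
    qed
    finally show "norm ((\<Sum>t<T. a t) / real T - l) < e" by simp
  qed
qed

lemma sum_time_reversed: "(\<Sum>t=1..T. f (T - t)) = (\<Sum>t<T. f t)" for f :: "nat \<Rightarrow> real"
  by (rule sum.reindex_bij_witness[of _ "\<lambda>t. T - t" "\<lambda>t. T - t"]) auto

text \<open>Riccati weights are read backwards from the horizon, error variances forwards. Splitting
  a summand minus \<open>la * lb\<close> into \<open>(a - la) * b + la * (b - lb)\<close>, with
  \<open>b\<close> bounded, leaves two plain Cesaro means of null sequences; reversing time in the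
  first does not change its sum.\<close>

lemma cesaro_convolution:
  fixes a b :: "nat \<Rightarrow> real"
  assumes a: "a \<longlonglongrightarrow> la" and b: "b \<longlonglongrightarrow> lb"
  shows "(\<lambda>T. (\<Sum>t=1..T. a (T - t) * b t) / real T) \<longlonglongrightarrow> la * lb"
proof -
  obtain B where B: "\<And>n. \<bar>b n\<bar> \<le> B"
    using convergent_imp_Bseq[OF convergentI[OF b]] by (auto simp: Bseq_def)
  have B0: "B \<ge> 0" using B[of 0] by linarith
  let ?g = "\<lambda>T. B * ((\<Sum>t<T. \<bar>a t - la\<bar>) / real T) + \<bar>la\<bar> * ((\<Sum>t<T. \<bar>b (Suc t) - lb\<bar>) / real T)"
  have "(\<lambda>t. \<bar>a t - la\<bar>) \<longlonglongrightarrow> 0" using a by (simp add: LIM_zero_iff tendsto_rabs_zero)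
  moreover have "(\<lambda>t. \<bar>b (Suc t) - lb\<bar>) \<longlonglongrightarrow> 0"
    using LIMSEQ_Suc[OF b] by (simp add: LIM_zero_iff tendsto_rabs_zero)
  ultimately have "?g \<longlonglongrightarrow> B * 0 + \<bar>la\<bar> * 0"
    by (intro tendsto_add tendsto_mult tendsto_const cesaro_mean)
  then have g: "?g \<longlonglongrightarrow> 0" by simp
  have "(\<lambda>T. (\<Sum>t=1..T. a (T - t) * b t) / real T - la * lb) \<longlonglongrightarrow> 0"
  proof (rule Lim_null_comparison[OF _ g], rule eventually_sequentiallyI[of 1])
    fix T :: nat assume T: "1 \<le> T"
    then have T0: "real T > 0" by simp
    have "(\<Sum>t=1..T. a (T - t) * b t) / real T - la * lb
        = (\<Sum>t=1..T. (a (T - t) - la) * b t + la * (b t - lb)) / real T"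
      using T0 by (simp add: field_simps sum.distrib sum_subtractf)
    also have "\<bar>\<dots>\<bar> \<le> (\<Sum>t=1..T. B * \<bar>a (T - t) - la\<bar> + \<bar>la\<bar> * \<bar>b t - lb\<bar>) / real T"
    proof -
      have "\<bar>(a (T - t) - la) * b t + la * (b t - lb)\<bar> \<le> B * \<bar>a (T - t) - la\<bar> + \<bar>la\<bar> * \<bar>b t - lb\<bar>" for t
      proof -
        have "\<bar>(a (T - t) - la) * b t + la * (b t - lb)\<bar> \<le> \<bar>(a (T - t) - la) * b t\<bar> + \<bar>la * (b t - lb)\<bar>"
          by (rule abs_triangle_ineq)
        also have "\<bar>(a (T - t) - la) * b t\<bar> \<le> B * \<bar>a (T - t) - la\<bar>"
          using mult_left_mono[OF B[of t], of "\<bar>a (T - t) - la\<bar>"] by (simp add: abs_mult mult.commute)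
        finally show ?thesis by (simp add: abs_mult)
      qed
      then show ?thesis using T0
        by (simp add: divide_right_mono order_trans[OF sum_abs sum_mono])
    qed
    also have "\<dots> = ?g T"
    proof -
      have "(\<Sum>t=1..T. \<bar>a (T - t) - la\<bar>) = (\<Sum>t<T. \<bar>a t - la\<bar>)"
        by (rule sum_time_reversed)
      moreover have "(\<Sum>t=1..T. \<bar>b t - lb\<bar>) = (\<Sum>t<T. \<bar>b (Suc t) - lb\<bar>)"
        by (rule sum.reindex_bij_witness[of _ Suc "\<lambda>t. t - 1"]) auto
      ultimately show ?thesis
        by (simp add: sum.distrib sum_distrib_left[symmetric] add_divide_distrib)
    qed
    finally show "norm ((\<Sum>t=1..T. a (T - t) * b t) / real T - la * lb) \<le> ?g T" by simp
  qed
  then show ?thesis by (simp add: LIM_zero_iff)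
qed

lemma affine_recursion_tendsto:
  fixes g b :: "nat \<Rightarrow> real"
  assumes rec: "\<And>t. g (Suc t) = \<rho> * g t + b t" and "0 \<le> \<rho>" "\<rho> < 1" and b: "b \<longlonglongrightarrow> lb"
  shows "g \<longlonglongrightarrow> lb / (1 - \<rho>)"
proof -
  define l where "l = lb / (1 - \<rho>)"
  define h where "h t = \<bar>g t - l\<bar>" for t
  have l: "l = \<rho> * l + lb" using assms(3) by (simp add: l_def field_simps)
  have h: "h (Suc t) \<le> \<rho> * h t + \<bar>b t - lb\<bar>" for t
  proof -
    have "g (Suc t) - l = \<rho> * (g t - l) + (b t - lb)"
      using rec[of t] l by (simp add: algebra_simps)
    then have "h (Suc t) \<le> \<bar>\<rho> * (g t - l)\<bar> + \<bar>b t - lb\<bar>" unfolding h_def by simp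
    then show ?thesis using assms(2) by (simp add: abs_mult h_def)
  qed
  have "h \<longlonglongrightarrow> 0"
  proof (rule LIMSEQ_I)
    fix e :: real assume e: "e > 0"
    \<comment> \<open>With this threshold \<open>e / 2\<close> is the equilibrium of the recursion
      for \<open>h\<close>, so from \<open>N\<close> on the excess over \<open>e / 2\<close> decays
      geometrically.\<close>
    obtain N where N: "\<And>n. n \<ge> N \<Longrightarrow> \<bar>b n - lb\<bar> < (1 - \<rho>) * (e / 2)"
      using LIMSEQ_D[OF b, of "(1 - \<rho>) * (e / 2)"] e assms(3) by auto
    have k: "h (N + k) \<le> \<rho> ^ k * h N + e / 2" for k
    proof (induction k)
      case (Suc k)
      have "h (N + Suc k) \<le> \<rho> * h (N + k) + \<bar>b (N + k) - lb\<bar>" using h[of "N + k"] by simp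
      also have "\<dots> \<le> \<rho> * (\<rho> ^ k * h N + e / 2) + (1 - \<rho>) * (e / 2)"
        using Suc assms(2) N[of "N + k"] by (intro add_mono mult_left_mono) auto
      finally show ?case by (simp add: algebra_simps add_divide_distrib diff_divide_distrib)
    qed (use e in simp)
    have "(\<lambda>k. \<rho> ^ k * h N) \<longlonglongrightarrow> 0 * h N"
      using assms by (intro tendsto_mult tendsto_const LIMSEQ_power_zero) auto
    then obtain K where K: "\<And>k. k \<ge> K \<Longrightarrow> \<bar>\<rho> ^ k * h N\<bar> < e / 2"
      using LIMSEQ_D[of "\<lambda>k. \<rho> ^ k * h N" 0 "e/2"] e by auto
    show "\<exists>no. \<forall>n\<ge>no. norm (h n - 0) < e"
    proof (intro exI allI impI)
      fix n assume n: "n \<ge> N + K"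
      then have "h n \<le> \<rho> ^ (n - N) * h N + e/2" using k[of "n - N"] by simp
      also have "\<rho> ^ (n - N) * h N < e/2" using K[of "n - N"] n by linarith
      finally show "norm (h n - 0) < e" by (simp add: h_def)
    qed
  qed
  then show ?thesis unfolding h_def l_def by (simp add: tendsto_rabs_zero_iff LIM_zero_iff)
qed

section \<open>Convergence of the scalar Riccati recursion\<close>

lemma riccati_fixed_point:
  fixes S :: real
  assumes "S > 0" "R \<ge> 0" "S\<^sup>2 - (Q + (\<alpha>\<^sup>2 - 1) * R) * S - Q * R = 0"
  shows "S = \<alpha>\<^sup>2 * R * S / (S + R) + Q"
proof -
  have "S + R > 0" using assms by linarith
  moreover have "S * (S + R) = \<alpha>\<^sup>2 * R * S + Q * (S + R)"
    using assms(3) by (simp add: algebra_simps power2_eq_square)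
  ultimately show ?thesis by (simp add: field_simps)
qed

text \<open>The Riccati map is increasing, and its quotient by the argument, \<alpha>^2 R / (s + R)
  + Q / s, is nonincreasing with value 1 at \<open>S\<close>; hence it does not decrease a positive
  value below \<open>S\<close>. The bound keeps the iterates away from 0, which is a second fixed
  point when \<open>Q = 0\<close>.\<close>

lemma riccati_lower_bound:
  assumes S: "S > 0" "S\<^sup>2 - (Q + (\<alpha>\<^sup>2 - 1) * R) * S - Q * R = 0"
    and "R \<ge> 0" "Q \<ge> 0" "F > 0"
  shows "min F S \<le> riccati \<alpha> F Q R k"
proof (induction k)
  case (Suc k)
  let ?s = "riccati \<alpha> F Q R k" and ?m = "min F S"
  have m: "?m > 0" using assms by simp
  have fix1: "S = \<alpha>\<^sup>2 * R * S / (S + R) + Q" by (rule riccati_fixed_point) fact+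
  have mono: "x / (x + R) \<le> y / (y + R)" if "0 < x" "x \<le> y" for x y
    using that assms by (simp add: field_simps mult_left_mono)
  have "?m \<le> \<alpha>\<^sup>2 * R * (?m / (?m + R)) + Q"
  proof -
    have sR: "?m + R \<le> S + R" "?m + R > 0" "S + R > 0" using m assms by auto
    have "S * (\<alpha>\<^sup>2 * R / (S + R) + Q / S) = \<alpha>\<^sup>2 * R * S / (S + R) + Q"
      using S by (simp add: distrib_left mult_ac)
    then have "S * (\<alpha>\<^sup>2 * R / (S + R) + Q / S) = S * 1" using fix1 by linarith
    then have "1 = \<alpha>\<^sup>2 * R / (S + R) + Q / S" using S by (simp only: mult_left_cancel)
    also have "\<dots> \<le> \<alpha>\<^sup>2 * R / (?m + R) + Q / ?m"
      using sR m assms by (intro add_mono divide_left_mono) auto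
    finally have "?m * 1 \<le> ?m * (\<alpha>\<^sup>2 * R / (?m + R) + Q / ?m)" using m by (intro mult_left_mono) auto
    then show ?thesis using m by (simp add: distrib_left mult_ac)
  qed
  also have "\<dots> \<le> \<alpha>\<^sup>2 * R * (?s / (?s + R)) + Q"
    using mono[OF m Suc] assms by (intro add_mono mult_left_mono) auto
  finally show ?case by simp
qed simp

lemma riccati_pos:
  assumes "S > 0" "S\<^sup>2 - (Q + (\<alpha>\<^sup>2 - 1) * R) * S - Q * R = 0"
    and "R \<ge> 0" "Q \<ge> 0" "F > 0"
  shows "riccati \<alpha> F Q R k > 0"
  using riccati_lower_bound[OF assms, of k] assms by (simp add: min_def split: if_splits)

text \<open>One step multiplies the distance to \<open>S\<close> by \<alpha>^2 R / (S + R) times R /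
  (s + R). The first factor is at most 1 by the fixed-point equation (and equals 1 if
  \<open>Q = 0\<close>), so the contraction has to come from the second, which the lower bound on
  the iterates keeps below 1.\<close>

lemma riccati_tendsto:
  assumes S: "S > 0" "S\<^sup>2 - (Q + (\<alpha>\<^sup>2 - 1) * R) * S - Q * R = 0"
    and "R \<ge> 0" "Q \<ge> 0" "F > 0"
  shows "riccati \<alpha> F Q R \<longlonglongrightarrow> S"
proof -
  define m where "m = min F S"
  define \<rho> where "\<rho> = R / (m + R)"
  have m: "m > 0" using assms by (simp add: m_def)
  have \<rho>: "0 \<le> \<rho>" "\<rho> < 1" using m assms by (auto simp: \<rho>_def field_simps)
  have fix1: "S = \<alpha>\<^sup>2 * R * S / (S + R) + Q" by (rule riccati_fixed_point) fact+
  have SR: "S + R > 0" using assms by linarith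
  have contr: "\<alpha>\<^sup>2 * R / (S + R) \<le> 1"
  proof -
    have "\<alpha>\<^sup>2 * R / (S + R) * S \<le> 1 * S" using fix1 assms by simp
    then show ?thesis using S by (simp only: mult_le_cancel_right_pos)
  qed
  have step: "\<bar>riccati \<alpha> F Q R (Suc k) - S\<bar> \<le> \<rho> * \<bar>riccati \<alpha> F Q R k - S\<bar>" for k
  proof -
    let ?s = "riccati \<alpha> F Q R k"
    have s: "m \<le> ?s" unfolding m_def by (rule riccati_lower_bound) fact+
    then have sR: "?s + R > 0" "m + R > 0" using m assms by auto
    have "riccati \<alpha> F Q R (Suc k) - S = \<alpha>\<^sup>2 * R * ?s / (?s + R) - \<alpha>\<^sup>2 * R * S / (S + R)"
      using fix1 by simp
    also have "\<dots> = (\<alpha>\<^sup>2 * R / (S + R)) * (R / (?s + R)) * (?s - S)"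
      using sR SR by (simp add: field_simps)
    finally have "\<bar>riccati \<alpha> F Q R (Suc k) - S\<bar> = \<bar>\<alpha>\<^sup>2 * R / (S + R)\<bar> * \<bar>R / (?s + R)\<bar> * \<bar>?s - S\<bar>"
      by (simp add: abs_mult)
    also have "\<bar>\<alpha>\<^sup>2 * R / (S + R)\<bar> = \<alpha>\<^sup>2 * R / (S + R)" using assms SR by simp
    also have "\<bar>R / (?s + R)\<bar> = R / (?s + R)" using assms sR by simp
    also have "\<alpha>\<^sup>2 * R / (S + R) * (R / (?s + R)) \<le> 1 * (R / (m + R))"
      using contr sR s assms SR by (intro mult_mono divide_left_mono) auto
    finally show ?thesis unfolding \<rho>_def by (simp add: mult_right_mono)
  qed
  have "\<bar>riccati \<alpha> F Q R k - S\<bar> \<le> \<rho> ^ k * \<bar>F - S\<bar>" for k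
  proof (induction k)
    case (Suc k)
    have "\<bar>riccati \<alpha> F Q R (Suc k) - S\<bar> \<le> \<rho> * (\<rho> ^ k * \<bar>F - S\<bar>)"
      using step[of k] mult_left_mono[OF Suc \<rho>(1)] by linarith
    then show ?case by (simp add: mult.assoc)
  qed simp
  then have "\<forall>\<^sub>F k in sequentially. norm (riccati \<alpha> F Q R k - S) \<le> \<rho> ^ k * \<bar>F - S\<bar>"
    by (intro always_eventually allI) (simp only: real_norm_def)
  moreover have "(\<lambda>k. \<rho> ^ k * \<bar>F - S\<bar>) \<longlonglongrightarrow> 0"
    using \<rho> by (intro tendsto_mult_left_zero LIMSEQ_power_zero) auto
  ultimately have "(\<lambda>k. riccati \<alpha> F Q R k - S) \<longlonglongrightarrow> 0"
    by (rule Lim_null_comparison)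
  then show ?thesis by (simp add: LIM_zero_iff)
qed

text \<open>Duality of filtering and control: the prediction error obeys the control Riccati
  recursion with \<open>W\<close> in the role of \<open>Q\<close> and \<open>V\<close> in that of
  \<open>R\<close>, so its convergence comes from the same lemma.\<close>

lemma kf_pred_mse_eq_riccati:
  assumes "W > 0" "V \<ge> 0" "P0 \<ge> 0"
  shows "kf_pred_mse \<alpha> W V P0 (Suc t) = riccati \<alpha> (\<alpha>\<^sup>2 * P0 + W) W V t
    \<and> kf_pred_mse \<alpha> W V P0 (Suc t) \<ge> W"
proof (induction t)
  case 0
  then show ?case using assms by simp
next
  case (Suc t)
  let ?p = "kf_pred_mse \<alpha> W V P0 (Suc t)"
  have p: "?p + V > 0" "?p > 0" using Suc assms by linarith+
  have "kf_pred_mse \<alpha> W V P0 (Suc (Suc t)) = \<alpha>\<^sup>2 * V * ?p / (?p + V) + W"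
    using p by (simp add: Let_def field_simps)
  moreover from this have "kf_pred_mse \<alpha> W V P0 (Suc (Suc t)) \<ge> W" using p assms by simp
  ultimately show ?case using Suc by simp
qed

text \<open>Made for finite-horizon gains: the factor depends on the remaining steps and contracts
  except during the last \<open>k0\<close> of them. The level \<open>D\<close> is preserved by
  contracting steps since \<open>\<sigma> * D + C \<le> D\<close>; each other step costs at most a
  factor \<open>\<Lambda> + 1\<close>, because \<open>C \<le> D\<close>. The resulting bound is free
  of \<open>T\<close>.\<close>

lemma stage_recursion_bounded:
  fixes a :: "nat \<Rightarrow> real"
  assumes rec: "\<And>t. 1 \<le> t \<Longrightarrow> t \<le> T \<Longrightarrow> a (Suc t) \<le> \<rho> (T - t) * a t + C"
    and a0: "\<And>t. t \<le> T + 1 \<Longrightarrow> 0 \<le> a t"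
    and r1: "\<And>k. k \<ge> k0 \<Longrightarrow> \<rho> k \<le> \<sigma>" and r2: "\<And>k. \<rho> k \<le> \<Lambda>"
    and "0 \<le> \<sigma>" "\<sigma> < 1" "\<Lambda> \<ge> 0" "0 \<le> C" and D: "a 1 \<le> D" "C \<le> (1 - \<sigma>) * D"
    and t: "1 \<le> t" "t \<le> T + 1"
  shows "a t \<le> D * (\<Lambda> + 1) ^ k0"
proof -
  have D0: "D \<ge> 0" using D(1) a0[of 1] by simp
  have CD: "C \<le> D"
  proof -
    have "(1 - \<sigma>) * D \<le> 1 * D" using D0 assms by (intro mult_right_mono) auto
    then show ?thesis using D by simp
  qed
  \<comment> \<open>The subtraction is truncated: the exponent stays 0 as long as the steps contract
    and grows by one with each later step.\<close>
  have "a t \<le> D * (\<Lambda> + 1) ^ (k0 - (T + 1 - t))"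
    using t
  proof (induction t rule: dec_induct)
    case base
    have "D * 1 \<le> D * (\<Lambda> + 1) ^ (k0 - (T + 1 - 1))"
      using D0 assms by (intro mult_left_mono one_le_power) auto
    then show ?case using D by simp
  next
    case (step t)
    let ?j = "k0 - (T + 1 - t)"
    have t: "1 \<le> t" "t \<le> T" using step by auto
    have IH: "a t \<le> D * (\<Lambda> + 1) ^ ?j" using step by simp
    have at: "0 \<le> a t" using a0[of t] t by simp
    show ?case
    proof (cases "T - t \<ge> k0")
      case True
      then have [simp]: "?j = 0" "k0 - (T + 1 - Suc t) = 0" by auto
      have "\<rho> (T - t) * a t + C \<le> \<sigma> * D + (1 - \<sigma>) * D"
        using True r1 at IH D assms by (intro add_mono mult_mono) auto
      then have "a (Suc t) \<le> D" using rec[of t] t by (simp add: algebra_simps)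
      then show ?thesis
        using \<open>k0 - (T + 1 - Suc t) = 0\<close> by (simp only: power_0 mult_1_right)
    next
      case False
      then have j: "k0 - (T + 1 - Suc t) = Suc ?j" using t by auto
      have "\<rho> (T - t) * a t + C \<le> \<Lambda> * (D * (\<Lambda> + 1) ^ ?j) + D * (\<Lambda> + 1) ^ ?j"
      proof (intro add_mono mult_mono)
        have "D * 1 \<le> D * (\<Lambda> + 1) ^ ?j"
          using D0 assms by (intro mult_left_mono one_le_power) auto
        then show "C \<le> D * (\<Lambda> + 1) ^ ?j" using CD by simp
      qed (use IH at assms r2 in auto)
      then show ?thesis using rec[of t] t unfolding j by (simp add: algebra_simps)
    qed
  qed
  also have "\<dots> \<le> D * (\<Lambda> + 1) ^ k0"
    using D0 assms by (intro mult_left_mono power_increasing) auto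
  finally show ?thesis .
qed

subsection \<open>Gaussian innovations\<close>


lemma (in prob_space) indep_varI_prob:
  assumes "random_variable N1 X" "random_variable N2 Y"
    and "\<And>A B. A \<in> sets N1 \<Longrightarrow> B \<in> sets N2 \<Longrightarrow>
      prob (X -` A \<inter> space M \<inter> (Y -` B \<inter> space M)) = prob (X -` A \<inter> space M) * prob (Y -` B \<inter> space M)"
  shows "indep_var N1 X N2 Y"
  unfolding indep_var_def indep_vars_def2
proof (intro conjI)
  have "indep_set {X -` A \<inter> space M |A. A \<in> sets N1} {Y -` A \<inter> space M |A. A \<in> sets N2}"
    using assms by (intro indep_setI) (auto intro: measurable_sets)
  then show "indep_sets (\<lambda>i. {case_bool X Y i -` A \<inter> space M |A. A \<in> sets (case_bool N1 N2 i)}) UNIV"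
    unfolding indep_set_def by (rule indep_sets_mono_sets) (auto split: bool.splits)
qed (use assms in \<open>auto split: bool.splits\<close>)

section \<open>Laws, multiples, sums and moments of centered Gaussians, point mass included\<close>

lemma centered_gaussian_pos:
  "s > 0 \<Longrightarrow> centered_gaussian s = density lborel (\<lambda>x. ennreal (normal_density 0 (sqrt s) x))"
  by (simp add: centered_gaussian_def)

lemma sets_centered_gaussian[simp, measurable_cong]: "sets (centered_gaussian s) = sets borel"
  by (simp add: centered_gaussian_def)

lemma (in prob_space) AE_eq_0_if_centered_gaussian_0:
  assumes [measurable]: "X \<in> borel_measurable M" and "distr M borel X = centered_gaussian 0"
  shows "AE \<omega> in M. X \<omega> = 0"
proof -
  have "AE x in distr M borel X. x = 0"
  proof -
    have "centered_gaussian 0 = return borel 0" by (simp add: centered_gaussian_def)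
    then show ?thesis unfolding assms(2) by (simp only:) (subst AE_return, auto)
  qed
  then show ?thesis by (subst (asm) AE_distr_iff) auto
qed

lemma (in prob_space) distr_cong_AE_borel:
  fixes X Y :: "'a \<Rightarrow> real"
  assumes "AE \<omega> in M. X \<omega> = Y \<omega>" "X \<in> borel_measurable M" "Y \<in> borel_measurable M"
  shows "distr M borel X = distr M borel Y"
  using assms by (intro distr_cong_AE) auto

lemma (in prob_space) distr_zero: "distr M borel (\<lambda>_. 0 :: real) = centered_gaussian 0"
  by (simp add: centered_gaussian_def distr_const)

lemma (in prob_space) distributed_centered_gaussian:
  assumes "X \<in> borel_measurable M" "distr M borel X = centered_gaussian s" "s > 0"
  shows "distributed M lborel X (\<lambda>x. ennreal (normal_density 0 (sqrt s) x))"
  using assms unfolding distributed_def by (simp add: centered_gaussian_pos cong: distr_cong)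

lemma (in prob_space) centered_gaussian_distributed:
  assumes "distributed M lborel X (\<lambda>x. ennreal (normal_density 0 (sqrt s) x))" "s > 0"
  shows "distr M borel X = centered_gaussian s"
proof -
  have "distr M borel X = distr M lborel X" by (rule distr_cong) auto
  then show ?thesis using assms by (simp add: distributed_def centered_gaussian_pos)
qed

lemma (in prob_space) centered_gaussian_scale:
  assumes X[measurable]: "X \<in> borel_measurable M" and d: "distr M borel X = centered_gaussian s" and "s \<ge> 0"
  shows "distr M borel (\<lambda>\<omega>. c * X \<omega>) = centered_gaussian (c\<^sup>2 * s)"
proof (cases "s = 0 \<or> c = 0")
  case True
  have "AE \<omega> in M. c * X \<omega> = 0"
    using True AE_eq_0_if_centered_gaussian_0[OF X] d by (cases "c = 0") auto
  then have "distr M borel (\<lambda>\<omega>. c * X \<omega>) = centered_gaussian 0"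
    by (subst distr_zero[symmetric]) (rule distr_cong_AE_borel, auto)
  then show ?thesis using True by auto
next
  case False
  then have "distributed M lborel (\<lambda>\<omega>. 0 + c * X \<omega>) (\<lambda>x. ennreal (normal_density (0 + c * 0) (\<bar>c\<bar> * sqrt s) x))"
    using assms by (intro normal_density_affine distributed_centered_gaussian) auto
  then show ?thesis
    using False assms by (intro centered_gaussian_distributed) (auto simp: real_sqrt_mult)
qed

lemma (in prob_space) centered_gaussian_add:
  assumes X[measurable]: "X \<in> borel_measurable M" and dX: "distr M borel X = centered_gaussian a" and "a \<ge> 0"
    and Y[measurable]: "Y \<in> borel_measurable M" and dY: "distr M borel Y = centered_gaussian b" and "b \<ge> 0"
    and ind: "indep_var borel X borel Y"
  shows "distr M borel (\<lambda>\<omega>. X \<omega> + Y \<omega>) = centered_gaussian (a + b)"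
proof (cases "a = 0 \<or> b = 0")
  case True
  then consider "a = 0" | "b = 0" by auto
  then show ?thesis
  proof cases
    case 1
    then have "AE \<omega> in M. X \<omega> = 0" using dX by (auto intro: AE_eq_0_if_centered_gaussian_0)
    then have "AE \<omega> in M. X \<omega> + Y \<omega> = Y \<omega>" by eventually_elim simp
    then have "distr M borel (\<lambda>\<omega>. X \<omega> + Y \<omega>) = distr M borel Y"
      by (rule distr_cong_AE_borel) auto
    then show ?thesis using 1 dY by simp
  next
    case 2
    then have "AE \<omega> in M. Y \<omega> = 0" using dY by (auto intro: AE_eq_0_if_centered_gaussian_0)
    then have "AE \<omega> in M. X \<omega> + Y \<omega> = X \<omega>" by eventually_elim simp
    then have "distr M borel (\<lambda>\<omega>. X \<omega> + Y \<omega>) = distr M borel X"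
      by (rule distr_cong_AE_borel) auto
    then show ?thesis using 2 dX by simp
  qed
next
  case False
  then have ab: "a > 0" "b > 0" using assms by auto
  have "distributed M lborel (\<lambda>\<omega>. X \<omega> + Y \<omega>)
      (\<lambda>x. ennreal (normal_density (0 + 0) (sqrt ((sqrt a)\<^sup>2 + (sqrt b)\<^sup>2)) x))"
    using ab assms by (intro add_indep_normal distributed_centered_gaussian) auto
  then show ?thesis
    using ab by (intro centered_gaussian_distributed) auto
qed

lemma (in prob_space) centered_gaussian_moments:
  assumes X[measurable]: "X \<in> borel_measurable M" and d: "distr M borel X = centered_gaussian s" and "s \<ge> 0"
  shows "integrable M (\<lambda>\<omega>. (X \<omega>)\<^sup>2)" "expectation X = 0" "expectation (\<lambda>\<omega>. (X \<omega>)\<^sup>2) = s"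
proof -
  have "integrable M (\<lambda>\<omega>. (X \<omega>)\<^sup>2) \<and> expectation X = 0 \<and> expectation (\<lambda>\<omega>. (X \<omega>)\<^sup>2) = s"
  proof (cases "s = 0")
    case True
    then have z: "AE \<omega> in M. X \<omega> = 0" using AE_eq_0_if_centered_gaussian_0[OF X] d by simp
    then have z2: "AE \<omega> in M. (X \<omega>)\<^sup>2 = 0" by eventually_elim simp
    have "integrable M (\<lambda>\<omega>. (X \<omega>)\<^sup>2)" by (subst integrable_cong_AE[OF _ _ z2]) auto
    moreover have "expectation X = expectation (\<lambda>_. 0)" by (rule integral_cong_AE) (use z in auto)
    moreover have "expectation (\<lambda>\<omega>. (X \<omega>)\<^sup>2) = expectation (\<lambda>_. 0)"
      by (rule integral_cong_AE) (use z2 in auto)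
    ultimately show ?thesis using True by simp
  next
    case False
    then have s: "s > 0" "sqrt s > 0" using assms by auto
    have D: "distributed M lborel X (\<lambda>x. ennreal (normal_density 0 (sqrt s) x))"
      using assms s by (intro distributed_centered_gaussian)
    note m2 = normal_moment_even[OF s(2), of 0 1] and m1 = normal_moment_odd[OF s(2), of 0 0]
    have "integrable lborel (\<lambda>x. normal_density 0 (sqrt s) x * x\<^sup>2)"
      using m2 by (auto simp: has_bochner_integral_iff)
    then have "integrable M (\<lambda>\<omega>. (X \<omega>)\<^sup>2)"
      using distributed_integrable[OF D, of "\<lambda>x. x\<^sup>2"] by simp
    moreover have "expectation X = 0"
      using distributed_integral[OF D, of "\<lambda>x. x"] m1 by (simp add: has_bochner_integral_iff)
    moreover have "expectation (\<lambda>\<omega>. (X \<omega>)\<^sup>2) = s"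
      using distributed_integral[OF D, of "\<lambda>x. x\<^sup>2"] m2 s by (simp add: has_bochner_integral_iff)
    ultimately show ?thesis by simp
  qed
  then show "integrable M (\<lambda>\<omega>. (X \<omega>)\<^sup>2)" "expectation X = 0" "expectation (\<lambda>\<omega>. (X \<omega>)\<^sup>2) = s" by auto
qed

text \<open>With z = x + y and e = x - K z, the coefficient \<open>K\<close> is the one that makes e
  and z uncorrelated, so the cross term in the exponent disappears: x^2/a + y^2/b = z^2/(a+b) +
  e^2/(K b). The residual variance is K b = a b / (a + b), which also matches the normalizing
  constants.\<close>

lemma normal_density_rotate:
  fixes a b :: real
  assumes "a > 0" "b > 0" and K: "K = a / (a + b)"
  shows "normal_density 0 (sqrt a) (e + K * z) * normal_density 0 (sqrt b) (z - (e + K * z))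
    = normal_density 0 (sqrt (a + b)) z * normal_density 0 (sqrt (K * b)) e"
proof -
  have ab: "a + b > 0" using assms by simp
  have Kb: "K * b > 0" using assms by simp
  have e1: "(e + K * z)\<^sup>2 / (2 * a) + (z - (e + K * z))\<^sup>2 / (2 * b) = z\<^sup>2 / (2 * (a + b)) + e\<^sup>2 / (2 * (K * b))"
  proof -
    define c where "c = a + b"
    have b: "b = c - a" and c: "c > 0" "c - a > 0" using assms by (auto simp: c_def)
    show ?thesis unfolding K c_def[symmetric] unfolding b using assms c
      by (simp add: divide_simps) (simp add: algebra_simps power2_eq_square)
  qed
  have e2: "sqrt (2 * pi * a) * sqrt (2 * pi * b) = sqrt (2 * pi * (a + b)) * sqrt (2 * pi * (K * b))"
    unfolding K real_sqrt_mult[symmetric] using ab by (simp add: field_simps)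
  have prod: "normal_density 0 (sqrt c) x * normal_density 0 (sqrt d) y
      = 1 / (sqrt (2 * pi * c) * sqrt (2 * pi * d)) * exp (- (x\<^sup>2 / (2 * c) + y\<^sup>2 / (2 * d)))"
    if "c > 0" "d > 0" for c d x y :: real
    using that unfolding normal_density_def by (simp add: exp_add[symmetric])
  show ?thesis
    unfolding prod[OF assms(1,2)] prod[OF ab Kb] e1 e2 ..
qed

lemma (in prob_space) nn_integral_indep_centered_gaussian:
  fixes X Y :: "'a \<Rightarrow> real" and H :: "real \<Rightarrow> real \<Rightarrow> ennreal"
  assumes X[measurable]: "X \<in> borel_measurable M" and dX: "distr M borel X = centered_gaussian a" and a: "a > 0"
    and Y[measurable]: "Y \<in> borel_measurable M" and dY: "distr M borel Y = centered_gaussian b" and b: "b > 0"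
    and ind: "indep_var borel X borel Y"
    and H[measurable]: "case_prod H \<in> borel_measurable (borel \<Otimes>\<^sub>M borel)"
  shows "(\<integral>\<^sup>+\<omega>. H (X \<omega>) (Y \<omega>) \<partial>M)
    = (\<integral>\<^sup>+x. \<integral>\<^sup>+y. ennreal (normal_density 0 (sqrt a) x * normal_density 0 (sqrt b) y) * H x y \<partial>lborel \<partial>lborel)"
proof -
  let ?f = "\<lambda>s x. ennreal (normal_density 0 (sqrt s) x)"
  have "distr M (borel \<Otimes>\<^sub>M borel) (\<lambda>\<omega>. (X \<omega>, Y \<omega>)) = centered_gaussian a \<Otimes>\<^sub>M centered_gaussian b"
    using ind dX dY by (simp add: indep_var_distribution_eq)
  also have "\<dots> = density (lborel \<Otimes>\<^sub>M lborel) (\<lambda>(x, y). ?f a x * ?f b y)"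
  proof -
    interpret B: prob_space "density lborel (?f b)" using b by (intro prob_space_normal_density) simp
    have "sigma_finite_measure (density lborel (?f b))" by unfold_locales
    then show ?thesis using a b by (simp add: centered_gaussian_pos pair_measure_density lborel.sigma_finite_measure_axioms)
  qed
  finally have D: "distr M (borel \<Otimes>\<^sub>M borel) (\<lambda>\<omega>. (X \<omega>, Y \<omega>)) = density (lborel \<Otimes>\<^sub>M lborel) (\<lambda>(x, y). ?f a x * ?f b y)" .
  have "(\<integral>\<^sup>+\<omega>. H (X \<omega>) (Y \<omega>) \<partial>M) = (\<integral>\<^sup>+z. case_prod H z \<partial>distr M (borel \<Otimes>\<^sub>M borel) (\<lambda>\<omega>. (X \<omega>, Y \<omega>)))"
    by (subst nn_integral_distr) auto
  also have "\<dots> = (\<integral>\<^sup>+z. (\<lambda>(x, y). ?f a x * ?f b y) z * case_prod H z \<partial>(lborel \<Otimes>\<^sub>M lborel))"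
    unfolding D by (subst nn_integral_density) auto
  also have "\<dots> = (\<integral>\<^sup>+x. \<integral>\<^sup>+y. ennreal (normal_density 0 (sqrt a) x * normal_density 0 (sqrt b) y) * H x y \<partial>lborel \<partial>lborel)"
    by (subst lborel.nn_integral_fst[symmetric]) (auto simp: ennreal_mult)
  finally show ?thesis .
qed

text \<open>The substitutions y = z - x and, after Fubini, x = e + K z have unit Jacobian and turn
  the joint density into the product of \<open>normal_density_rotate\<close>. Thus
  \<open>key\<close> factorizes the law on rectangles; taking \<open>UNIV\<close> for one side
  identifies the two marginals.\<close>

lemma (in prob_space) indep_innovation_residual_pos:
  fixes X Y :: "'a \<Rightarrow> real"
  assumes X[measurable]: "X \<in> borel_measurable M" and dX: "distr M borel X = centered_gaussian a" and a: "a > 0"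
    and Y[measurable]: "Y \<in> borel_measurable M" and dY: "distr M borel Y = centered_gaussian b" and b: "b > 0"
    and ind: "indep_var borel X borel Y" and K: "K = a / (a + b)"
  shows "indep_var borel (\<lambda>\<omega>. X \<omega> - K * (X \<omega> + Y \<omega>)) borel (\<lambda>\<omega>. X \<omega> + Y \<omega>)"
proof -
  let ?N = "\<lambda>s x. normal_density 0 (sqrt s) x"
  have Kb: "K * b > 0" "a + b > 0" using a b K by auto
  have key: "emeasure M {\<omega>\<in>space M. X \<omega> - K * (X \<omega> + Y \<omega>) \<in> A \<and> X \<omega> + Y \<omega> \<in> B}
      = (\<integral>\<^sup>+e. ennreal (?N (K * b) e) * indicator A e \<partial>lborel) * (\<integral>\<^sup>+z. ennreal (?N (a + b) z) * indicator B z \<partial>lborel)"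
    if [measurable]: "A \<in> sets borel" "B \<in> sets borel" for A B
  proof -
    let ?H = "\<lambda>x y. indicator A (x - K * (x + y)) * indicator B (x + y) :: ennreal"
    have "emeasure M {\<omega>\<in>space M. X \<omega> - K * (X \<omega> + Y \<omega>) \<in> A \<and> X \<omega> + Y \<omega> \<in> B}
        = (\<integral>\<^sup>+\<omega>. ?H (X \<omega>) (Y \<omega>) \<partial>M)"
    proof -
      have "(\<integral>\<^sup>+\<omega>. ?H (X \<omega>) (Y \<omega>) \<partial>M)
          = (\<integral>\<^sup>+\<omega>. indicator {\<omega>\<in>space M. X \<omega> - K * (X \<omega> + Y \<omega>) \<in> A \<and> X \<omega> + Y \<omega> \<in> B} \<omega> \<partial>M)"
        by (rule nn_integral_cong) (auto split: split_indicator)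
      then show ?thesis by simp
    qed
    also have "\<dots> = (\<integral>\<^sup>+x. \<integral>\<^sup>+y. ennreal (?N a x * ?N b y) * ?H x y \<partial>lborel \<partial>lborel)"
      by (rule nn_integral_indep_centered_gaussian[OF X dX a Y dY b ind]) measurable
    also have "\<dots> = (\<integral>\<^sup>+x. \<integral>\<^sup>+z. ennreal (?N a x * ?N b (z - x)) * (indicator A (x - K * z) * indicator B z) \<partial>lborel \<partial>lborel)"
    proof (rule nn_integral_cong)
      fix x :: real
      show "(\<integral>\<^sup>+y. ennreal (?N a x * ?N b y) * ?H x y \<partial>lborel)
        = (\<integral>\<^sup>+z. ennreal (?N a x * ?N b (z - x)) * (indicator A (x - K * z) * indicator B z) \<partial>lborel)"
        by (subst nn_integral_real_affine[where c=1 and t="-x"]) auto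
    qed
    also have "\<dots> = (\<integral>\<^sup>+z. \<integral>\<^sup>+x. ennreal (?N a x * ?N b (z - x)) * (indicator A (x - K * z) * indicator B z) \<partial>lborel \<partial>lborel)"
      by (rule lborel_pair.Fubini') measurable
    also have "\<dots> = (\<integral>\<^sup>+z. \<integral>\<^sup>+e. ennreal (?N (a + b) z * ?N (K * b) e) * (indicator A e * indicator B z) \<partial>lborel \<partial>lborel)"
    proof (rule nn_integral_cong)
      fix z :: real
      show "(\<integral>\<^sup>+x. ennreal (?N a x * ?N b (z - x)) * (indicator A (x - K * z) * indicator B z) \<partial>lborel)
        = (\<integral>\<^sup>+e. ennreal (?N (a + b) z * ?N (K * b) e) * (indicator A e * indicator B z) \<partial>lborel)"
        by (subst nn_integral_real_affine[where c=1 and t="K * z"])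
           (auto simp: normal_density_rotate[OF a b K, symmetric] add.commute)
    qed
    also have "\<dots> = (\<integral>\<^sup>+z. (\<integral>\<^sup>+e. ennreal (?N (K * b) e) * indicator A e \<partial>lborel) * (ennreal (?N (a + b) z) * indicator B z) \<partial>lborel)"
      by (intro nn_integral_cong, subst nn_integral_multc[symmetric]) (auto simp: ennreal_mult mult_ac intro!: nn_integral_cong)
    also have "\<dots> = (\<integral>\<^sup>+e. ennreal (?N (K * b) e) * indicator A e \<partial>lborel) * (\<integral>\<^sup>+z. ennreal (?N (a + b) z) * indicator B z \<partial>lborel)"
      by (subst nn_integral_cmult) auto
    finally show ?thesis .
  qed
  have tot: "(\<integral>\<^sup>+e. ennreal (?N s e) * indicator UNIV e \<partial>lborel) = 1" if "s > 0" for s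
  proof -
    interpret D: prob_space "density lborel (\<lambda>x. ennreal (?N s x))"
      using that by (intro prob_space_normal_density) simp
    show ?thesis using D.emeasure_space_1 by (simp add: emeasure_density)
  qed
  show ?thesis
  proof (rule indep_varI_prob)
    fix A B :: "real set" assume [measurable]: "A \<in> sets borel" "B \<in> sets borel"
    have "emeasure M ((\<lambda>\<omega>. X \<omega> - K * (X \<omega> + Y \<omega>)) -` A \<inter> space M \<inter> ((\<lambda>\<omega>. X \<omega> + Y \<omega>) -` B \<inter> space M))
       = emeasure M ((\<lambda>\<omega>. X \<omega> - K * (X \<omega> + Y \<omega>)) -` A \<inter> space M) * emeasure M ((\<lambda>\<omega>. X \<omega> + Y \<omega>) -` B \<inter> space M)"
      using key[of A B] key[of A UNIV] key[of UNIV B] tot[OF Kb(1)] tot[OF Kb(2)]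
      by (simp add: vimage_def Int_def conj_ac)
    then show "prob ((\<lambda>\<omega>. X \<omega> - K * (X \<omega> + Y \<omega>)) -` A \<inter> space M \<inter> ((\<lambda>\<omega>. X \<omega> + Y \<omega>) -` B \<inter> space M))
       = prob ((\<lambda>\<omega>. X \<omega> - K * (X \<omega> + Y \<omega>)) -` A \<inter> space M) * prob ((\<lambda>\<omega>. X \<omega> + Y \<omega>) -` B \<inter> space M)"
      by (simp add: emeasure_eq_measure ennreal_mult[symmetric])
  qed simp_all
qed

text \<open>Serves the degenerate cases: the residual of a noise-free measurement, and the constants
  that fill used-up noise slots.\<close>

lemma (in prob_space) indep_var_const_AE:
  fixes X Y :: "'a \<Rightarrow> real"
  assumes [measurable]: "X \<in> borel_measurable M" "Y \<in> borel_measurable M" and z: "AE \<omega> in M. X \<omega> = c"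
  shows "indep_var borel X borel Y"
proof (rule indep_varI_prob)
  fix A B :: "real set" assume [measurable]: "A \<in> sets borel" "B \<in> sets borel"
  show "prob (X -` A \<inter> space M \<inter> (Y -` B \<inter> space M)) = prob (X -` A \<inter> space M) * prob (Y -` B \<inter> space M)"
  proof (cases "c \<in> A")
    case True
    have "prob (X -` A \<inter> space M) = prob (space M)"
      by (rule finite_measure_eq_AE) (use z True in auto)
    moreover have "prob (X -` A \<inter> space M \<inter> (Y -` B \<inter> space M)) = prob (Y -` B \<inter> space M)"
      by (rule finite_measure_eq_AE) (use z True in auto)
    ultimately show ?thesis by (simp add: prob_space)
  next
    case False
    have "prob (X -` A \<inter> space M) = prob {}"
      by (rule finite_measure_eq_AE) (use z False in auto)
    moreover have "prob (X -` A \<inter> space M \<inter> (Y -` B \<inter> space M)) = prob {}"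
      by (rule finite_measure_eq_AE) (use z False in auto)
    ultimately show ?thesis by simp
  qed
qed simp_all

text \<open>One scalar Kalman update: \<open>X\<close> is the prediction error, \<open>Y\<close> the
  measurement noise, \<open>K\<close> the gain and \<open>K * b\<close> the filtered error variance.
  For \<open>b = 0\<close> the gain is 1 and the residual vanishes almost surely, so no density is
  involved.\<close>

lemma (in prob_space) gaussian_innovation:
  fixes X Y :: "'a \<Rightarrow> real"
  assumes X[measurable]: "X \<in> borel_measurable M" and dX: "distr M borel X = centered_gaussian a" and a: "a > 0"
    and Y[measurable]: "Y \<in> borel_measurable M" and dY: "distr M borel Y = centered_gaussian b" and b: "b \<ge> 0"
    and ind: "indep_var borel X borel Y" and K: "K = a / (a + b)"
  shows "indep_var borel (\<lambda>\<omega>. X \<omega> - K * (X \<omega> + Y \<omega>)) borel (\<lambda>\<omega>. X \<omega> + Y \<omega>)"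
    and "distr M borel (\<lambda>\<omega>. X \<omega> - K * (X \<omega> + Y \<omega>)) = centered_gaussian (K * b)"
proof -
  have ab: "a + b > 0" using a b by simp
  show "indep_var borel (\<lambda>\<omega>. X \<omega> - K * (X \<omega> + Y \<omega>)) borel (\<lambda>\<omega>. X \<omega> + Y \<omega>)"
  proof (cases "b = 0")
    case True
    then have "AE \<omega> in M. Y \<omega> = 0" using dY by (auto intro: AE_eq_0_if_centered_gaussian_0)
    then have "AE \<omega> in M. X \<omega> - K * (X \<omega> + Y \<omega>) = 0"
      by eventually_elim (use True a K in simp)
    then show ?thesis by (intro indep_var_const_AE) auto
  next
    case False
    then show ?thesis using assms by (intro indep_innovation_residual_pos) auto
  qed
  have i2: "indep_var borel ((\<lambda>x. (1 - K) * x) \<circ> X) borel ((\<lambda>x. (- K) * x) \<circ> Y)"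
    by (rule indep_var_compose[OF ind]) auto
  have "distr M borel (\<lambda>\<omega>. (1 - K) * X \<omega> + (- K) * Y \<omega>) = centered_gaussian ((1 - K)\<^sup>2 * a + (- K)\<^sup>2 * b)"
    using i2 a b by (intro centered_gaussian_add centered_gaussian_scale dX dY) (auto simp: comp_def)
  also have "(1 - K)\<^sup>2 * a + (- K)\<^sup>2 * b = K * b"
  proof -
    have "K * (a + b) = a" using K ab by simp
    then have "K * (K * (a + b)) = K * a" by simp
    then show ?thesis using \<open>K * (a + b) = a\<close> by (simp add: power2_eq_square algebra_simps)
  qed
  finally show "distr M borel (\<lambda>\<omega>. X \<omega> - K * (X \<omega> + Y \<omega>)) = centered_gaussian (K * b)"
    by (simp add: algebra_simps)
qed

subsection \<open>Information sigma-algebras and square-integrable functions\<close>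


text \<open>The sigma-algebra generated by the variables indexed by \<open>A\<close>. Pulling back
  along the whole tuple makes independence of disjoint blocks available for arbitrary measurable
  functions of a block.\<close>

definition info :: "'a measure \<Rightarrow> 'i set \<Rightarrow> ('i \<Rightarrow> 'a \<Rightarrow> real) \<Rightarrow> 'a measure" where
  "info M A X = vimage_algebra (space M) (\<lambda>\<omega>. \<lambda>j\<in>A. X j \<omega>) (Pi\<^sub>M A (\<lambda>_. borel))"

lemma space_info[simp]: "space (info M A X) = space M"
  by (simp add: info_def)

lemma measurable_info_restrict: "(\<lambda>\<omega>. \<lambda>j\<in>A. X j \<omega>) \<in> measurable (info M A X) (Pi\<^sub>M A (\<lambda>_. borel))"
  unfolding info_def by (rule measurable_vimage_algebra1) (auto simp: space_PiM)

lemma measurable_info_component: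
  assumes "j \<in> A"
  shows "X j \<in> borel_measurable (info M A X)"
proof -
  have "(\<lambda>\<omega>. (\<lambda>j\<in>A. X j \<omega>) j) \<in> borel_measurable (info M A X)"
    by (rule measurable_compose[OF measurable_info_restrict measurable_component_singleton]) fact
  then show ?thesis using assms by simp
qed

lemma sets_info_subset:
  assumes "\<And>j. j \<in> A \<Longrightarrow> X j \<in> borel_measurable N" "space N = space M"
  shows "sets (info M A X) \<subseteq> sets N"
  unfolding info_def using assms by (intro sets_image_in_sets measurable_restrict) auto

lemma measurable_info_mono:
  assumes f: "f \<in> measurable (info M A X) S"
    and "\<And>j. j \<in> A \<Longrightarrow> X j \<in> borel_measurable N" and sp: "space N = space M"
  shows "f \<in> measurable N S"
proof -
  have "sets (info M A X) \<subseteq> sets N" by (rule sets_info_subset) fact+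
  then show ?thesis using f sp by (auto simp: measurable_def)
qed

context prob_space begin

lemma indep_set_info:
  assumes ind: "indep_vars (\<lambda>_. borel) X I" and AB: "A \<inter> B = {}" "A \<subseteq> I" "B \<subseteq> I"
  shows "indep_set (sets (info M A X)) (sets (info M B X))"
  using indep_var_restrict[OF ind AB] unfolding indep_var_eq info_def sets_vimage_algebra by auto

lemma indep_var_info:
  assumes ind: "indep_vars (\<lambda>_. borel) X I" and AB: "A \<inter> B = {}" "A \<subseteq> I" "B \<subseteq> I"
    and f: "f \<in> measurable (info M A X) S" and g: "g \<in> measurable (info M B X) T"
  shows "indep_var S f T g"
proof (rule indep_varI_prob)
  have X: "X j \<in> borel_measurable M" if "j \<in> I" for j
    using ind that by (auto simp: indep_vars_def2)
  show "random_variable S f" by (rule measurable_info_mono[OF f]) (use X AB in auto)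
  show "random_variable T g" by (rule measurable_info_mono[OF g]) (use X AB in auto)
  fix C D assume "C \<in> sets S" "D \<in> sets T"
  then have "f -` C \<inter> space M \<in> sets (info M A X)" "g -` D \<inter> space M \<in> sets (info M B X)"
    using measurable_sets[OF f] measurable_sets[OF g] by auto
  then show "prob (f -` C \<inter> space M \<inter> (g -` D \<inter> space M)) = prob (f -` C \<inter> space M) * prob (g -` D \<inter> space M)"
    by (rule indep_setD[OF indep_set_info[OF ind AB]])
qed

lemma indep_vars_pair:
  assumes ind: "indep_var borel (X i) borel (X j)" and "i \<noteq> j"
  shows "indep_vars (\<lambda>_. borel) X {i, j}"
  unfolding indep_vars_def2
proof (intro conjI indep_setsI)
  have rv: "X i \<in> borel_measurable M" "X j \<in> borel_measurable M"
    using ind by (auto simp: indep_var_eq)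
  then show rv': "\<forall>i\<in>{i, j}. random_variable borel (X i)" by simp
  show "{X k -` A \<inter> space M |A. A \<in> sets borel} \<subseteq> events" if "k \<in> {i, j}" for k
    using rv' that by auto
  fix A J assume J: "J \<noteq> {}" "J \<subseteq> {i, j}" "\<forall>k\<in>J. A k \<in> {X k -` A \<inter> space M |A. A \<in> sets borel}"
  then consider "J = {i}" | "J = {j}" | "J = {i, j}" by blast
  then show "prob (\<Inter>k\<in>J. A k) = (\<Prod>k\<in>J. prob (A k))"
  proof cases
    case 3
    then obtain B C where B: "A i = X i -` B \<inter> space M" "B \<in> sets borel"
      and C: "A j = X j -` C \<inter> space M" "C \<in> sets borel" using J by auto
    have "A i \<inter> A j = (\<lambda>\<omega>. (X i \<omega>, X j \<omega>)) -` (B \<times> C) \<inter> space M" using B C by auto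
    then show ?thesis using indep_varD[OF ind B(2) C(2)] 3 \<open>i \<noteq> j\<close> B C by simp
  qed simp_all
qed

text \<open>Changing variables inside a block does not disturb the rest. An event about finitely
  many new variables splits into a part determined by the old block and a part determined by its
  complement; these are independent, and each part factorizes by itself.\<close>

lemma indep_vars_replace_block:
  assumes ind: "indep_vars (\<lambda>_. borel) X I" and J: "J \<subseteq> I"
    and ind': "indep_vars (\<lambda>_. borel) X' J"
    and fn: "\<And>j. j \<in> J \<Longrightarrow> X' j \<in> borel_measurable (info M J X)"
    and same: "\<And>j. j \<in> I - J \<Longrightarrow> X' j = X j"
  shows "indep_vars (\<lambda>_. borel) X' I"
  unfolding indep_vars_def2
proof (intro conjI indep_setsI)
  have X: "X j \<in> borel_measurable M" if "j \<in> I" for j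
    using ind that by (auto simp: indep_vars_def2)
  have X': "X' j \<in> borel_measurable M" if "j \<in> I" for j
    using ind' X same that by (cases "j \<in> J") (auto simp: indep_vars_def2)
  then show "\<forall>i\<in>I. random_variable borel (X' i)" by simp
  show "{X' k -` A \<inter> space M |A. A \<in> sets borel} \<subseteq> events" if "k \<in> I" for k
    using X' that by auto
  fix A K assume K: "K \<noteq> {}" "K \<subseteq> I" "finite K" "\<forall>k\<in>K. A k \<in> {X' k -` A \<inter> space M |A. A \<in> sets borel}"
  then have "\<forall>k\<in>K. \<exists>B. A k = X' k -` B \<inter> space M \<and> B \<in> sets borel" by auto
  then obtain B where B: "\<And>k. k \<in> K \<Longrightarrow> A k = X' k -` B k \<inter> space M" "\<And>k. k \<in> K \<Longrightarrow> B k \<in> sets borel"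
    by metis
  have AX: "A k = X k -` B k \<inter> space M" if "k \<in> K - J" for k
    using B(1)[of k] same[of k] that K by auto
  \<comment> \<open>Intersecting with \<open>space M\<close> lets an empty index set yield the sure
    event; the bare intersection would be \<open>UNIV\<close>.\<close>
  define a where "a = space M \<inter> (\<Inter>k\<in>K \<inter> J. A k)"
  define b where "b = space M \<inter> (\<Inter>k\<in>K - J. A k)"
  have pa: "prob a = (\<Prod>k\<in>K \<inter> J. prob (A k))"
  proof (cases "K \<inter> J = {}")
    case False
    have "prob (\<Inter>k\<in>K \<inter> J. X' k -` B k \<inter> space M) = (\<Prod>k\<in>K \<inter> J. prob (X' k -` B k \<inter> space M))"
      using False K B by (intro indep_varsD[OF ind']) auto
    moreover have "a = (\<Inter>k\<in>K \<inter> J. X' k -` B k \<inter> space M)" using False B unfolding a_def by auto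
    ultimately show ?thesis using B by simp
  qed (simp add: a_def prob_space)
  have pb: "prob b = (\<Prod>k\<in>K - J. prob (A k))"
  proof (cases "K - J = {}")
    case False
    have "prob (\<Inter>k\<in>K - J. X k -` B k \<inter> space M) = (\<Prod>k\<in>K - J. prob (X k -` B k \<inter> space M))"
      using False K B by (intro indep_varsD[OF ind]) auto
    moreover have "b = (\<Inter>k\<in>K - J. X k -` B k \<inter> space M)" using False AX unfolding b_def by auto
    ultimately show ?thesis using AX by simp
  qed (simp only: b_def prob_space, simp add: prob_space)
  have "a \<in> sets (info M J X)"
  proof (cases "K \<inter> J = {}")
    case False
    then have "a = (\<Inter>k\<in>K \<inter> J. X' k -` B k \<inter> space (info M J X))" using B unfolding a_def by auto
    also have "\<dots> \<in> sets (info M J X)"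
      using False K B fn by (intro sets.finite_INT measurable_sets[where A=borel]) auto
    finally show ?thesis .
  next
    case True
    then have "a = space (info M J X)" by (simp add: a_def)
    then show ?thesis by (metis sets.top)
  qed
  moreover have "b \<in> sets (info M (I - J) X)"
  proof (cases "K - J = {}")
    case False
    then have "b = (\<Inter>k\<in>K - J. X k -` B k \<inter> space (info M (I - J) X))" using AX unfolding b_def by auto
    also have "\<dots> \<in> sets (info M (I - J) X)"
      using False K B by (intro sets.finite_INT measurable_sets[where A=borel] measurable_info_component) auto
    finally show ?thesis .
  next
    case True
    have "b = space (info M (I - J) X)" unfolding b_def True by simp
    then show ?thesis by (metis sets.top)
  qed
  ultimately have "prob (a \<inter> b) = prob a * prob b"
    by (intro indep_setD[OF indep_set_info[OF ind _ J Diff_subset]]) auto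
  also have "\<dots> = (\<Prod>k\<in>K. prob (A k))"
    unfolding pa pb using prod.union_disjoint[of "K \<inter> J" "K - J" "\<lambda>k. prob (A k)"] K
    by (simp add: Int_Diff_Un Int_Diff_disjoint)
  also have "a \<inter> b = (\<Inter>k\<in>K. A k)"
    using B K unfolding a_def b_def by blast
  finally show "prob (\<Inter>k\<in>K. A k) = (\<Prod>k\<in>K. prob (A k))" .
qed

end

section \<open>Square-integrable functions and orthogonality\<close>

definition sqint :: "'a measure \<Rightarrow> ('a \<Rightarrow> real) \<Rightarrow> bool" where
  "sqint M f \<longleftrightarrow> f \<in> borel_measurable M \<and> integrable M (\<lambda>\<omega>. (f \<omega>)\<^sup>2)"

lemma sqint_square: "sqint M f \<Longrightarrow> integrable M (\<lambda>\<omega>. (f \<omega>)\<^sup>2)"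
  by (simp add: sqint_def)

lemma sqint_mult:
  assumes "sqint M f" "sqint M g"
  shows "integrable M (\<lambda>\<omega>. f \<omega> * g \<omega>)"
proof (rule Bochner_Integration.integrable_bound)
  show "integrable M (\<lambda>\<omega>. (f \<omega>)\<^sup>2 + (g \<omega>)\<^sup>2)"
    using assms by (intro Bochner_Integration.integrable_add sqint_square)
  show "(\<lambda>\<omega>. f \<omega> * g \<omega>) \<in> borel_measurable M"
    using assms by (auto intro: borel_measurable_times simp: sqint_def)
  have "\<bar>x * y\<bar> \<le> x\<^sup>2 + y\<^sup>2" for x y :: real
  proof -
    have "2 * \<bar>x * y\<bar> \<le> x\<^sup>2 + y\<^sup>2"
      using sum_squares_bound[of "\<bar>x\<bar>" "\<bar>y\<bar>"] by (simp add: abs_mult)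
    then show ?thesis by linarith
  qed
  then show "AE \<omega> in M. norm (f \<omega> * g \<omega>) \<le> norm ((f \<omega>)\<^sup>2 + (g \<omega>)\<^sup>2)"
    by simp
qed

lemma sqint_cmult[intro]: "sqint M f \<Longrightarrow> sqint M (\<lambda>\<omega>. c * f \<omega>)"
  by (auto simp: sqint_def power_mult_distrib)

lemma sqint_add[intro]:
  assumes "sqint M f" "sqint M g"
  shows "sqint M (\<lambda>\<omega>. f \<omega> + g \<omega>)"
proof -
  have "integrable M (\<lambda>\<omega>. (f \<omega>)\<^sup>2 + (g \<omega>)\<^sup>2 + 2 * (f \<omega> * g \<omega>))"
    using assms by (intro Bochner_Integration.integrable_add integrable_mult_right sqint_square sqint_mult)
  then show ?thesis using assms by (simp add: sqint_def power2_sum mult.assoc borel_measurable_add)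
qed

lemma sqint_diff[intro]: "sqint M f \<Longrightarrow> sqint M g \<Longrightarrow> sqint M (\<lambda>\<omega>. f \<omega> - g \<omega>)"
  using sqint_add[of M f "\<lambda>\<omega>. (-1) * g \<omega>"] sqint_cmult[of M g "-1"] by simp

lemma sqint_zero[intro, simp]: "sqint M (\<lambda>_. 0)"
  by (simp add: sqint_def)

lemma sqint_cong:
  assumes "sqint M f" "\<And>\<omega>. \<omega> \<in> space M \<Longrightarrow> f \<omega> = g \<omega>"
  shows "sqint M g"
proof -
  have "g \<in> borel_measurable M \<longleftrightarrow> f \<in> borel_measurable M" using assms(2) by (intro measurable_cong) simp
  moreover have "integrable M (\<lambda>\<omega>. (g \<omega>)\<^sup>2) \<longleftrightarrow> integrable M (\<lambda>\<omega>. (f \<omega>)\<^sup>2)"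
    using assms(2) by (intro Bochner_Integration.integrable_cong) auto
  ultimately show ?thesis using assms(1) by (simp add: sqint_def)
qed

lemma sqint_if_nn_integral_finite:
  assumes [measurable]: "f \<in> borel_measurable M" and "(\<integral>\<^sup>+\<omega>. ennreal ((f \<omega>)\<^sup>2) \<partial>M) < \<infinity>"
  shows "sqint M f"
  using assms by (auto simp: sqint_def intro!: integrableI_nonneg)

lemma nn_integral_sqint:
  "sqint M f \<Longrightarrow> (\<integral>\<^sup>+\<omega>. ennreal ((f \<omega>)\<^sup>2) \<partial>M) = ennreal (\<integral>\<omega>. (f \<omega>)\<^sup>2 \<partial>M)"
  by (intro nn_integral_eq_integral) (auto simp: sqint_def)

lemma integral_square_lincomb:
  assumes "sqint M f" "sqint M g"
  shows "(\<integral>\<omega>. (a * f \<omega> + b * g \<omega>)\<^sup>2 \<partial>M)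
    = a\<^sup>2 * (\<integral>\<omega>. (f \<omega>)\<^sup>2 \<partial>M) + 2 * a * b * (\<integral>\<omega>. f \<omega> * g \<omega> \<partial>M) + b\<^sup>2 * (\<integral>\<omega>. (g \<omega>)\<^sup>2 \<partial>M)"
proof -
  have "(\<integral>\<omega>. (a * f \<omega> + b * g \<omega>)\<^sup>2 \<partial>M)
      = (\<integral>\<omega>. a\<^sup>2 * (f \<omega>)\<^sup>2 + 2 * a * b * (f \<omega> * g \<omega>) + b\<^sup>2 * (g \<omega>)\<^sup>2 \<partial>M)"
    by (rule Bochner_Integration.integral_cong) (simp_all add: power2_eq_square algebra_simps)
  also have "\<dots> = a\<^sup>2 * (\<integral>\<omega>. (f \<omega>)\<^sup>2 \<partial>M) + 2 * a * b * (\<integral>\<omega>. f \<omega> * g \<omega> \<partial>M) + b\<^sup>2 * (\<integral>\<omega>. (g \<omega>)\<^sup>2 \<partial>M)"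
    using sqint_square[OF assms(1)] sqint_square[OF assms(2)] sqint_mult[OF assms] by simp
  finally show ?thesis .
qed

lemma (in prob_space) indep_orthogonal:
  assumes "indep_var borel f borel g" "sqint M f" "sqint M g" "expectation f = 0 \<or> expectation g = 0"
  shows "expectation (\<lambda>\<omega>. f \<omega> * g \<omega>) = 0"
proof -
  have "integrable M f" "integrable M g"
    using assms by (auto intro!: square_integrable_imp_integrable simp: sqint_def)
  then show ?thesis using indep_var_lebesgue_integral[of f g] assms by auto
qed

subsection \<open>The Kalman filter\<close>


abbreviation noise_indices :: "nat \<Rightarrow> noise_index set" where
  "noise_indices KC \<equiv> {Initial} \<union> range Process \<union> Measurement ` {1..}
      \<union> {Channel t i | t i. 1 \<le> t \<and> i < KC}"

locale gaussian_plant = gaussian_noises M P0 W V SNR KC x0 w v n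
  for M :: "'a measure" and P0 W V SNR :: real and KC :: nat
    and x0 :: "'a \<Rightarrow> real" and w v :: "nat \<Rightarrow> 'a \<Rightarrow> real" and n :: "nat \<Rightarrow> nat \<Rightarrow> 'a \<Rightarrow> real" +
  fixes \<alpha> :: real
  assumes W_pos: "W > 0" and V_nonneg: "V \<ge> 0" and P0_nonneg: "P0 \<ge> 0"
begin

abbreviation "K t \<equiv> kf_gain \<alpha> W V P0 t"
abbreviation "Pt t \<equiv> kf_pred_mse \<alpha> W V P0 t"

text \<open>At time 0 the estimate 0 has error \<open>x0\<close>, whereas \<open>kf_filt_mse\<close>
  at index 0 is 0. With \<open>P0\<close> there, the prediction step \<open>Pt_Suc\<close> holds
  from \<open>t = 0\<close> on.\<close>

definition err_var :: "nat \<Rightarrow> real" where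
  "err_var t = (if t = 0 then P0 else kf_filt_mse \<alpha> W V P0 t)"

lemma Pt_ge: "Pt (Suc t) \<ge> W"
  using kf_pred_mse_eq_riccati[OF W_pos V_nonneg P0_nonneg] by blast

lemma Pt_pos: "Pt (Suc t) > 0"
  using Pt_ge[of t] W_pos by linarith

lemma Pt_V_pos: "Pt (Suc t) + V > 0"
  using Pt_pos[of t] V_nonneg by linarith

lemma K_nonneg: "K (Suc t) \<ge> 0"
  using Pt_pos[of t] Pt_V_pos[of t] by (simp add: kf_gain_def)

lemma err_var_Suc: "err_var (Suc t) = K (Suc t) * V"
  by (simp add: err_var_def kf_filt_mse_def)

lemma err_var_nonneg: "err_var t \<ge> 0"
proof (cases t)
  case 0 then show ?thesis using P0_nonneg by (simp add: err_var_def)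
next
  case (Suc s) then show ?thesis using K_nonneg[of s] V_nonneg by (simp add: err_var_Suc)
qed

lemma K_V: "K (Suc t) * V = Pt (Suc t) * (1 - K (Suc t))"
  using Pt_V_pos[of t] by (simp add: kf_gain_def field_simps)

lemma Pt_Suc: "Pt (Suc t) = \<alpha>\<^sup>2 * err_var t + W"
proof (cases t)
  case 0 then show ?thesis by (simp add: err_var_def)
next
  case (Suc s)
  have "Pt (Suc (Suc s)) = \<alpha>\<^sup>2 * (Pt (Suc s) * (1 - K (Suc s))) + W"
    by (simp add: Let_def kf_gain_def)
  then show ?thesis unfolding Suc K_V[symmetric] err_var_Suc .
qed

text \<open>The left side is the mean square of the filter's correction, gain times innovation; it
  equals the drop from predicted to filtered error. The same quantity later drives the recursion for
  the source variance.\<close>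

lemma innovation_variance: "(K (Suc t))\<^sup>2 * (Pt (Suc t) + V) = Pt (Suc t) - err_var (Suc t)"
proof -
  have "K (Suc t) * (Pt (Suc t) + V) = Pt (Suc t)"
    using Pt_V_pos[of t] by (simp add: kf_gain_def)
  then have "(K (Suc t))\<^sup>2 * (Pt (Suc t) + V) = K (Suc t) * Pt (Suc t)"
    by (simp add: power2_eq_square mult.assoc)
  then show ?thesis unfolding err_var_Suc K_V by (simp add: algebra_simps)
qed

lemma x0_measurable[measurable]: "x0 \<in> borel_measurable M"
  and w_measurable[measurable]: "w t \<in> borel_measurable M"
  and v_measurable: "1 \<le> t \<Longrightarrow> v t \<in> borel_measurable M"
proof -
  have *: "noise_family x0 w v n j \<in> borel_measurable M" if "j \<in> noise_indices KC" for j
    using independent that unfolding indep_vars_def2 by blast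
  show "x0 \<in> borel_measurable M" using *[of Initial] by simp
  show "w t \<in> borel_measurable M" using *[of "Process t"] by simp
  show "1 \<le> t \<Longrightarrow> v t \<in> borel_measurable M" using *[of "Measurement t"] by simp
qed

text \<open>Built from the noises alone, so that one process serves all loops and all horizons;
  \<open>run_decomposition\<close> identifies it with state minus observer estimate.\<close>

primrec filt_err :: "nat \<Rightarrow> 'a \<Rightarrow> real" where
  "filt_err 0 = x0"
| "filt_err (Suc t) = (\<lambda>\<omega>. (\<alpha> * filt_err t \<omega> + w t \<omega>)
      - K (Suc t) * ((\<alpha> * filt_err t \<omega> + w t \<omega>) + v (Suc t) \<omega>))"

definition innov :: "nat \<Rightarrow> 'a \<Rightarrow> real" where
  "innov t = (\<lambda>\<omega>. (\<alpha> * filt_err (t - 1) \<omega> + w (t - 1) \<omega>) + v t \<omega>)"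

text \<open>
  The independent family after \<open>t\<close> filter steps: the past primary noises have been traded for
  the current estimation error and the innovations up to time \<open>t\<close>.
\<close>

definition mixed :: "nat \<Rightarrow> noise_index \<Rightarrow> 'a \<Rightarrow> real" where
  "mixed t j = (case j of
      Initial \<Rightarrow> filt_err t
    | Process s \<Rightarrow> (if s < t then (\<lambda>_. 0) else w s)
    | Measurement s \<Rightarrow> (if s \<le> t then innov s else v s)
    | Channel s i \<Rightarrow> n s i)"

lemma mixed_simps[simp]:
  "mixed t Initial = filt_err t"
  "mixed t (Process s) = (if s < t then (\<lambda>_. 0) else w s)"
  "mixed t (Measurement s) = (if s \<le> t then innov s else v s)"
  "mixed t (Channel s i) = n s i"
  by (simp_all add: mixed_def)

text \<open>Each filter step is two block replacements. The first merges error and process noise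
  into the prediction error; the second exchanges prediction error and measurement noise for
  residual and innovation, which are independent by \<open>gaussian_innovation\<close>. That lemma
  needs the exact law of the error, hence the joint induction.\<close>

lemma mixed_independent_and_law:
  "indep_vars (\<lambda>_. borel) (mixed t) (noise_indices KC)
    \<and> distr M borel (filt_err t) = centered_gaussian (err_var t)"
proof (induction t)
  case 0
  have "indep_vars (\<lambda>_. borel) (mixed 0) (noise_indices KC)
      \<longleftrightarrow> indep_vars (\<lambda>_. borel) (noise_family x0 w v n) (noise_indices KC)"
    by (rule indep_vars_cong) auto
  then show ?case using independent initial_law by (simp add: err_var_def)
next
  case (Suc t)
  let ?I = "noise_indices KC"
  let ?p = "\<lambda>\<omega>. \<alpha> * filt_err t \<omega> + w t \<omega>"
  let ?v = "v (Suc t)"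
  define X where "X = mixed t"
  have X: "indep_vars (\<lambda>_. borel) X ?I" and law: "distr M borel (filt_err t) = centered_gaussian (err_var t)"
    using Suc by (auto simp: X_def)
  have Xm: "X j \<in> borel_measurable M" if "j \<in> ?I" for j
    using X that by (auto simp: indep_vars_def2)
  have e[measurable]: "filt_err t \<in> borel_measurable M" using Xm[of Initial] by (simp add: X_def)
  have v[measurable]: "?v \<in> borel_measurable M" by (rule v_measurable) simp
  \<comment> \<open>After prediction: the new error takes the slot \<open>Initial\<close>, and the
    consumed process noise leaves a constant, which is independent of everything.\<close>
  define X1 where "X1 = X(Initial := ?p, Process t := (\<lambda>_. 0))"
  let ?J1 = "{Process t, Initial}"
  have c1: "X j \<in> borel_measurable (info M ?J1 X)" if "j \<in> ?J1" for j
    using that by (rule measurable_info_component)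
  have m1[measurable]: "filt_err t \<in> borel_measurable (info M ?J1 X)" "w t \<in> borel_measurable (info M ?J1 X)"
    using c1[of Initial] c1[of "Process t"] by (auto simp: X_def)
  have X1: "indep_vars (\<lambda>_. borel) X1 ?I"
  proof (rule indep_vars_replace_block[OF X])
    show "?J1 \<subseteq> ?I" by auto
    have "indep_var borel (X1 (Process t)) borel (X1 Initial)"
      by (rule indep_var_const_AE[where c=0]) (auto simp: X1_def)
    then show "indep_vars (\<lambda>_. borel) X1 ?J1" by (rule indep_vars_pair) simp
    show "X1 j \<in> borel_measurable (info M ?J1 X)" if "j \<in> ?J1" for j
      using that by (auto simp: X1_def)
    show "X1 j = X j" if "j \<in> ?I - ?J1" for j
      using that by (auto simp: X1_def)
  qed
  have ind_ew: "indep_var borel (\<lambda>\<omega>. \<alpha> * filt_err t \<omega>) borel (w t)"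
  proof (rule indep_var_info[OF X])
    show "{Initial} \<inter> {Process t} = {}" "{Initial} \<subseteq> ?I" "{Process t} \<subseteq> ?I" by auto
    have [measurable]: "filt_err t \<in> borel_measurable (info M {Initial} X)"
      using measurable_info_component[of Initial "{Initial}" X M] by (simp add: X_def)
    show "(\<lambda>\<omega>. \<alpha> * filt_err t \<omega>) \<in> borel_measurable (info M {Initial} X)" by measurable
    show "w t \<in> borel_measurable (info M {Process t} X)"
      using measurable_info_component[of "Process t" "{Process t}" X M] by (simp add: X_def)
  qed
  have p_law: "distr M borel ?p = centered_gaussian (Pt (Suc t))"
    unfolding Pt_Suc using ind_ew law err_var_nonneg[of t] W_pos process_law
    by (intro centered_gaussian_add centered_gaussian_scale) auto
  have ind_pv: "indep_var borel ?p borel ?v"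
  proof (rule indep_var_info[OF X1])
    show "{Initial} \<inter> {Measurement (Suc t)} = {}" "{Initial} \<subseteq> ?I" "{Measurement (Suc t)} \<subseteq> ?I" by auto
    show "?p \<in> borel_measurable (info M {Initial} X1)"
      using measurable_info_component[of Initial "{Initial}" X1 M] by (simp add: X1_def)
    show "?v \<in> borel_measurable (info M {Measurement (Suc t)} X1)"
      using measurable_info_component[of "Measurement (Suc t)" "{Measurement (Suc t)}" X1 M]
      by (simp add: X1_def X_def)
  qed
  have v_law: "distr M borel ?v = centered_gaussian V" by (rule measurement_law) simp
  have rot: "indep_var borel (\<lambda>\<omega>. ?p \<omega> - K (Suc t) * (?p \<omega> + ?v \<omega>)) borel (\<lambda>\<omega>. ?p \<omega> + ?v \<omega>)"
    and err_law: "distr M borel (\<lambda>\<omega>. ?p \<omega> - K (Suc t) * (?p \<omega> + ?v \<omega>)) = centered_gaussian (K (Suc t) * V)"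
    using p_law v_law Pt_pos[of t] V_nonneg ind_pv kf_gain_def
    by (intro gaussian_innovation[where a="Pt (Suc t)"]; (simp | measurable))+
  \<comment> \<open>After the measurement update: residual and innovation fill the two slots of the
    rotated pair.\<close>
  define X2 where "X2 = X1(Initial := filt_err (Suc t), Measurement (Suc t) := innov (Suc t))"
  let ?J2 = "{Initial, Measurement (Suc t)}"
  have c2: "X1 j \<in> borel_measurable (info M ?J2 X1)" if "j \<in> ?J2" for j
    using that by (rule measurable_info_component)
  have m2[measurable]: "?p \<in> borel_measurable (info M ?J2 X1)" "?v \<in> borel_measurable (info M ?J2 X1)"
    using c2[of Initial] c2[of "Measurement (Suc t)"] by (auto simp: X1_def X_def)
  have X2: "indep_vars (\<lambda>_. borel) X2 ?I"
  proof (rule indep_vars_replace_block[OF X1])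
    show "?J2 \<subseteq> ?I" by auto
    have "indep_var borel (X2 Initial) borel (X2 (Measurement (Suc t)))"
      using rot by (simp add: X2_def innov_def)
    then show "indep_vars (\<lambda>_. borel) X2 ?J2" by (rule indep_vars_pair) simp
    show "X2 j \<in> borel_measurable (info M ?J2 X1)" if "j \<in> ?J2" for j
      using that m2 by (auto simp: X2_def innov_def)
    show "X2 j = X1 j" if "j \<in> ?I - ?J2" for j
      using that by (auto simp: X2_def)
  qed
  have "X2 j = mixed (Suc t) j" if "j \<in> ?I" for j
    using that by (cases j) (auto simp: X2_def X1_def X_def)
  then have "indep_vars (\<lambda>_. borel) (mixed (Suc t)) ?I \<longleftrightarrow> indep_vars (\<lambda>_. borel) X2 ?I"
    by (intro indep_vars_cong) auto
  then show ?case using X2 err_law by (simp add: err_var_Suc)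
qed

lemmas mixed_independent = mixed_independent_and_law[THEN conjunct1]
lemmas filt_err_law = mixed_independent_and_law[THEN conjunct2]

lemma mixed_measurable: "j \<in> noise_indices KC \<Longrightarrow> mixed t j \<in> borel_measurable M"
  using mixed_independent[of t] unfolding indep_vars_def2 by blast

lemma filt_err_measurable[measurable]: "filt_err t \<in> borel_measurable M"
  using mixed_measurable[of Initial t] by simp

lemma innov_measurable: "1 \<le> t \<Longrightarrow> innov t \<in> borel_measurable M"
  using mixed_measurable[of "Measurement t" t] by simp

lemma innov_law: "distr M borel (innov (Suc t)) = centered_gaussian (Pt (Suc t) + V)"
proof -
  let ?A = "{Initial, Process t}" and ?B = "{Measurement (Suc t)}"
  have [measurable]: "filt_err t \<in> borel_measurable (info M ?A (mixed t))" "w t \<in> borel_measurable (info M ?A (mixed t))"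
    using measurable_info_component[of Initial ?A "mixed t" M] measurable_info_component[of "Process t" ?A "mixed t" M]
    by auto
  have v: "v (Suc t) \<in> borel_measurable (info M ?B (mixed t))"
    using measurable_info_component[of "Measurement (Suc t)" ?B "mixed t" M] by auto
  have ind: "indep_var borel (\<lambda>\<omega>. \<alpha> * filt_err t \<omega> + w t \<omega>) borel (v (Suc t))"
    by (rule indep_var_info[OF mixed_independent, of ?A ?B]) (auto intro: v)
  have [measurable]: "filt_err t \<in> borel_measurable (info M {Initial} (mixed t))"
    using measurable_info_component[of Initial "{Initial}" "mixed t" M] by auto
  have w: "w t \<in> borel_measurable (info M {Process t} (mixed t))"
    using measurable_info_component[of "Process t" "{Process t}" "mixed t" M] by auto
  have ind2: "indep_var borel (\<lambda>\<omega>. \<alpha> * filt_err t \<omega>) borel (w t)"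
    by (rule indep_var_info[OF mixed_independent, of "{Initial}" "{Process t}"]) (auto intro: w)
  show ?thesis
    unfolding innov_def Pt_Suc using ind ind2 err_var_nonneg[of t] W_pos V_nonneg filt_err_law process_law
    by (auto intro!: centered_gaussian_add centered_gaussian_scale measurement_law v_measurable)
qed

lemma filt_err_moments:
  "sqint M (filt_err t)" "expectation (filt_err t) = 0" "expectation (\<lambda>\<omega>. (filt_err t \<omega>)\<^sup>2) = err_var t"
  using centered_gaussian_moments[OF filt_err_measurable filt_err_law err_var_nonneg]
  by (auto simp: sqint_def)

lemma w_moments:
  "sqint M (w t)" "expectation (w t) = 0" "expectation (\<lambda>\<omega>. (w t \<omega>)\<^sup>2) = W"
  using centered_gaussian_moments[OF w_measurable process_law] W_pos
  by (auto simp: sqint_def)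

lemma innov_moments:
  "sqint M (innov (Suc t))" "expectation (innov (Suc t)) = 0"
  "expectation (\<lambda>\<omega>. (innov (Suc t) \<omega>)\<^sup>2) = Pt (Suc t) + V"
  using centered_gaussian_moments[OF innov_measurable innov_law, of t] Pt_V_pos[of t] innov_measurable[of "Suc t"]
  by (auto simp: sqint_def)

section \<open>The information available at time t, and what is independent of it\<close>

definition past :: "nat \<Rightarrow> noise_index set" where
  "past t = Measurement ` {1..t} \<union> {Channel s i | s i. 1 \<le> s \<and> s \<le> t \<and> i < KC}"

text \<open>On \<open>past t\<close> the family \<open>mixed t\<close> consists of the innovations
  and channel noises up to time t. Innovations replace measurements because they do not depend on
  the control law.\<close>

definition G :: "nat \<Rightarrow> 'a measure" where
  "G t = info M (past t) (mixed t)"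

lemma past_subset: "past t \<subseteq> noise_indices KC"
  by (auto simp: past_def)

lemma past_mono: "s \<le> t \<Longrightarrow> past s \<subseteq> past t"
  by (auto simp: past_def)

lemma space_G[simp]: "space (G t) = space M"
  by (simp add: G_def)

text \<open>Slots in \<open>past s\<close> are frozen from time s on, so earlier information can be
  read inside any later independent family.\<close>

lemma G_measurable_info:
  assumes f: "f \<in> measurable (G s) S" and "s \<le> t" "past s \<subseteq> A"
  shows "f \<in> measurable (info M A (mixed t)) S"
proof (rule measurable_info_mono[OF f[unfolded G_def]])
  fix j assume j: "j \<in> past s"
  then have "mixed s j = mixed t j" using \<open>s \<le> t\<close> by (auto simp: past_def)
  then show "mixed s j \<in> borel_measurable (info M A (mixed t))"
    using measurable_info_component[of j A "mixed t" M] j assms by auto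
qed simp

lemma G_mono: "f \<in> measurable (G s) S \<Longrightarrow> s \<le> t \<Longrightarrow> f \<in> measurable (G t) S"
  unfolding G_def[of t] by (intro G_measurable_info past_mono)

lemma G_imp_M: "f \<in> measurable (G t) S \<Longrightarrow> f \<in> measurable M S"
  unfolding G_def by (erule measurable_info_mono) (auto intro!: mixed_measurable[THEN measurable_compose] mixed_measurable subsetD[OF past_subset])

lemma innov_in_G: "1 \<le> s \<Longrightarrow> s \<le> t \<Longrightarrow> innov s \<in> borel_measurable (G t)"
  using measurable_info_component[of "Measurement s" "past t" "mixed t" M]
  by (auto simp: G_def past_def)

lemma n_in_G: "1 \<le> s \<Longrightarrow> s \<le> t \<Longrightarrow> i < KC \<Longrightarrow> n s i \<in> borel_measurable (G t)"
  using measurable_info_component[of "Channel s i" "past t" "mixed t" M]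
  by (auto simp: G_def past_def)

text \<open>In \<open>mixed t\<close> the error sits in the slot \<open>Initial\<close>, outside
  \<open>past t\<close>. The independence therefore extends to nonlinear functions of the past such
  as decoder outputs, where mere uncorrelatedness would not suffice.\<close>

lemma filt_err_indep_G:
  assumes f: "f \<in> borel_measurable (G t)"
  shows "indep_var borel (filt_err t) borel f"
proof (rule indep_var_info[OF mixed_independent[of t]])
  show "{Initial} \<inter> past t = {}" "{Initial} \<subseteq> noise_indices KC" by (auto simp: past_def)
  show "past t \<subseteq> noise_indices KC" by (rule past_subset)
  show "filt_err t \<in> borel_measurable (info M {Initial} (mixed t))"
    using measurable_info_component[of Initial "{Initial}" "mixed t" M] by simp
qed (use f in \<open>simp add: G_def\<close>)

text \<open>Read off from the family one step later, in which the new innovation has a slot of its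
  own.\<close>

lemma innov_indep_G:
  assumes f: "f \<in> borel_measurable (G t)"
  shows "indep_var borel f borel (innov (Suc t))"
proof (rule indep_var_info[OF mixed_independent[of "Suc t"]])
  show "past t \<inter> {Measurement (Suc t)} = {}" "{Measurement (Suc t)} \<subseteq> noise_indices KC"
    by (auto simp: past_def)
  show "past t \<subseteq> noise_indices KC" by (rule past_subset)
  show "f \<in> borel_measurable (info M (past t) (mixed (Suc t)))"
    using f by (rule G_measurable_info) auto
  show "innov (Suc t) \<in> borel_measurable (info M {Measurement (Suc t)} (mixed (Suc t)))"
    using measurable_info_component[of "Measurement (Suc t)" "{Measurement (Suc t)}" "mixed (Suc t)" M] by simp
qed

lemma w_indep_lincomb:
  assumes f: "f \<in> borel_measurable (G t)"
  shows "indep_var borel (\<lambda>\<omega>. a * filt_err t \<omega> + f \<omega>) borel (w t)"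
proof (rule indep_var_info[OF mixed_independent[of t]])
  let ?A = "insert Initial (past t)"
  show "?A \<inter> {Process t} = {}" "{Process t} \<subseteq> noise_indices KC" by (auto simp: past_def)
  show "?A \<subseteq> noise_indices KC" using past_subset by auto
  have [measurable]: "filt_err t \<in> borel_measurable (info M ?A (mixed t))"
    using measurable_info_component[of Initial ?A "mixed t" M] by simp
  have [measurable]: "f \<in> borel_measurable (info M ?A (mixed t))"
    using f by (rule G_measurable_info) auto
  show "(\<lambda>\<omega>. a * filt_err t \<omega> + f \<omega>) \<in> borel_measurable (info M ?A (mixed t))" by measurable
  show "w t \<in> borel_measurable (info M {Process t} (mixed t))"
    using measurable_info_component[of "Process t" "{Process t}" "mixed t" M] by simp
qed

text \<open>
  \<open>indep_var\<close> wants both variables in one type, hence the source as a vector of length one.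
\<close>

lemma channel_indep_source:
  assumes f: "f \<in> borel_measurable (G t)"
  shows "indep_var (Pi\<^sub>M {0} (\<lambda>_. borel)) (\<lambda>\<omega>. \<lambda>i\<in>{0}. a * innov (Suc t) \<omega> + f \<omega>)
    (Pi\<^sub>M {..<KC} (\<lambda>_. borel)) (\<lambda>\<omega>. \<lambda>i\<in>{..<KC}. n (Suc t) i \<omega>)"
proof (rule indep_var_info[OF mixed_independent[of "Suc t"]])
  let ?A = "insert (Measurement (Suc t)) (past t)" and ?B = "Channel (Suc t) ` {..<KC}"
  show "?A \<inter> ?B = {}" "?B \<subseteq> noise_indices KC" by (auto simp: past_def)
  show "?A \<subseteq> noise_indices KC" using past_subset by auto
  have [measurable]: "innov (Suc t) \<in> borel_measurable (info M ?A (mixed (Suc t)))"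
    using measurable_info_component[of "Measurement (Suc t)" ?A "mixed (Suc t)" M] by simp
  have [measurable]: "f \<in> borel_measurable (info M ?A (mixed (Suc t)))"
    using f by (rule G_measurable_info) auto
  show "(\<lambda>\<omega>. \<lambda>i\<in>{0}. a * innov (Suc t) \<omega> + f \<omega>) \<in> measurable (info M ?A (mixed (Suc t))) (Pi\<^sub>M {0} (\<lambda>_. borel))"
    by measurable
  show "(\<lambda>\<omega>. \<lambda>i\<in>{..<KC}. n (Suc t) i \<omega>) \<in> measurable (info M ?B (mixed (Suc t))) (Pi\<^sub>M {..<KC} (\<lambda>_. borel))"
  proof (rule measurable_restrict)
    fix i assume "i \<in> {..<KC}"
    then show "n (Suc t) i \<in> borel_measurable (info M ?B (mixed (Suc t)))"
      using measurable_info_component[of "Channel (Suc t) i" ?B "mixed (Suc t)" M] by simp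
  qed
qed

end

subsection \<open>The quadratic cost\<close>


lemma completion_of_square:
  fixes s' R :: real
  assumes "s' + R \<noteq> 0"
  shows "s' * (\<alpha> * x + u)\<^sup>2 + R * u\<^sup>2 + Q * x\<^sup>2
    = (\<alpha>\<^sup>2 * R * s' / (s' + R) + Q) * x\<^sup>2 + (s' + R) * (u + \<alpha> * s' / (s' + R) * x)\<^sup>2"
  using assms by (simp add: divide_simps) (simp add: algebra_simps power2_eq_square)

context gaussian_plant begin

abbreviation "plant T r \<equiv> plant_and_observer M \<alpha> W V P0 x0 w v T r"
abbreviation "msq f \<equiv> expectation (\<lambda>\<omega>. (f \<omega>)\<^sup>2)"

lemma msq_cong: "(\<And>\<omega>. \<omega> \<in> space M \<Longrightarrow> f \<omega> = g \<omega>) \<Longrightarrow> msq f = msq g"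
  by (rule Bochner_Integration.integral_cong) auto

lemma msq_add_orthogonal:
  assumes "sqint M f" "sqint M g" "expectation (\<lambda>\<omega>. f \<omega> * g \<omega>) = 0"
  shows "msq (\<lambda>\<omega>. a * f \<omega> + b * g \<omega>) = a\<^sup>2 * msq f + b\<^sup>2 * msq g"
  using integral_square_lincomb[OF assms(1,2)] assms(3) by simp

section \<open>Runs of plant and observer: separation of estimate and error\<close>

lemma run_initial:
  assumes "plant T r" "\<omega> \<in> space M"
  shows "state r 0 \<omega> = x0 \<omega>" "control r 0 \<omega> = 0" "obs_est r 0 \<omega> = 0"
  using assms unfolding plant_and_observer_def by auto

lemma run_state_Suc:
  assumes "plant T r" "\<omega> \<in> space M" "t \<le> T"
  shows "state r (Suc t) \<omega> = \<alpha> * state r t \<omega> + w t \<omega> + control r t \<omega>"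
  using assms unfolding plant_and_observer_def by auto

text \<open>State and estimate receive the same control, which cancels in their difference; the
  difference obeys the noise-only recursion of \<open>filt_err\<close>. The estimate update at t + 1
  uses the decomposition at t, so both claims come from one induction.\<close>

lemma run_decomposition:
  assumes p: "plant T r" and \<omega>: "\<omega> \<in> space M"
  shows "t \<le> T \<Longrightarrow> state r t \<omega> = obs_est r t \<omega> + filt_err t \<omega>"
    and "t < T \<Longrightarrow> obs_est r (Suc t) \<omega> = \<alpha> * obs_est r t \<omega> + control r t \<omega> + K (Suc t) * innov (Suc t) \<omega>"
proof -
  have upd: "obs_est r (Suc t) \<omega> = \<alpha> * obs_est r t \<omega> + control r t \<omega> + K (Suc t) * innov (Suc t) \<omega>"
    if "t < T" "state r t \<omega> = obs_est r t \<omega> + filt_err t \<omega>" for t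
  proof -
    have "Suc t \<in> {1..T}" using that by simp
    then have m: "meas r (Suc t) \<omega> = state r (Suc t) \<omega> + v (Suc t) \<omega>"
      and o: "obs_est r (Suc t) \<omega> = \<alpha> * obs_est r t \<omega> + control r t \<omega>
             + K (Suc t) * (meas r (Suc t) \<omega> - \<alpha> * obs_est r t \<omega> - control r t \<omega>)"
      using p \<omega> unfolding plant_and_observer_def by (metis diff_Suc_1)+
    have "meas r (Suc t) \<omega> - \<alpha> * obs_est r t \<omega> - control r t \<omega> = innov (Suc t) \<omega>"
      using m run_state_Suc[OF p \<omega>, of t] that by (simp add: innov_def algebra_simps)
    then show ?thesis using o by simp
  qed
  have main: "t \<le> T \<Longrightarrow> state r t \<omega> = obs_est r t \<omega> + filt_err t \<omega>" for t
  proof (induction t)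
    case 0 then show ?case using run_initial[OF p \<omega>] by simp
  next
    case (Suc t)
    then show ?case using upd[of t] run_state_Suc[OF p \<omega>, of t]
      by (simp add: innov_def algebra_simps)
  qed
  then show "t \<le> T \<Longrightarrow> state r t \<omega> = obs_est r t \<omega> + filt_err t \<omega>" .
  show "t < T \<Longrightarrow> obs_est r (Suc t) \<omega> = \<alpha> * obs_est r t \<omega> + control r t \<omega> + K (Suc t) * innov (Suc t) \<omega>"
    using upd[of t] main[of t] by simp
qed

lemma run_control_0_G:
  assumes "plant T r"
  shows "control r 0 \<in> borel_measurable (G t)" "sqint M (control r 0)"
proof -
  have "control r 0 \<in> borel_measurable (G t) \<longleftrightarrow> (\<lambda>_. 0 :: real) \<in> borel_measurable (G t)"
    using run_initial[OF assms] by (intro measurable_cong) simp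
  then show "control r 0 \<in> borel_measurable (G t)" by simp
  show "sqint M (control r 0)" by (rule sqint_cong[OF sqint_zero]) (use run_initial[OF assms] in simp)
qed

lemma run_obs_est_0_G:
  assumes "plant T r"
  shows "obs_est r 0 \<in> borel_measurable (G t)" "sqint M (obs_est r 0)"
proof -
  have "obs_est r 0 \<in> borel_measurable (G t) \<longleftrightarrow> (\<lambda>_. 0 :: real) \<in> borel_measurable (G t)"
    using run_initial[OF assms] by (intro measurable_cong) simp
  then show "obs_est r 0 \<in> borel_measurable (G t)" by simp
  show "sqint M (obs_est r 0)" by (rule sqint_cong[OF sqint_zero]) (use run_initial[OF assms] in simp)
qed

lemma run_obs_est_Suc_G:
  assumes p: "plant T r" and t: "t < T"
    and "obs_est r t \<in> borel_measurable (G t)" "control r t \<in> borel_measurable (G t)"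
  shows "obs_est r (Suc t) \<in> borel_measurable (G (Suc t))"
proof -
  have [measurable]: "obs_est r t \<in> borel_measurable (G (Suc t))" "control r t \<in> borel_measurable (G (Suc t))"
    "innov (Suc t) \<in> borel_measurable (G (Suc t))"
    using assms by (auto intro: G_mono innov_in_G)
  have "obs_est r (Suc t) \<in> borel_measurable (G (Suc t)) \<longleftrightarrow>
     (\<lambda>\<omega>. \<alpha> * obs_est r t \<omega> + control r t \<omega> + K (Suc t) * innov (Suc t) \<omega>) \<in> borel_measurable (G (Suc t))"
    using run_decomposition(2)[OF p _ t] by (intro measurable_cong) simp
  then show ?thesis by simp
qed

lemma run_obs_est_Suc_sqint:
  assumes p: "plant T r" and t: "t < T" and "sqint M (obs_est r t)" "sqint M (control r t)"
  shows "sqint M (obs_est r (Suc t))"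
proof (rule sqint_cong)
  show "sqint M (\<lambda>\<omega>. \<alpha> * obs_est r t \<omega> + control r t \<omega> + K (Suc t) * innov (Suc t) \<omega>)"
    using assms innov_moments by (intro sqint_add sqint_cmult) auto
qed (use run_decomposition(2)[OF p _ t] in simp)

text \<open>The common ground of both loops: causality provides orthogonality to the filter error
  and the fresh noise, finite second moments allow expectations to be split. Time 0 is fixed by the
  plant equations.\<close>

definition admissible :: "nat \<Rightarrow> ('a, 'z) loop_scheme \<Rightarrow> bool" where
  "admissible T r \<longleftrightarrow> plant T r \<and>
     (\<forall>t\<in>{1..T}. control r t \<in> borel_measurable (G t) \<and> sqint M (control r t))"

lemma admissible_signals:
  assumes a: "admissible T r" and t: "t \<le> T"
  shows "control r t \<in> borel_measurable (G t)" "sqint M (control r t)"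
    "obs_est r t \<in> borel_measurable (G t)" "sqint M (obs_est r t)"
proof -
  have p: "plant T r" using a by (simp add: admissible_def)
  have c: "control r t \<in> borel_measurable (G t) \<and> sqint M (control r t)" if "t \<le> T" for t
    using a that run_control_0_G[OF p] by (cases "t = 0") (auto simp: admissible_def)
  have "obs_est r t \<in> borel_measurable (G t) \<and> sqint M (obs_est r t)"
    using t
  proof (induction t)
    case 0 then show ?case using run_obs_est_0_G[OF p] by simp
  next
    case (Suc t)
    then show ?case using c[of t] run_obs_est_Suc_G[OF p, of t] run_obs_est_Suc_sqint[OF p, of t] by simp
  qed
  then show "control r t \<in> borel_measurable (G t)" "sqint M (control r t)"
    "obs_est r t \<in> borel_measurable (G t)" "sqint M (obs_est r t)" using c[OF t] by auto
qed

lemma admissible_state_sqint: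
  assumes a: "admissible T r" and t: "t \<le> Suc T"
  shows "sqint M (state r t)"
proof -
  have p: "plant T r" using a by (simp add: admissible_def)
  have x: "sqint M (state r t)" if "t \<le> T" for t
  proof (rule sqint_cong)
    show "sqint M (\<lambda>\<omega>. obs_est r t \<omega> + filt_err t \<omega>)"
      using admissible_signals[OF a that] filt_err_moments by (intro sqint_add)
  qed (use run_decomposition(1)[OF p _ that] in simp)
  show ?thesis
  proof (cases "t = Suc T")
    case True
    have "sqint M (\<lambda>\<omega>. \<alpha> * state r T \<omega> + w T \<omega> + control r T \<omega>)"
      using x[of T] admissible_signals[OF a, of T] w_moments by (intro sqint_add sqint_cmult) auto
    then have "sqint M (state r (Suc T))"
      by (rule sqint_cong) (use run_state_Suc[OF p] in simp)
    then show ?thesis using True by simp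
  qed (use x t in simp)
qed

lemma next_state_msq:
  assumes f: "f \<in> borel_measurable (G t)" "sqint M f"
  shows "msq (\<lambda>\<omega>. (\<alpha> * filt_err t \<omega> + f \<omega>) + w t \<omega>) = msq (\<lambda>\<omega>. \<alpha> * filt_err t \<omega> + f \<omega>) + W"
proof -
  have z: "sqint M (\<lambda>\<omega>. \<alpha> * filt_err t \<omega> + f \<omega>)"
    using f filt_err_moments by (intro sqint_add sqint_cmult)
  have "expectation (\<lambda>\<omega>. (\<alpha> * filt_err t \<omega> + f \<omega>) * w t \<omega>) = 0"
    by (rule indep_orthogonal[OF w_indep_lincomb[OF f(1)] z]) (use w_moments in auto)
  then show ?thesis
    using msq_add_orthogonal[OF z w_moments(1), of t 1 1] w_moments(3) by simp
qed

lemma filt_err_orthogonal: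
  assumes f: "f \<in> borel_measurable (G t)" "sqint M f"
  shows "msq (\<lambda>\<omega>. a * f \<omega> + b * filt_err t \<omega>) = a\<^sup>2 * msq f + b\<^sup>2 * err_var t"
proof -
  have "expectation (\<lambda>\<omega>. filt_err t \<omega> * f \<omega>) = 0"
    by (rule indep_orthogonal[OF filt_err_indep_G[OF f(1)]]) (use filt_err_moments f in auto)
  then have "expectation (\<lambda>\<omega>. f \<omega> * filt_err t \<omega>) = 0" by (simp add: mult.commute)
  then show ?thesis
    using msq_add_orthogonal[OF f(2) filt_err_moments(1)[of t]] filt_err_moments(3) by simp
qed

lemma state_Suc_msq:
  assumes a: "admissible T r" and t: "t \<le> T"
  shows "msq (state r (Suc t)) = msq (\<lambda>\<omega>. \<alpha> * state r t \<omega> + control r t \<omega>) + W"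
proof -
  have p: "plant T r" using a by (simp add: admissible_def)
  note sig[measurable] = admissible_signals[OF a t]
  let ?f = "\<lambda>\<omega>. \<alpha> * obs_est r t \<omega> + control r t \<omega>"
  have "msq (state r (Suc t)) = msq (\<lambda>\<omega>. (\<alpha> * filt_err t \<omega> + ?f \<omega>) + w t \<omega>)"
    by (rule msq_cong) (use run_state_Suc[OF p _ t] run_decomposition(1)[OF p _ t] in \<open>simp add: algebra_simps\<close>)
  also have "\<dots> = msq (\<lambda>\<omega>. \<alpha> * filt_err t \<omega> + ?f \<omega>) + W"
  proof (rule next_state_msq)
    show "?f \<in> borel_measurable (G t)" by measurable
    show "sqint M ?f" using sig by (intro sqint_add sqint_cmult) auto
  qed
  also have "msq (\<lambda>\<omega>. \<alpha> * filt_err t \<omega> + ?f \<omega>) = msq (\<lambda>\<omega>. \<alpha> * state r t \<omega> + control r t \<omega>)"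
    by (rule msq_cong) (use run_decomposition(1)[OF p _ t] in \<open>simp add: algebra_simps\<close>)
  finally show ?thesis .
qed

lemma stage_cost_identity:
  assumes s: "s' > 0" "R \<ge> 0"
    and a: "admissible T r" and t: "t \<le> T"
  defines "L \<equiv> \<alpha> * s' / (s' + R)"
  shows "s' * msq (state r (Suc t)) + R * msq (control r t) + Q * msq (state r t)
    = (\<alpha>\<^sup>2 * R * s' / (s' + R) + Q) * msq (state r t) + W * s'
      + (s' + R) * (msq (\<lambda>\<omega>. control r t \<omega> + L * obs_est r t \<omega>) + L\<^sup>2 * err_var t)"
proof -
  have p: "plant T r" using a by (simp add: admissible_def)
  note sig[measurable] = admissible_signals[OF a t]
  have xs: "sqint M (state r t)" using admissible_state_sqint[OF a] t by simp
  let ?z = "\<lambda>\<omega>. \<alpha> * state r t \<omega> + control r t \<omega>"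
  have z: "sqint M ?z" using xs sig by (intro sqint_add sqint_cmult) auto
  have x': "msq (state r (Suc t)) = msq ?z + W" by (rule state_Suc_msq[OF a t])
  have y: "sqint M (\<lambda>\<omega>. control r t \<omega> + L * state r t \<omega>)"
    using xs sig by (intro sqint_add sqint_cmult) auto
  have "s' * msq ?z + R * msq (control r t) + Q * msq (state r t)
      = expectation (\<lambda>\<omega>. s' * (?z \<omega>)\<^sup>2 + R * (control r t \<omega>)\<^sup>2 + Q * (state r t \<omega>)\<^sup>2)"
    using sqint_square[OF z] sqint_square[OF sig(2)] sqint_square[OF xs] by simp
  also have "\<dots> = expectation (\<lambda>\<omega>. (\<alpha>\<^sup>2 * R * s' / (s' + R) + Q) * (state r t \<omega>)\<^sup>2
      + (s' + R) * (control r t \<omega> + L * state r t \<omega>)\<^sup>2)"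
    unfolding L_def using s by (intro Bochner_Integration.integral_cong refl completion_of_square) simp
  also have "\<dots> = (\<alpha>\<^sup>2 * R * s' / (s' + R) + Q) * msq (state r t)
      + (s' + R) * msq (\<lambda>\<omega>. control r t \<omega> + L * state r t \<omega>)"
    using sqint_square[OF xs] sqint_square[OF y] by simp
  \<comment> \<open>The optimal control would need the state; replacing it by the estimate leaves
    \<open>L * filt_err\<close>, which is orthogonal to everything known at time t.\<close>
  also have "msq (\<lambda>\<omega>. control r t \<omega> + L * state r t \<omega>)
      = msq (\<lambda>\<omega>. control r t \<omega> + L * obs_est r t \<omega>) + L\<^sup>2 * err_var t"
  proof -
    let ?g = "\<lambda>\<omega>. control r t \<omega> + L * obs_est r t \<omega>"
    have "msq (\<lambda>\<omega>. control r t \<omega> + L * state r t \<omega>) = msq (\<lambda>\<omega>. 1 * ?g \<omega> + L * filt_err t \<omega>)"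
      by (rule msq_cong) (use run_decomposition(1)[OF p _ t] in \<open>simp add: algebra_simps\<close>)
    also have "\<dots> = 1\<^sup>2 * msq ?g + L\<^sup>2 * err_var t"
    proof (rule filt_err_orthogonal)
      show "?g \<in> borel_measurable (G t)" by measurable
      show "sqint M ?g" using sig by (intro sqint_add sqint_cmult) auto
    qed
    finally show ?thesis by simp
  qed
  finally show ?thesis unfolding x' by (simp add: algebra_simps)
qed

lemma first_state_msq:
  assumes a: "admissible T r"
  shows "msq (state r (Suc 0)) = \<alpha>\<^sup>2 * P0 + W"
proof -
  have p: "plant T r" using a by (simp add: admissible_def)
  have "msq (state r (Suc 0)) = msq (\<lambda>\<omega>. (\<alpha> * filt_err 0 \<omega> + (\<lambda>_. 0) \<omega>) + w 0 \<omega>)"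
    by (rule msq_cong) (use run_state_Suc[OF p, of _ 0] run_initial[OF p] in simp)
  also have "\<dots> = msq (\<lambda>\<omega>. \<alpha> * filt_err 0 \<omega> + (\<lambda>_. 0) \<omega>) + W"
    by (rule next_state_msq) auto
  also have "msq (\<lambda>\<omega>. \<alpha> * filt_err 0 \<omega> + (\<lambda>_. 0) \<omega>) = \<alpha>\<^sup>2 * msq (filt_err 0)"
    by (simp add: power_mult_distrib)
  also have "msq (filt_err 0) = P0"
    using filt_err_moments(3)[of 0] by (simp add: err_var_def)
  finally show ?thesis .
qed

end

locale lqg = gaussian_plant M P0 W V SNR KC x0 w v n \<alpha>
  for M :: "'a measure" and P0 W V SNR :: real and KC :: nat
    and x0 :: "'a \<Rightarrow> real" and w v :: "nat \<Rightarrow> 'a \<Rightarrow> real" and n :: "nat \<Rightarrow> nat \<Rightarrow> 'a \<Rightarrow> real" and \<alpha> :: real +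
  fixes F Q R S P :: real
  assumes F_pos: "F > 0" and Q_nonneg: "Q \<ge> 0" and R_nonneg: "R \<ge> 0"
    and S_pos: "S > 0" and S_eq: "S\<^sup>2 - (Q + (\<alpha>\<^sup>2 - 1) * R) * S - Q * R = 0"
    and P_pos: "P > 0" and P_eq: "P\<^sup>2 - ((\<alpha>\<^sup>2 - 1) * V + W) * P - V * W = 0"
begin

abbreviation "ric \<equiv> riccati \<alpha> F Q R"
abbreviation "ctg T t \<equiv> cost_to_go \<alpha> F Q R T t"
abbreviation "L T t \<equiv> lqg_gain \<alpha> F Q R T t"

lemma ric_pos: "ric k > 0"
  by (rule riccati_pos[OF S_pos S_eq R_nonneg Q_nonneg F_pos])

lemma ctg_pos: "ctg T t > 0"
  by (simp add: cost_to_go_def ric_pos)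

lemma ctg_Suc_le: "t \<le> T \<Longrightarrow> ctg T (Suc t) = ric (T - t)"
  by (simp add: cost_to_go_def)

lemma ctg_rec:
  assumes "t \<le> T"
  shows "ctg T t = \<alpha>\<^sup>2 * R * ctg T (Suc t) / (ctg T (Suc t) + R) + Q"
proof -
  have "T + 1 - t = Suc (T - t)" using assms by simp
  then show ?thesis by (simp add: cost_to_go_def)
qed

text \<open>The part of the total cost beyond the reach of any control law: the first state (with
  u_0 = 0), the process noise, and the filter error weighted by the gains.\<close>

definition base_cost :: "nat \<Rightarrow> real" where
  "base_cost T = ctg T 1 * (\<alpha>\<^sup>2 * P0 + W)
     + (\<Sum>t=1..T. W * ctg T (Suc t) + (ctg T (Suc t) + R) * (L T t)\<^sup>2 * err_var t)"

lemma expected_cost: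
  assumes a: "admissible T r"
  shows "F * msq (state r (Suc T)) + (\<Sum>t=1..T. Q * msq (state r t) + R * msq (control r t))
    = base_cost T + (\<Sum>t=1..T. (ctg T (Suc t) + R) * msq (\<lambda>\<omega>. control r t \<omega> + L T t * obs_est r t \<omega>))"
proof -
  let ?d = "\<lambda>t. msq (\<lambda>\<omega>. control r t \<omega> + L T t * obs_est r t \<omega>)"
  \<comment> \<open>Telescoping with the potential S_{k+1} E x_{k+1}^2; at \<open>k = T\<close> its
    weight S_{T+1} is \<open>F\<close>.\<close>
  have "ctg T (Suc k) * msq (state r (Suc k)) + (\<Sum>t=1..k. Q * msq (state r t) + R * msq (control r t))
    = ctg T 1 * (\<alpha>\<^sup>2 * P0 + W)
      + (\<Sum>t=1..k. W * ctg T (Suc t) + (ctg T (Suc t) + R) * (?d t + (L T t)\<^sup>2 * err_var t))" if "k \<le> T" for k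
    using that
  proof (induction k)
    case 0 then show ?case using first_state_msq[OF a] by simp
  next
    case (Suc k)
    have "ctg T (Suc (Suc k)) * msq (state r (Suc (Suc k))) + R * msq (control r (Suc k)) + Q * msq (state r (Suc k))
      = ctg T (Suc k) * msq (state r (Suc k)) + W * ctg T (Suc (Suc k))
        + (ctg T (Suc (Suc k)) + R) * (?d (Suc k) + (L T (Suc k))\<^sup>2 * err_var (Suc k))"
      using stage_cost_identity[OF ctg_pos[of T "Suc (Suc k)"] R_nonneg a Suc.prems] ctg_rec[OF Suc.prems]
      by (simp add: lqg_gain_def)
    then show ?case using Suc by simp
  qed
  from this[of T] show ?thesis
    by (simp add: base_cost_def cost_to_go_def sum.distrib algebra_simps)
qed

lemma horizon_cost_admissible:
  assumes a: "admissible T r" and T: "T \<ge> 1"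
  shows "horizon_cost M F Q R T r = ereal ((base_cost T
    + (\<Sum>t=1..T. (ctg T (Suc t) + R) * msq (\<lambda>\<omega>. control r t \<omega> + L T t * obs_est r t \<omega>))) / real T)"
proof -
  let ?c = "\<lambda>\<omega>. F * (state r (T + 1) \<omega>)\<^sup>2 + (\<Sum>t=1..T. Q * (state r t \<omega>)\<^sup>2 + R * (control r t \<omega>)\<^sup>2)"
  have x: "integrable M (\<lambda>\<omega>. (state r t \<omega>)\<^sup>2)" if "t \<le> Suc T" for t
    using admissible_state_sqint[OF a that] by (rule sqint_square)
  have u: "integrable M (\<lambda>\<omega>. (control r t \<omega>)\<^sup>2)" if "t \<le> T" for t
    using admissible_signals(2)[OF a that] by (rule sqint_square)
  have st: "integrable M (\<lambda>\<omega>. Q * (state r t \<omega>)\<^sup>2 + R * (control r t \<omega>)\<^sup>2)" if "t \<in> {1..T}" for t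
    using that by (intro Bochner_Integration.integrable_add integrable_mult_right x u) auto
  have fin: "integrable M (\<lambda>\<omega>. F * (state r (T + 1) \<omega>)\<^sup>2)" using x[of "Suc T"] by simp
  have int: "integrable M ?c"
    by (intro Bochner_Integration.integrable_add fin Bochner_Integration.integrable_sum st)
  have c0: "?c \<omega> \<ge> 0" for \<omega>
    using F_pos Q_nonneg R_nonneg by (intro add_nonneg_nonneg sum_nonneg) auto
  have "expectation ?c = F * msq (state r (Suc T)) + (\<Sum>t=1..T. Q * msq (state r t) + R * msq (control r t))"
  proof -
    have "expectation ?c = expectation (\<lambda>\<omega>. F * (state r (T + 1) \<omega>)\<^sup>2)
        + (\<Sum>t=1..T. expectation (\<lambda>\<omega>. Q * (state r t \<omega>)\<^sup>2 + R * (control r t \<omega>)\<^sup>2))"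
      using st by (subst Bochner_Integration.integral_add[OF fin Bochner_Integration.integrable_sum[OF st]])
        (auto simp: Bochner_Integration.integral_sum)
    also have "(\<Sum>t=1..T. expectation (\<lambda>\<omega>. Q * (state r t \<omega>)\<^sup>2 + R * (control r t \<omega>)\<^sup>2))
        = (\<Sum>t=1..T. Q * msq (state r t) + R * msq (control r t))"
      using x u by (intro sum.cong refl) simp
    finally show ?thesis by simp
  qed
  then have "(\<integral>\<^sup>+\<omega>. ennreal (?c \<omega>) \<partial>M) = ennreal (base_cost T
    + (\<Sum>t=1..T. (ctg T (Suc t) + R) * msq (\<lambda>\<omega>. control r t \<omega> + L T t * obs_est r t \<omega>)))"
    and "0 \<le> base_cost T + (\<Sum>t=1..T. (ctg T (Suc t) + R) * msq (\<lambda>\<omega>. control r t \<omega> + L T t * obs_est r t \<omega>))"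
    using nn_integral_eq_integral[OF int] c0 Bochner_Integration.integral_nonneg[of M ?c] expected_cost[OF a] by auto
  then show ?thesis using T unfolding horizon_cost_def by (simp add: enn2ereal_ennreal)
qed

section \<open>Stationary values and the limit of the uncontrollable cost\<close>

lemma Pt_tendsto: "(\<lambda>t. Pt t) \<longlonglongrightarrow> P"
proof -
  have "riccati \<alpha> (\<alpha>\<^sup>2 * P0 + W) W V \<longlonglongrightarrow> P"
  proof (rule riccati_tendsto)
    show "P\<^sup>2 - (W + (\<alpha>\<^sup>2 - 1) * V) * P - W * V = 0" using P_eq by (simp add: algebra_simps)
    show "\<alpha>\<^sup>2 * P0 + W > 0" using P0_nonneg W_pos by (simp add: add_nonneg_pos)
  qed (use P_pos V_nonneg W_pos in auto)
  then have "(\<lambda>t. Pt (Suc t)) \<longlonglongrightarrow> P"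
    using kf_pred_mse_eq_riccati[OF W_pos V_nonneg P0_nonneg] by simp
  then show ?thesis by (rule LIMSEQ_imp_Suc)
qed

lemma kf_filt_mse_tendsto: "(\<lambda>t. kf_filt_mse \<alpha> W V P0 t) \<longlonglongrightarrow> P * V / (P + V)"
proof -
  have "P + V \<noteq> 0" using P_pos V_nonneg by linarith
  then have "(\<lambda>t. Pt t / (Pt t + V) * V) \<longlonglongrightarrow> P / (P + V) * V"
    by (intro tendsto_intros Pt_tendsto)
  then show ?thesis by (simp add: kf_filt_mse_def kf_gain_def)
qed

lemma err_var_tendsto: "err_var \<longlonglongrightarrow> P * V / (P + V)"
  by (rule LIMSEQ_imp_Suc) (use LIMSEQ_Suc[OF kf_filt_mse_tendsto] in \<open>simp add: err_var_def\<close>)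

lemma ric_tendsto: "ric \<longlonglongrightarrow> S"
  by (rule riccati_tendsto[OF S_pos S_eq R_nonneg Q_nonneg F_pos])

text \<open>(S_{t+1} + R) L_t^2 as a function of the k = T - t remaining steps, in which form it
  does not depend on the horizon. It is the price of one unit of mean-square estimation
  error.\<close>

definition ric_weight :: "nat \<Rightarrow> real" where
  "ric_weight k = (ric k + R) * (\<alpha> * ric k / (ric k + R))\<^sup>2"

lemma ric_weight_eq: "t \<le> T \<Longrightarrow> (ctg T (Suc t) + R) * (L T t)\<^sup>2 = ric_weight (T - t)"
  by (simp add: ric_weight_def lqg_gain_def ctg_Suc_le)

text \<open>(S + R) L^2 = \<alpha>^2 S^2 / (S + R) = \<alpha>^2 S - \<alpha>^2 R S / (S + R), and
  the fixed-point equation turns the last term into S - Q.\<close>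

lemma ric_weight_tendsto: "ric_weight \<longlonglongrightarrow> Q + (\<alpha>\<^sup>2 - 1) * S"
proof -
  have SR: "S + R > 0" using S_pos R_nonneg by linarith
  have "(\<lambda>k. (ric k + R) * (\<alpha> * ric k / (ric k + R))\<^sup>2) \<longlonglongrightarrow> (S + R) * (\<alpha> * S / (S + R))\<^sup>2"
    using SR by (intro tendsto_intros ric_tendsto) auto
  also have "(S + R) * (\<alpha> * S / (S + R))\<^sup>2 = \<alpha>\<^sup>2 * S - \<alpha>\<^sup>2 * R * S / (S + R)"
  proof -
    have "(S + R) * (\<alpha> * S / (S + R))\<^sup>2 = \<alpha>\<^sup>2 * S * S / (S + R)"
      using SR by (simp add: power2_eq_square)
    moreover have "\<alpha>\<^sup>2 * S = \<alpha>\<^sup>2 * S * S / (S + R) + \<alpha>\<^sup>2 * R * S / (S + R)"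
    proof -
      have "\<alpha>\<^sup>2 * S * S / (S + R) + \<alpha>\<^sup>2 * R * S / (S + R) = \<alpha>\<^sup>2 * S * (S + R) / (S + R)"
        unfolding add_divide_distrib[symmetric]
        by (rule arg_cong[where f="\<lambda>x. x / (S + R)"]) (simp add: algebra_simps)
      then show ?thesis using SR by simp
    qed
    ultimately show ?thesis by linarith
  qed
  also have "\<dots> = Q + (\<alpha>\<^sup>2 - 1) * S"
    using riccati_fixed_point[OF S_pos R_nonneg S_eq] by (simp add: algebra_simps)
  finally show ?thesis by (simp add: ric_weight_def[abs_def])
qed

lemma P_fixed_point: "P = \<alpha>\<^sup>2 * (P * V / (P + V)) + W"
  using riccati_fixed_point[OF P_pos V_nonneg, of W \<alpha>] P_eq by (simp add: algebra_simps)

text \<open>The Cesaro limit is W S + (Q + (\<alpha>^2 - 1) S) Pbar; substituting W = P - \<alpha>^2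
  Pbar, the fixed point of the filter, gives the stated form.\<close>

lemma base_cost_tendsto:
  defines "Pbar \<equiv> P * V / (P + V)"
  shows "(\<lambda>T. base_cost T / real T) \<longlonglongrightarrow> Q * Pbar + S * (P - Pbar)"
proof -
  define c where "c = \<alpha>\<^sup>2 * P0 + W"
  \<comment> \<open>The factor 1 plays the constant second sequence in
    \<open>cesaro_convolution\<close>.\<close>
  let ?f = "\<lambda>T. ric T * (c / real T)
    + (W * ((\<Sum>t=1..T. ric (T - t) * 1) / real T) + (\<Sum>t=1..T. ric_weight (T - t) * err_var t) / real T)"
  have eq: "base_cost T / real T = ?f T" for T
  proof -
    have "(\<Sum>t=1..T. W * ctg T (Suc t) + (ctg T (Suc t) + R) * (L T t)\<^sup>2 * err_var t)
      = (\<Sum>t=1..T. W * (ric (T - t) * 1) + ric_weight (T - t) * err_var t)"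
    proof (rule sum.cong)
      fix t assume "t \<in> {1..T}"
      then have "t \<le> T" by simp
      then show "W * ctg T (Suc t) + (ctg T (Suc t) + R) * (L T t)\<^sup>2 * err_var t
          = W * (ric (T - t) * 1) + ric_weight (T - t) * err_var t"
        using ric_weight_eq[of t T] by (simp add: ctg_Suc_le)
    qed simp
    then show ?thesis
      unfolding base_cost_def c_def[symmetric]
      by (simp add: cost_to_go_def sum.distrib sum_distrib_left[symmetric] add_divide_distrib)
  qed
  have "?f \<longlonglongrightarrow> S * 0 + (W * (S * 1) + (Q + (\<alpha>\<^sup>2 - 1) * S) * Pbar)"
    unfolding Pbar_def
    by (intro tendsto_add tendsto_mult ric_tendsto tendsto_const cesaro_convolution ric_weight_tendsto
        err_var_tendsto lim_const_over_n)
  moreover have "S * 0 + (W * (S * 1) + (Q + (\<alpha>\<^sup>2 - 1) * S) * Pbar) = Q * Pbar + S * (P - Pbar)"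
    using P_fixed_point unfolding Pbar_def[symmetric] by (simp add: algebra_simps)
  ultimately show ?thesis unfolding eq by simp
qed

end

subsection \<open>The cost achievable at the observer\<close>


context lqg begin

abbreviation "optimal_cost \<equiv> Q * (P * V / (P + V)) + S * (P - P * V / (P + V))"

text \<open>Controls are functions of estimates and estimates contain earlier controls, so
  measurability propagates alternately through time.\<close>

lemma observer_controlled_G:
  assumes o: "observer_controlled M \<alpha> W V P0 x0 w v T r" and t: "t \<le> T"
  shows "control r t \<in> borel_measurable (G t)"
proof -
  have p: "plant T r" using o by (simp add: observer_controlled_def)
  obtain \<phi> where \<phi>: "\<And>t. t \<in> {1..T} \<Longrightarrow> \<phi> t \<in> borel_measurable (Pi\<^sub>M {1..t} (\<lambda>_. borel))"
    "\<And>t \<omega>. t \<in> {1..T} \<Longrightarrow> \<omega> \<in> space M \<Longrightarrow> control r t \<omega> = \<phi> t (\<lambda>i\<in>{1..t}. obs_est r i \<omega>)"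
    using o unfolding observer_controlled_def by blast
  have ctrl: "control r t \<in> borel_measurable (G t)"
    if t: "t \<le> T" and est: "\<And>s. s \<le> t \<Longrightarrow> obs_est r s \<in> borel_measurable (G s)" for t
  proof (cases "t = 0")
    case False
    then have t1: "t \<in> {1..T}" using t by simp
    have "(\<lambda>\<omega>. \<lambda>i\<in>{1..t}. obs_est r i \<omega>) \<in> measurable (G t) (Pi\<^sub>M {1..t} (\<lambda>_. borel))"
      by (rule measurable_restrict) (auto intro!: G_mono[OF est])
    then have "(\<lambda>\<omega>. \<phi> t (\<lambda>i\<in>{1..t}. obs_est r i \<omega>)) \<in> borel_measurable (G t)"
      by (rule measurable_compose[OF _ \<phi>(1)[OF t1]])
    moreover have "control r t \<in> borel_measurable (G t) \<longleftrightarrow> (\<lambda>\<omega>. \<phi> t (\<lambda>i\<in>{1..t}. obs_est r i \<omega>)) \<in> borel_measurable (G t)"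
      using \<phi>(2)[OF t1] by (intro measurable_cong) simp
    ultimately show ?thesis by simp
  qed (use run_control_0_G[OF p] in simp)
  have "\<forall>s\<le>t. obs_est r s \<in> borel_measurable (G s)" if "t \<le> T" for t
    using that
  proof (induction t)
    case 0 then show ?case using run_obs_est_0_G[OF p] by simp
  next
    case (Suc t)
    then have "obs_est r (Suc t) \<in> borel_measurable (G (Suc t))"
      using ctrl[of t] run_obs_est_Suc_G[OF p, of t] by simp
    then show ?case using Suc by (auto simp: le_Suc_eq)
  qed
  then show ?thesis using ctrl[OF t] t by blast
qed

text \<open>An arbitrary control law carries no moment assumption; the finiteness of its cost has to
  supply one. Laws of infinite cost satisfy the lower bound trivially.\<close>

lemma finite_cost_admissible:
  assumes o: "observer_controlled M \<alpha> W V P0 x0 w v T r"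
    and fin: "(\<integral>\<^sup>+ \<omega>. ennreal (F * (state r (T + 1) \<omega>)\<^sup>2
        + (\<Sum>t=1..T. Q * (state r t \<omega>)\<^sup>2 + R * (control r t \<omega>)\<^sup>2)) \<partial>M) < \<infinity>" (is "(\<integral>\<^sup>+\<omega>. ennreal (?c \<omega>) \<partial>M) < \<infinity>")
  shows "admissible T r"
proof -
  have p: "plant T r" using o by (simp add: observer_controlled_def)
  have uG: "control r t \<in> borel_measurable (G t)" if "t \<le> T" for t
    using observer_controlled_G[OF o that] .
  have um: "control r t \<in> borel_measurable M" if "t \<le> T" for t
    using G_imp_M[OF uG[OF that]] .
  have xm: "state r t \<in> borel_measurable M" if "t \<le> Suc T" for t
    using that
  proof (induction t)
    case 0
    have "state r 0 \<in> borel_measurable M \<longleftrightarrow> x0 \<in> borel_measurable M"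
      using run_initial[OF p] by (intro measurable_cong) simp
    then show ?case by simp
  next
    case (Suc t)
    then have [measurable]: "state r t \<in> borel_measurable M" "control r t \<in> borel_measurable M"
      using um by auto
    have "state r (Suc t) \<in> borel_measurable M
        \<longleftrightarrow> (\<lambda>\<omega>. \<alpha> * state r t \<omega> + w t \<omega> + control r t \<omega>) \<in> borel_measurable M"
      using run_state_Suc[OF p, of _ t] Suc by (intro measurable_cong) simp
    then show ?case by simp
  qed
  have part: "sqint M f"
    if f: "f \<in> borel_measurable M" and c: "c > 0" and le: "\<And>\<omega>. \<omega> \<in> space M \<Longrightarrow> c * (f \<omega>)\<^sup>2 \<le> ?c \<omega>" for f c
  proof (rule sqint_if_nn_integral_finite[OF f])
    have "(\<integral>\<^sup>+\<omega>. ennreal ((f \<omega>)\<^sup>2) \<partial>M) \<le> (\<integral>\<^sup>+\<omega>. ennreal (1 / c) * ennreal (?c \<omega>) \<partial>M)"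
    proof (rule nn_integral_mono)
      fix \<omega> assume "\<omega> \<in> space M"
      then have "(f \<omega>)\<^sup>2 \<le> 1 / c * ?c \<omega>" using le[of \<omega>] c by (simp add: field_simps)
      then show "ennreal ((f \<omega>)\<^sup>2) \<le> ennreal (1 / c) * ennreal (?c \<omega>)"
        using c by (simp add: ennreal_mult'[symmetric] ennreal_leI)
    qed
    also have "\<dots> = ennreal (1 / c) * (\<integral>\<^sup>+\<omega>. ennreal (?c \<omega>) \<partial>M)"
    proof (rule nn_integral_cmult)
      have [measurable]: "state r (T + 1) \<in> borel_measurable M" using xm by simp
      have [measurable]: "t \<in> {1..T} \<Longrightarrow> state r t \<in> borel_measurable M"
        "t \<in> {1..T} \<Longrightarrow> control r t \<in> borel_measurable M" for t
        using xm um by auto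
      show "(\<lambda>\<omega>. ennreal (?c \<omega>)) \<in> borel_measurable M" by measurable
    qed
    also have "\<dots> < \<infinity>" using fin by (simp add: ennreal_mult_less_top)
    finally show "(\<integral>\<^sup>+\<omega>. ennreal ((f \<omega>)\<^sup>2) \<partial>M) < \<infinity>" .
  qed
  have stage: "Q * (state r t \<omega>)\<^sup>2 + R * (control r t \<omega>)\<^sup>2
      \<le> (\<Sum>t=1..T. Q * (state r t \<omega>)\<^sup>2 + R * (control r t \<omega>)\<^sup>2)" if "t \<in> {1..T}" for t \<omega>
    using that Q_nonneg R_nonneg by (intro member_le_sum) auto
  have sum_nn: "0 \<le> (\<Sum>t=1..T. Q * (state r t \<omega>)\<^sup>2 + R * (control r t \<omega>)\<^sup>2)" for \<omega>
    using Q_nonneg R_nonneg by (intro sum_nonneg) auto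
  have "sqint M (control r t)" if t: "t \<in> {1..T}" for t
  proof (cases "R = 0")
    case False
    then have "R > 0" using R_nonneg by simp
    then show ?thesis
    proof (rule part[rotated])
      fix \<omega>
      have "0 \<le> F * (state r (T + 1) \<omega>)\<^sup>2" "0 \<le> Q * (state r t \<omega>)\<^sup>2" using F_pos Q_nonneg by auto
      then show "R * (control r t \<omega>)\<^sup>2 \<le> ?c \<omega>" using stage[OF t, of \<omega>] by linarith
    qed (use um t in auto)
  next
    case True
    \<comment> \<open>Without a control penalty the cost does not mention the control. The equation
      for \<open>S\<close> then forces \<open>Q = S\<close>, so all states from time 1 on are
      penalized, and the control is recovered from consecutive states and the process noise.\<close>
    have "S * S = Q * S" using S_eq True by (simp add: power2_eq_square)
    then have Q_pos: "Q > 0" using S_pos by simp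
    have x: "sqint M (state r s)" if s: "s \<in> {1..Suc T}" for s
    proof (cases "s = Suc T")
      case True
      show ?thesis
      proof (rule part[OF _ F_pos])
        show "F * (state r s \<omega>)\<^sup>2 \<le> ?c \<omega>" for \<omega> using sum_nn[of \<omega>] True by simp
      qed (use xm True in auto)
    next
      case False
      then have s: "s \<in> {1..T}" using s by auto
      show ?thesis
      proof (rule part[OF _ Q_pos])
        fix \<omega>
        have "0 \<le> F * (state r (T + 1) \<omega>)\<^sup>2" "0 \<le> R * (control r s \<omega>)\<^sup>2" using F_pos R_nonneg by auto
        then show "Q * (state r s \<omega>)\<^sup>2 \<le> ?c \<omega>" using stage[OF s, of \<omega>] by linarith
      qed (use xm s in auto)
    qed
    have "sqint M (\<lambda>\<omega>. state r (Suc t) \<omega> - \<alpha> * state r t \<omega> - w t \<omega>)"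
      using x t w_moments by (intro sqint_diff sqint_cmult) auto
    then show ?thesis by (rule sqint_cong) (use run_state_Suc[OF p, of _ t] t in simp)
  qed
  then show ?thesis using p uG by (auto simp: admissible_def)
qed

lemma observer_cost_lower_bound:
  assumes o: "observer_controlled M \<alpha> W V P0 x0 w v T r" and T: "T \<ge> 1"
  shows "ereal (base_cost T / real T) \<le> horizon_cost M F Q R T r"
proof (cases "(\<integral>\<^sup>+ \<omega>. ennreal (F * (state r (T + 1) \<omega>)\<^sup>2
        + (\<Sum>t=1..T. Q * (state r t \<omega>)\<^sup>2 + R * (control r t \<omega>)\<^sup>2)) \<partial>M) < \<infinity>")
  case True
  have "0 \<le> (\<Sum>t=1..T. (ctg T (Suc t) + R) * msq (\<lambda>\<omega>. control r t \<omega> + L T t * obs_est r t \<omega>))"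
    using ctg_pos R_nonneg by (intro sum_nonneg mult_nonneg_nonneg add_nonneg_nonneg) (auto intro: less_imp_le)
  then show ?thesis
    unfolding horizon_cost_admissible[OF finite_cost_admissible[OF o True] T]
    by (simp add: divide_right_mono)
next
  case False
  then have "horizon_cost M F Q R T r = \<infinity>" using T unfolding horizon_cost_def by (simp add: not_less top.extremum_unique)
  then show ?thesis by simp
qed

lemma average_cost_lower_bound:
  assumes "\<And>T. T \<ge> 1 \<Longrightarrow> observer_controlled M \<alpha> W V P0 x0 w v T (r T)"
  shows "ereal optimal_cost \<le> average_cost M F Q R r"
proof -
  have "(\<lambda>T. ereal (base_cost T / real T)) \<longlonglongrightarrow> ereal optimal_cost"
    using base_cost_tendsto by simp
  then have "ereal optimal_cost = limsup (\<lambda>T. ereal (base_cost T / real T))"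
    by (rule lim_imp_Limsup[OF sequentially_bot, symmetric])
  also have "\<dots> \<le> average_cost M F Q R r"
    unfolding average_cost_def
    by (intro Limsup_mono eventually_sequentiallyI[of 1] observer_cost_lower_bound assms)
  finally show ?thesis .
qed

lemma lqg_controlled_observer_controlled:
  assumes q: "observer_lqg_controlled M \<alpha> W V P0 F Q R x0 w v T q"
  shows "observer_controlled M \<alpha> W V P0 x0 w v T q"
  unfolding observer_controlled_def
proof (intro conjI exI[of _ "\<lambda>t y. - L T t * y t"] ballI)
  show "plant T q" using q by (simp add: observer_lqg_controlled_def)
  fix t assume t: "t \<in> {1..T}"
  show "(\<lambda>y. - L T t * y t) \<in> borel_measurable (Pi\<^sub>M {1..t} (\<lambda>_. borel))"
    using t by (intro borel_measurable_times borel_measurable_const measurable_component_singleton) simp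
  fix \<omega> assume "\<omega> \<in> space M"
  then show "control q t \<omega> = - L T t * (\<lambda>i\<in>{1..t}. obs_est q i \<omega>) t"
    using q t by (simp add: observer_lqg_controlled_def)
qed

lemma lqg_controlled_admissible:
  assumes q: "observer_lqg_controlled M \<alpha> W V P0 F Q R x0 w v T q"
  shows "admissible T q"
proof -
  have p: "plant T q" using q by (simp add: observer_lqg_controlled_def)
  have step: "sqint M (control q t)" if "t \<le> T" "sqint M (obs_est q t)" for t
  proof (cases "t = 0")
    case False
    have "sqint M (\<lambda>\<omega>. - L T t * obs_est q t \<omega>)" using that by (intro sqint_cmult)
    then show ?thesis
      by (rule sqint_cong) (use q False that in \<open>simp add: observer_lqg_controlled_def\<close>)
  qed (use run_control_0_G[OF p] in simp)
  have "sqint M (obs_est q t)" if "t \<le> T" for t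
    using that
  proof (induction t)
    case 0 then show ?case using run_obs_est_0_G[OF p] by simp
  next
    case (Suc t) then show ?case using step[of t] run_obs_est_Suc_sqint[OF p, of t] by simp
  qed
  then show ?thesis
    using p step observer_controlled_G[OF lqg_controlled_observer_controlled[OF q]]
    by (auto simp: admissible_def)
qed

lemma lqg_controlled_average_cost:
  assumes q: "\<And>T. T \<ge> 1 \<Longrightarrow> observer_lqg_controlled M \<alpha> W V P0 F Q R x0 w v T (q T)"
  shows "average_cost M F Q R q = ereal optimal_cost"
proof -
  have "horizon_cost M F Q R T (q T) = ereal (base_cost T / real T)" if T: "T \<ge> 1" for T
  proof -
    have "(\<Sum>t=1..T. (ctg T (Suc t) + R) * msq (\<lambda>\<omega>. control (q T) t \<omega> + L T t * obs_est (q T) t \<omega>)) = 0"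
    proof (rule sum.neutral, rule ballI)
      fix t assume "t \<in> {1..T}"
      then have "msq (\<lambda>\<omega>. control (q T) t \<omega> + L T t * obs_est (q T) t \<omega>) = msq (\<lambda>_. 0)"
        using q[OF T] by (intro msq_cong) (simp add: observer_lqg_controlled_def)
      then show "(ctg T (Suc t) + R) * msq (\<lambda>\<omega>. control (q T) t \<omega> + L T t * obs_est (q T) t \<omega>) = 0"
        by simp
    qed
    then show ?thesis
      using horizon_cost_admissible[OF lqg_controlled_admissible[OF q[OF T]] T] by simp
  qed
  then have "average_cost M F Q R q = limsup (\<lambda>T. ereal (base_cost T / real T))"
    unfolding average_cost_def by (intro Limsup_eq eventually_sequentiallyI[of 1])
  also have "\<dots> = ereal optimal_cost"
    using base_cost_tendsto by (intro lim_imp_Limsup) simp_all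
  finally show ?thesis .
qed

text \<open>The infimum needs a run that attains it. The estimate is generated first, driven by the
  innovations; adding \<open>filt_err\<close> then gives a state that satisfies the plant
  equations.\<close>

primrec lqg_est :: "nat \<Rightarrow> nat \<Rightarrow> 'a \<Rightarrow> real" where
  "lqg_est T 0 = (\<lambda>_. 0)"
| "lqg_est T (Suc t) = (\<lambda>\<omega>. \<alpha> * lqg_est T t \<omega> + (if t = 0 then 0 else - L T t * lqg_est T t \<omega>)
      + K (Suc t) * innov (Suc t) \<omega>)"

definition lqg_loop :: "nat \<Rightarrow> 'a loop" where
  "lqg_loop T = \<lparr> state = (\<lambda>t \<omega>. lqg_est T t \<omega> + filt_err t \<omega>),
     meas = (\<lambda>t \<omega>. lqg_est T t \<omega> + filt_err t \<omega> + v t \<omega>),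
     control = (\<lambda>t \<omega>. if t = 0 then 0 else - L T t * lqg_est T t \<omega>),
     obs_est = lqg_est T \<rparr>"

lemma lqg_loop_controlled: "observer_lqg_controlled M \<alpha> W V P0 F Q R x0 w v T (lqg_loop T)"
proof -
  have "plant T (lqg_loop T)"
    unfolding plant_and_observer_def
  proof (intro ballI conjI allI impI)
    fix \<omega> t assume "t \<in> {1..T}"
    then obtain s where t: "t = Suc s" by (cases t) auto
    show "obs_est (lqg_loop T) t \<omega> = \<alpha> * obs_est (lqg_loop T) (t - 1) \<omega> + control (lqg_loop T) (t - 1) \<omega>
             + K t * (meas (lqg_loop T) t \<omega> - \<alpha> * obs_est (lqg_loop T) (t - 1) \<omega> - control (lqg_loop T) (t - 1) \<omega>)"
    proof -
      have "meas (lqg_loop T) t \<omega> - \<alpha> * obs_est (lqg_loop T) (t - 1) \<omega> - control (lqg_loop T) (t - 1) \<omega> = innov t \<omega>"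
        unfolding t by (simp add: lqg_loop_def innov_def algebra_simps)
      then show ?thesis unfolding t by (simp add: lqg_loop_def)
    qed
  qed (simp_all add: lqg_loop_def innov_def algebra_simps)
  then show ?thesis by (simp add: observer_lqg_controlled_def lqg_loop_def)
qed

lemma observer_cost_eq: "observer_cost M \<alpha> W V P0 F Q R x0 w v = ereal optimal_cost"
  unfolding observer_cost_def
proof (rule antisym)
  have "average_cost M F Q R lqg_loop = ereal optimal_cost"
    by (rule lqg_controlled_average_cost) (rule lqg_loop_controlled)
  moreover have "\<forall>T\<ge>1. observer_controlled M \<alpha> W V P0 x0 w v T (lqg_loop T)"
    using lqg_loop_controlled by (blast intro: lqg_controlled_observer_controlled)
  ultimately show "Inf {average_cost M F Q R r |r. \<forall>T\<ge>1. observer_controlled M \<alpha> W V P0 x0 w v T (r T)} \<le> ereal optimal_cost"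
    by (intro Inf_lower CollectI exI[of _ lqg_loop]) simp
  show "ereal optimal_cost \<le> Inf {average_cost M F Q R r |r. \<forall>T\<ge>1. observer_controlled M \<alpha> W V P0 x0 w v T (r T)}"
  proof (rule Inf_greatest)
    fix c assume "c \<in> {average_cost M F Q R r |r. \<forall>T\<ge>1. observer_controlled M \<alpha> W V P0 x0 w v T (r T)}"
    then obtain r where "c = average_cost M F Q R r" "\<And>T. T \<ge> 1 \<Longrightarrow> observer_controlled M \<alpha> W V P0 x0 w v T (r T)"
      by blast
    then show "ereal optimal_cost \<le> c" using average_cost_lower_bound[of r] by simp
  qed
qed

end

subsection \<open>The coded loop\<close>


context gaussian_plant begin

text \<open>
  The distortion bound holds for each fixed source value; since the channel noise is independent
  of the source, Fubini carries it over to the random source.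
\<close>

lemma code_distortion:
  fixes E :: "real \<Rightarrow> nat \<Rightarrow> real" and D :: "(nat \<Rightarrow> real) \<Rightarrow> real" and a :: real
  assumes f: "f \<in> borel_measurable (G t)"
    and E[measurable]: "\<And>i. i < KC \<Longrightarrow> (\<lambda>s. E s i) \<in> borel_measurable borel"
    and D[measurable]: "D \<in> borel_measurable (Pi\<^sub>M {..<KC} (\<lambda>_. borel))"
    and bound: "\<And>s. (\<integral>\<^sup>+ \<omega>. ennreal ((D (\<lambda>i\<in>{..<KC}. E s i + n (Suc t) i \<omega>) - s)\<^sup>2) \<partial>M) \<le> B"
  defines "X \<equiv> \<lambda>\<omega>. a * innov (Suc t) \<omega> + f \<omega>"
  shows "(\<integral>\<^sup>+ \<omega>. ennreal ((D (\<lambda>i\<in>{..<KC}. E (X \<omega>) i + n (Suc t) i \<omega>) - X \<omega>)\<^sup>2) \<partial>M) \<le> B"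
proof -
  let ?N1 = "Pi\<^sub>M {0::nat} (\<lambda>_. borel :: real measure)" and ?N2 = "Pi\<^sub>M {..<KC} (\<lambda>_. borel :: real measure)"
  let ?X = "\<lambda>\<omega>. \<lambda>i\<in>{0::nat}. X \<omega>" and ?Y = "\<lambda>\<omega>. \<lambda>i\<in>{..<KC}. n (Suc t) i \<omega>"
  let ?H = "\<lambda>x y. ennreal ((D (\<lambda>i\<in>{..<KC}. E (x 0) i + y i) - x (0::nat))\<^sup>2)"
  have ind: "indep_var ?N1 ?X ?N2 ?Y" unfolding X_def by (rule channel_indep_source[OF f])
  then have [measurable]: "?X \<in> measurable M ?N1" "?Y \<in> measurable M ?N2" by (auto simp: indep_var_eq)
  have E'[measurable]: "(\<lambda>z. E (fst z 0) i) \<in> borel_measurable (?N1 \<Otimes>\<^sub>M ?N2)" if "i < KC" for i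
    by (rule measurable_compose[OF _ E[OF that]]) measurable
  have H0: "(\<lambda>z. \<lambda>i\<in>{..<KC}. E (fst z 0) i + snd z i) \<in> measurable (?N1 \<Otimes>\<^sub>M ?N2) ?N2"
  proof (rule measurable_restrict)
    fix i assume i: "i \<in> {..<KC}"
    have [measurable]: "(\<lambda>z. snd z i) \<in> borel_measurable (?N1 \<Otimes>\<^sub>M ?N2)"
      using i by (intro measurable_compose[OF measurable_snd] measurable_component_singleton)
    show "(\<lambda>z. E (fst z 0) i + snd z i) \<in> borel_measurable (?N1 \<Otimes>\<^sub>M ?N2)"
      using E'[of i] i by simp
  qed
  have [measurable]: "(\<lambda>z. D (\<lambda>i\<in>{..<KC}. E (fst z 0) i + snd z i)) \<in> borel_measurable (?N1 \<Otimes>\<^sub>M ?N2)"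
    by (rule measurable_compose[OF H0 D])
  have H: "(\<lambda>z. ?H (fst z) (snd z)) \<in> borel_measurable (?N1 \<Otimes>\<^sub>M ?N2)" by measurable
  have eq: "?H (?X \<omega>') (?Y \<omega>) = ennreal ((D (\<lambda>i\<in>{..<KC}. E (X \<omega>') i + n (Suc t) i \<omega>) - X \<omega>')\<^sup>2)" for \<omega>' \<omega>
    by (simp cong: restrict_cong)
  have J: "distr M (?N1 \<Otimes>\<^sub>M ?N2) (\<lambda>\<omega>. (?X \<omega>, ?Y \<omega>)) = distr M ?N1 ?X \<Otimes>\<^sub>M distr M ?N2 ?Y"
    using ind by (simp add: indep_var_distribution_eq)
  interpret DY: prob_space "distr M ?N2 ?Y" by (rule prob_space_distr) simp
  interpret DX: prob_space "distr M ?N1 ?X" by (rule prob_space_distr) simp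
  have "(\<integral>\<^sup>+ \<omega>. ennreal ((D (\<lambda>i\<in>{..<KC}. E (X \<omega>) i + n (Suc t) i \<omega>) - X \<omega>)\<^sup>2) \<partial>M)
      = (\<integral>\<^sup>+ z. ?H (fst z) (snd z) \<partial>distr M (?N1 \<Otimes>\<^sub>M ?N2) (\<lambda>\<omega>. (?X \<omega>, ?Y \<omega>)))"
    using H by (subst nn_integral_distr) (simp_all only: eq fst_conv snd_conv, measurable)
  also have "\<dots> = (\<integral>\<^sup>+ x. \<integral>\<^sup>+ y. ?H x y \<partial>distr M ?N2 ?Y \<partial>distr M ?N1 ?X)"
    unfolding J using H by (subst DY.nn_integral_fst[symmetric]) simp_all
  also have "\<dots> \<le> (\<integral>\<^sup>+ x. B \<partial>distr M ?N1 ?X)"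
  proof (rule nn_integral_mono)
    fix x assume x: "x \<in> space (distr M ?N1 ?X)"
    then have x': "x \<in> space ?N1" by simp
    have "(\<integral>\<^sup>+ y. ?H x y \<partial>distr M ?N2 ?Y) = (\<integral>\<^sup>+ \<omega>. ?H x (?Y \<omega>) \<partial>M)"
      using measurable_Pair2[OF H x'] by (subst nn_integral_distr) simp_all
    also have "\<dots> = (\<integral>\<^sup>+ \<omega>. ennreal ((D (\<lambda>i\<in>{..<KC}. E (x 0) i + n (Suc t) i \<omega>) - x 0)\<^sup>2) \<partial>M)"
      by (simp cong: restrict_cong)
    finally show "(\<integral>\<^sup>+ y. ?H x y \<partial>distr M ?N2 ?Y) \<le> B" using bound[of "x 0"] by simp
  qed
  also have "\<dots> = B" using DX.emeasure_space_1 by simp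
  finally show ?thesis .
qed

end

locale coded_lqg = lqg M P0 W V SNR KC x0 w v n \<alpha> F Q R S P
  for M :: "'a measure" and P0 W V SNR :: real and KC :: nat
    and x0 :: "'a \<Rightarrow> real" and w v :: "nat \<Rightarrow> 'a \<Rightarrow> real" and n :: "nat \<Rightarrow> nat \<Rightarrow> 'a \<Rightarrow> real"
    and \<alpha> F Q R S P :: real +
  fixes SDR :: real and enc :: "nat \<Rightarrow> nat \<Rightarrow> real \<Rightarrow> nat \<Rightarrow> real"
    and dec :: "nat \<Rightarrow> nat \<Rightarrow> (nat \<Rightarrow> real) \<Rightarrow> real" and r :: "nat \<Rightarrow> 'a coded_loop"
  assumes \<alpha>_gt_1: "\<alpha> > 1" and SDR_pos: "SDR > 0" and stable: "\<alpha>\<^sup>2 < 1 + SDR"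
    and scheme: "\<And>T. T \<ge> 1 \<Longrightarrow>
      coding_and_control M \<alpha> W V P0 F Q R KC SDR x0 w v n (enc T) (dec T) T (r T)"
    and code: "\<And>T. T \<ge> 1 \<Longrightarrow> bounded_distortion_code M KC SDR n (enc T) (dec T) T (r T)"
begin

abbreviation "\<beta> \<equiv> SDR / (1 + SDR)"

definition src_var :: "nat \<Rightarrow> real" where
  "src_var t = rcv_pred_mse \<alpha> W V P0 SDR t - kf_filt_mse \<alpha> W V P0 t"

text \<open>The target bound for the mean square of observer estimate minus receiver estimate: after
  decoding, a share 1 / (1 + SDR) of the nominal source variance remains. Both estimates start at
  0.\<close>

definition gap_var :: "nat \<Rightarrow> real" where
  "gap_var t = (if t = 0 then 0 else src_var t / (1 + SDR))"

text \<open>Recasts the scheme's recursion for P^r as a variance balance for the source: amplified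
  old gap plus the mean square of the observer's new correction.\<close>

lemma src_var_Suc: "src_var (Suc t) = \<alpha>\<^sup>2 * gap_var t + (Pt (Suc t) - err_var (Suc t))"
proof (cases t)
  case 0
  then show ?thesis by (simp add: src_var_def gap_var_def err_var_def)
next
  case (Suc s)
  have e: "kf_filt_mse \<alpha> W V P0 (Suc s) = err_var (Suc s)" for s by (simp add: err_var_def)
  have D: "1 + SDR \<noteq> 0" using SDR_pos by simp
  let ?p = "rcv_pred_mse \<alpha> W V P0 SDR (Suc s)" and ?b = "err_var (Suc s)"
  have "\<alpha>\<^sup>2 / (1 + SDR) * (?p + SDR * ?b) = \<alpha>\<^sup>2 * ((?p - ?b) / (1 + SDR)) + \<alpha>\<^sup>2 * ?b"
    using D by (simp add: divide_simps) (simp add: algebra_simps)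
  then have "rcv_pred_mse \<alpha> W V P0 SDR (Suc (Suc s)) = \<alpha>\<^sup>2 * ((?p - ?b) / (1 + SDR)) + Pt (Suc (Suc s))"
    unfolding Pt_Suc by (simp add: e)
  then show ?thesis unfolding Suc by (simp add: src_var_def gap_var_def e)
qed

lemma innovation_variance_pos: "Pt (Suc t) - err_var (Suc t) > 0"
  unfolding innovation_variance[symmetric] using Pt_pos[of t] Pt_V_pos[of t]
  by (auto intro!: mult_pos_pos simp: kf_gain_def)

lemma gap_var_nonneg: "gap_var t \<ge> 0"
proof (induction t)
  case (Suc t)
  then have "src_var (Suc t) \<ge> 0" unfolding src_var_Suc using innovation_variance_pos[of t] by simp
  then show ?case using SDR_pos by (simp add: gap_var_def)
qed (simp add: gap_var_def)

text \<open>Strictness makes the normalization invertible, so the source can be recovered from its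
  normalized version.\<close>

lemma src_var_pos: "src_var (Suc t) > 0"
  unfolding src_var_Suc using innovation_variance_pos[of t] gap_var_nonneg[of t] by (simp add: add_nonneg_pos)

lemma gap_var_tendsto: "gap_var \<longlonglongrightarrow> (P - P * V / (P + V)) / (1 + SDR - \<alpha>\<^sup>2)"
proof -
  have "gap_var \<longlonglongrightarrow> ((P - P * V / (P + V)) / (1 + SDR)) / (1 - \<alpha>\<^sup>2 / (1 + SDR))"
  proof (rule affine_recursion_tendsto)
    show "gap_var (Suc t) = \<alpha>\<^sup>2 / (1 + SDR) * gap_var t + (Pt (Suc t) - err_var (Suc t)) / (1 + SDR)" for t
      by (simp add: gap_var_def[of "Suc t"] src_var_Suc add_divide_distrib)
    show "(\<lambda>t. (Pt (Suc t) - err_var (Suc t)) / (1 + SDR)) \<longlonglongrightarrow> (P - P * V / (P + V)) / (1 + SDR)"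
      using SDR_pos by (intro tendsto_intros LIMSEQ_Suc[OF Pt_tendsto] LIMSEQ_Suc[OF err_var_tendsto]) simp
  qed (use SDR_pos stable in auto)
  also have "((P - P * V / (P + V)) / (1 + SDR)) / (1 - \<alpha>\<^sup>2 / (1 + SDR)) = (P - P * V / (P + V)) / (1 + SDR - \<alpha>\<^sup>2)"
  proof -
    have "(1 + SDR) * (1 - \<alpha>\<^sup>2 / (1 + SDR)) = 1 + SDR - \<alpha>\<^sup>2"
      using SDR_pos by (simp add: right_diff_distrib)
    then show ?thesis by (simp only: divide_divide_eq_left)
  qed
  finally show ?thesis .
qed

definition gap :: "nat \<Rightarrow> nat \<Rightarrow> 'a \<Rightarrow> real" where
  "gap T t \<omega> = obs_est (r T) t \<omega> - rcv_est (r T) t \<omega>"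

context
  fixes T :: nat
  assumes T: "T \<ge> 1"
begin

lemma coded_plant: "plant T (r T)"
  using scheme[OF T] by (simp add: coding_and_control_def)

lemma coded_signals:
  assumes t: "t < T" and \<omega>: "\<omega> \<in> space M"
  shows "source (r T) (Suc t) \<omega> = obs_est (r T) (Suc t) \<omega> - (\<alpha> * rcv_est (r T) t \<omega> + control (r T) t \<omega>)"
    "norm_source (r T) (Suc t) \<omega> = source (r T) (Suc t) \<omega> / sqrt (src_var (Suc t))"
    "norm_source_est (r T) (Suc t) \<omega> = dec T (Suc t)
        (\<lambda>i\<in>{..<KC}. enc T (Suc t) (norm_source (r T) (Suc t) \<omega>) i + n (Suc t) i \<omega>)"
    "rcv_est (r T) (Suc t) \<omega> = (\<alpha> * rcv_est (r T) t \<omega> + control (r T) t \<omega>)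
        + \<beta> * (sqrt (src_var (Suc t)) * norm_source_est (r T) (Suc t) \<omega>)"
    "control (r T) (Suc t) \<omega> = - L T (Suc t) * rcv_est (r T) (Suc t) \<omega>"
proof -
  have "Suc t \<in> {1..T}" using t by simp
  with scheme[OF T] \<omega> have s:
    "rcv_pred (r T) (Suc t) \<omega> = \<alpha> * rcv_est (r T) t \<omega> + control (r T) t \<omega>"
    "source (r T) (Suc t) \<omega> = obs_est (r T) (Suc t) \<omega> - rcv_pred (r T) (Suc t) \<omega>"
    "norm_source (r T) (Suc t) \<omega> = source (r T) (Suc t) \<omega> / sqrt (src_var (Suc t))"
    "\<And>i. i < KC \<Longrightarrow> chan_in (r T) (Suc t) i \<omega> = enc T (Suc t) (norm_source (r T) (Suc t) \<omega>) i"
    "\<And>i. i < KC \<Longrightarrow> chan_out (r T) (Suc t) i \<omega> = chan_in (r T) (Suc t) i \<omega> + n (Suc t) i \<omega>"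
    "norm_source_est (r T) (Suc t) \<omega> = dec T (Suc t) (\<lambda>i\<in>{..<KC}. chan_out (r T) (Suc t) i \<omega>)"
    "source_est (r T) (Suc t) \<omega> = sqrt (src_var (Suc t)) * norm_source_est (r T) (Suc t) \<omega>"
    "rcv_est (r T) (Suc t) \<omega> = rcv_pred (r T) (Suc t) \<omega> + \<beta> * source_est (r T) (Suc t) \<omega>"
    "control (r T) (Suc t) \<omega> = - lqg_gain \<alpha> F Q R T (Suc t) * rcv_est (r T) (Suc t) \<omega>"
    unfolding coding_and_control_def Let_def src_var_def by (metis diff_Suc_1)+
  show "source (r T) (Suc t) \<omega> = obs_est (r T) (Suc t) \<omega> - (\<alpha> * rcv_est (r T) t \<omega> + control (r T) t \<omega>)"
    "norm_source (r T) (Suc t) \<omega> = source (r T) (Suc t) \<omega> / sqrt (src_var (Suc t))"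
    "rcv_est (r T) (Suc t) \<omega> = (\<alpha> * rcv_est (r T) t \<omega> + control (r T) t \<omega>)
        + \<beta> * (sqrt (src_var (Suc t)) * norm_source_est (r T) (Suc t) \<omega>)"
    "control (r T) (Suc t) \<omega> = - L T (Suc t) * rcv_est (r T) (Suc t) \<omega>"
    using s by simp_all
  have "(\<lambda>i\<in>{..<KC}. chan_out (r T) (Suc t) i \<omega>)
      = (\<lambda>i\<in>{..<KC}. enc T (Suc t) (norm_source (r T) (Suc t) \<omega>) i + n (Suc t) i \<omega>)"
    using s(4,5) by (intro restrict_ext) simp
  then show "norm_source_est (r T) (Suc t) \<omega> = dec T (Suc t)
        (\<lambda>i\<in>{..<KC}. enc T (Suc t) (norm_source (r T) (Suc t) \<omega>) i + n (Suc t) i \<omega>)"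
    using s(6) by simp
qed

text \<open>The control is known on both sides and cancels; what must be transmitted is the old gap,
  amplified, and the fresh correction.\<close>

lemma source_decomposition:
  assumes t: "t < T" and \<omega>: "\<omega> \<in> space M"
  shows "source (r T) (Suc t) \<omega> = \<alpha> * gap T t \<omega> + K (Suc t) * innov (Suc t) \<omega>"
  using coded_signals(1)[OF t \<omega>] run_decomposition(2)[OF coded_plant \<omega> t]
  by (simp add: gap_def algebra_simps)

text \<open>With X the normalized source, N the effective noise and c^2 the nominal variance, the
  new gap is c (1 - \<beta>) X - c \<beta> N. As X and N are orthogonal with E X^2 \<le> 1 and E N^2
  \<le> 1/SDR, its mean square is at most c^2 ((1 - \<beta>)^2 + \<beta>^2 / SDR). The scheme's
  \<open>\<beta>\<close> minimizes this expression, with value c^2 / (1 + SDR).\<close>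

lemma gap_step:
  assumes t: "t < T"
    and m: "rcv_est (r T) t \<in> borel_measurable (G t)" "obs_est (r T) t \<in> borel_measurable (G t)"
      "control (r T) t \<in> borel_measurable (G t)"
    and sq: "sqint M (gap T t)" and le: "msq (gap T t) \<le> gap_var t"
  shows "rcv_est (r T) (Suc t) \<in> borel_measurable (G (Suc t))"
    "sqint M (gap T (Suc t))" "msq (gap T (Suc t)) \<le> gap_var (Suc t)"
proof -
  let ?s = "source (r T) (Suc t)" and ?ns = "norm_source (r T) (Suc t)" and ?ne = "norm_source_est (r T) (Suc t)"
  let ?E = "enc T (Suc t)" and ?D = "dec T (Suc t)"
  define c where "c = sqrt (src_var (Suc t))"
  have c: "c > 0" "c\<^sup>2 = src_var (Suc t)" using src_var_pos[of t] by (auto simp: c_def)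
  define N where "N = (\<lambda>\<omega>. ?ne \<omega> - ?ns \<omega>)"
  have t1: "Suc t \<in> {1..T}" using t by simp
  have cE: "\<And>i. i < KC \<Longrightarrow> (\<lambda>s. ?E s i) \<in> borel_measurable borel"
    and cD: "?D \<in> borel_measurable (Pi\<^sub>M {..<KC} (\<lambda>_. borel))"
    and unb: "expectation (\<lambda>\<omega>. ?ns \<omega> * N \<omega>) = 0"
    and dist: "\<And>s. (\<integral>\<^sup>+ \<omega>. ennreal ((?D (\<lambda>i\<in>{..<KC}. ?E s i + n (Suc t) i \<omega>) - s)\<^sup>2) \<partial>M) \<le> ennreal (1 / SDR)"
    using code[OF T] t1 unfolding bounded_distortion_code_def N_def by blast+
  have gG[measurable]: "gap T t \<in> borel_measurable (G t)"
    unfolding gap_def[abs_def] using m by simp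
  have gG': "gap T t \<in> borel_measurable (G (Suc t))" using gG by (rule G_mono) simp
  have iG: "innov (Suc t) \<in> borel_measurable (G (Suc t))" by (rule innov_in_G) auto
  \<comment> \<open>The normalized source in the shape that \<open>code_distortion\<close> expects,
    a multiple of the innovation plus a function of \<open>G t\<close>. The recorded signal agrees
    with it only on \<open>space M\<close>.\<close>
  define X where "X = (\<lambda>\<omega>. (K (Suc t) / c) * innov (Suc t) \<omega> + \<alpha> / c * gap T t \<omega>)"
  have ns: "?ns \<omega> = X \<omega>" if "\<omega> \<in> space M" for \<omega>
    using coded_signals(2)[OF t that] source_decomposition[OF t that]
    by (simp add: X_def c_def add_divide_distrib)
  have XG[measurable]: "X \<in> borel_measurable (G (Suc t))"
    unfolding X_def using gG' iG by measurable
  have Xsq: "sqint M X" unfolding X_def using sq innov_moments by (intro sqint_add sqint_cmult)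
  have neX: "?ne \<omega> = ?D (\<lambda>i\<in>{..<KC}. ?E (X \<omega>) i + n (Suc t) i \<omega>)" if "\<omega> \<in> space M" for \<omega>
    using coded_signals(3)[OF t that] ns[OF that] by simp
  have neG: "?ne \<in> borel_measurable (G (Suc t))"
  proof -
    have "(\<lambda>\<omega>. \<lambda>i\<in>{..<KC}. ?E (X \<omega>) i + n (Suc t) i \<omega>) \<in> measurable (G (Suc t)) (Pi\<^sub>M {..<KC} (\<lambda>_. borel))"
    proof (rule measurable_restrict)
      fix i assume "i \<in> {..<KC}"
      then have i: "i < KC" by simp
      have "(\<lambda>\<omega>. ?E (X \<omega>) i) \<in> borel_measurable (G (Suc t))" by (rule measurable_compose[OF XG cE[OF i]])
      moreover have "n (Suc t) i \<in> borel_measurable (G (Suc t))" using i by (intro n_in_G) auto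
      ultimately show "(\<lambda>\<omega>. ?E (X \<omega>) i + n (Suc t) i \<omega>) \<in> borel_measurable (G (Suc t))" by measurable
    qed
    from measurable_compose[OF this cD]
    have "(\<lambda>\<omega>. ?D (\<lambda>i\<in>{..<KC}. ?E (X \<omega>) i + n (Suc t) i \<omega>)) \<in> borel_measurable (G (Suc t))" .
    then show ?thesis by (rule measurable_cong[THEN iffD2, rotated]) (use neX in simp)
  qed
  define N' where "N' = (\<lambda>\<omega>. ?ne \<omega> - X \<omega>)"
  have N'm: "N' \<in> borel_measurable M"
    unfolding N'_def using G_imp_M[OF neG] G_imp_M[OF XG] by measurable
  have NN: "N \<omega> = N' \<omega>" if "\<omega> \<in> space M" for \<omega> using ns[OF that] by (simp add: N_def N'_def)
  have "(\<integral>\<^sup>+\<omega>. ennreal ((N' \<omega>)\<^sup>2) \<partial>M)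
      = (\<integral>\<^sup>+ \<omega>. ennreal ((?D (\<lambda>i\<in>{..<KC}. ?E (X \<omega>) i + n (Suc t) i \<omega>) - X \<omega>)\<^sup>2) \<partial>M)"
    by (rule nn_integral_cong) (simp add: N'_def neX)
  also have "\<dots> \<le> ennreal (1 / SDR)"
    unfolding X_def by (rule code_distortion[OF _ cE cD dist]) measurable
  finally have N2: "(\<integral>\<^sup>+\<omega>. ennreal ((N' \<omega>)\<^sup>2) \<partial>M) \<le> ennreal (1 / SDR)" .
  then have Nsq: "sqint M N'"
    by (intro sqint_if_nn_integral_finite N'm) (auto intro: le_less_trans)
  have Nle: "msq N' \<le> 1 / SDR"
    using N2 SDR_pos unfolding nn_integral_sqint[OF Nsq] by (subst (asm) ennreal_le_iff) auto
  have orth: "expectation (\<lambda>\<omega>. X \<omega> * N' \<omega>) = 0"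
  proof -
    have "expectation (\<lambda>\<omega>. X \<omega> * N' \<omega>) = expectation (\<lambda>\<omega>. ?ns \<omega> * N \<omega>)"
      by (rule Bochner_Integration.integral_cong) (simp_all add: ns NN)
    then show ?thesis using unb by simp
  qed
  \<comment> \<open>The scheme divides by the nominal variance. Gap and innovation are orthogonal,
    so the bound on the old gap shows that the true variance does not exceed the nominal
    one.\<close>
  have Xle: "msq X \<le> 1"
  proof -
    have "expectation (\<lambda>\<omega>. gap T t \<omega> * innov (Suc t) \<omega>) = 0"
      by (rule indep_orthogonal[OF innov_indep_G[OF gG] sq]) (use innov_moments in auto)
    from msq_add_orthogonal[OF sq innov_moments(1) this]
    have "msq (\<lambda>\<omega>. \<alpha> / c * gap T t \<omega> + K (Suc t) / c * innov (Suc t) \<omega>)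
        = (\<alpha> / c)\<^sup>2 * msq (gap T t) + (K (Suc t) / c)\<^sup>2 * (Pt (Suc t) + V)"
      by (simp only: innov_moments(3))
    also have "\<dots> = (\<alpha>\<^sup>2 * msq (gap T t) + (K (Suc t))\<^sup>2 * (Pt (Suc t) + V)) / c\<^sup>2"
      by (simp add: power_divide add_divide_distrib)
    also have "\<dots> \<le> (\<alpha>\<^sup>2 * gap_var t + (K (Suc t))\<^sup>2 * (Pt (Suc t) + V)) / c\<^sup>2"
      using le by (intro divide_right_mono add_mono mult_left_mono) auto
    also have "\<dots> = 1"
      unfolding innovation_variance c(2) src_var_Suc[symmetric] using src_var_pos[of t] by simp
    finally show ?thesis unfolding X_def by (simp add: add.commute)
  qed
  have gap': "gap T (Suc t) \<omega> = (c / (1 + SDR)) * X \<omega> + (- c * \<beta>) * N' \<omega>" if \<omega>: "\<omega> \<in> space M" for \<omega>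
  proof -
    have "gap T (Suc t) \<omega> = ?s \<omega> - \<beta> * (c * ?ne \<omega>)"
      using coded_signals(1,4)[OF t \<omega>] by (simp add: gap_def c_def)
    also have "?s \<omega> = c * X \<omega>"
      using coded_signals(2)[OF t \<omega>] ns[OF \<omega>] c by (simp add: c_def[symmetric] field_simps)
    also have "c * X \<omega> - \<beta> * (c * ?ne \<omega>) = (c * (1 - \<beta>)) * X \<omega> + (- c * \<beta>) * N' \<omega>"
      by (simp add: N'_def algebra_simps)
    also have "c * (1 - \<beta>) = c / (1 + SDR)"
      using SDR_pos by (simp add: field_simps)
    finally show ?thesis .
  qed
  have "sqint M (\<lambda>\<omega>. (c / (1 + SDR)) * X \<omega> + (- c * \<beta>) * N' \<omega>)"
    using Xsq Nsq by (intro sqint_add sqint_cmult)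
  then show "sqint M (gap T (Suc t))" by (rule sqint_cong) (simp add: gap')
  have "msq (gap T (Suc t)) = msq (\<lambda>\<omega>. (c / (1 + SDR)) * X \<omega> + (- c * \<beta>) * N' \<omega>)"
    by (rule msq_cong) (rule gap')
  also have "\<dots> = (c / (1 + SDR))\<^sup>2 * msq X + (- c * \<beta>)\<^sup>2 * msq N'"
    by (rule msq_add_orthogonal[OF Xsq Nsq orth])
  also have "\<dots> \<le> (c / (1 + SDR))\<^sup>2 * 1 + (- c * \<beta>)\<^sup>2 * (1 / SDR)"
    using Xle Nle by (intro add_mono mult_left_mono) auto
  also have "\<dots> = c\<^sup>2 * ((1 + SDR) / (1 + SDR)\<^sup>2)"
    using SDR_pos by (simp add: power_divide power_mult_distrib power2_eq_square add_divide_distrib distrib_left)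
  also have "\<dots> = gap_var (Suc t)"
    using SDR_pos by (simp add: c(2)[unfolded power2_eq_square] gap_var_def power2_eq_square)
  finally show "msq (gap T (Suc t)) \<le> gap_var (Suc t)" .
  have [measurable]: "rcv_est (r T) t \<in> borel_measurable (G (Suc t))" "control (r T) t \<in> borel_measurable (G (Suc t))"
    using m by (auto intro: G_mono)
  note [measurable] = neG
  have "rcv_est (r T) (Suc t) \<in> borel_measurable (G (Suc t)) \<longleftrightarrow>
    (\<lambda>\<omega>. (\<alpha> * rcv_est (r T) t \<omega> + control (r T) t \<omega>) + \<beta> * (c * ?ne \<omega>)) \<in> borel_measurable (G (Suc t))"
    using coded_signals(4)[OF t] by (intro measurable_cong) (simp add: c_def)
  then show "rcv_est (r T) (Suc t) \<in> borel_measurable (G (Suc t))" by simp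
qed

text \<open>Feedback couples all signals: the next gap needs causality and moments of the present
  ones, and the control inherits its moments from estimate minus gap. Hence one simultaneous
  induction.\<close>

lemma gap_bounds:
  assumes "t \<le> T"
  shows "rcv_est (r T) t \<in> borel_measurable (G t) \<and> obs_est (r T) t \<in> borel_measurable (G t)
    \<and> control (r T) t \<in> borel_measurable (G t) \<and> sqint M (gap T t) \<and> msq (gap T t) \<le> gap_var t
    \<and> sqint M (control (r T) t) \<and> sqint M (obs_est (r T) t)"
  using assms
proof (induction t)
  case 0
  have z: "rcv_est (r T) 0 \<omega> = 0" "gap T 0 \<omega> = 0" if "\<omega> \<in> space M" for \<omega>
    using scheme[OF T] run_initial(3)[OF coded_plant that] that
    by (auto simp: coding_and_control_def gap_def)
  have "rcv_est (r T) 0 \<in> borel_measurable (G 0) \<longleftrightarrow> (\<lambda>_. 0 :: real) \<in> borel_measurable (G 0)"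
    using z by (intro measurable_cong) simp
  moreover have "sqint M (gap T 0)" by (rule sqint_cong[OF sqint_zero]) (simp add: z)
  moreover have "msq (gap T 0) = msq (\<lambda>_. 0)" by (rule msq_cong) (simp add: z)
  ultimately show ?case
    using run_obs_est_0_G[OF coded_plant] run_control_0_G[OF coded_plant] gap_var_nonneg[of 0] by simp
next
  case (Suc t)
  then have t: "t < T" by simp
  note IH = Suc.IH[OF less_imp_le[OF t]]
  have 1: "rcv_est (r T) (Suc t) \<in> borel_measurable (G (Suc t))"
    "sqint M (gap T (Suc t))" "msq (gap T (Suc t)) \<le> gap_var (Suc t)"
    using gap_step[OF t] IH by auto
  have 2: "obs_est (r T) (Suc t) \<in> borel_measurable (G (Suc t))" "sqint M (obs_est (r T) (Suc t))"
    using run_obs_est_Suc_G[OF coded_plant t] run_obs_est_Suc_sqint[OF coded_plant t] IH by auto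
  have "control (r T) (Suc t) \<in> borel_measurable (G (Suc t))
      \<longleftrightarrow> (\<lambda>\<omega>. - L T (Suc t) * rcv_est (r T) (Suc t) \<omega>) \<in> borel_measurable (G (Suc t))"
    using coded_signals(5)[OF t] by (intro measurable_cong) simp
  then have 3: "control (r T) (Suc t) \<in> borel_measurable (G (Suc t))" using 1 by simp
  have "sqint M (\<lambda>\<omega>. - L T (Suc t) * (obs_est (r T) (Suc t) \<omega> - gap T (Suc t) \<omega>))"
    using 1 2 by (intro sqint_cmult sqint_diff)
  then have "sqint M (control (r T) (Suc t))"
    by (rule sqint_cong) (use coded_signals(5)[OF t] in \<open>simp add: gap_def\<close>)
  then show ?case using 1 2 3 by simp
qed

lemma coded_admissible: "admissible T (r T)"
  using coded_plant gap_bounds by (auto simp: admissible_def)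

lemma coded_control:
  assumes "t \<in> {1..T}" "\<omega> \<in> space M"
  shows "control (r T) t \<omega> = - L T t * (obs_est (r T) t \<omega> - gap T t \<omega>)"
proof -
  from assms(1) obtain s where "t = Suc s" "s < T" by (cases t) auto
  then show ?thesis using coded_signals(5)[of s \<omega>] assms by (simp add: gap_def)
qed

lemma coded_horizon_cost:
  "horizon_cost M F Q R T (r T)
    \<le> ereal (base_cost T / real T + (\<Sum>t=1..T. ric_weight (T - t) * gap_var t) / real T)"
proof -
  have "(ctg T (Suc t) + R) * msq (\<lambda>\<omega>. control (r T) t \<omega> + L T t * obs_est (r T) t \<omega>)
      \<le> ric_weight (T - t) * gap_var t" if t: "t \<in> {1..T}" for t
  proof -
    have "msq (\<lambda>\<omega>. control (r T) t \<omega> + L T t * obs_est (r T) t \<omega>) = msq (\<lambda>\<omega>. L T t * gap T t \<omega>)"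
      by (rule msq_cong) (use coded_control[OF t] in \<open>simp add: algebra_simps\<close>)
    also have "\<dots> = (L T t)\<^sup>2 * msq (gap T t)" by (simp add: power_mult_distrib)
    finally have "(ctg T (Suc t) + R) * msq (\<lambda>\<omega>. control (r T) t \<omega> + L T t * obs_est (r T) t \<omega>)
        = ric_weight (T - t) * msq (gap T t)"
      using ric_weight_eq[of t T] t by simp
    also have "\<dots> \<le> ric_weight (T - t) * gap_var t"
      using gap_bounds[of t] t ric_pos[of "T - t"] R_nonneg
      by (intro mult_left_mono) (auto simp: ric_weight_def)
    finally show ?thesis .
  qed
  then have "(\<Sum>t=1..T. (ctg T (Suc t) + R) * msq (\<lambda>\<omega>. control (r T) t \<omega> + L T t * obs_est (r T) t \<omega>))
      \<le> (\<Sum>t=1..T. ric_weight (T - t) * gap_var t)"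
    by (rule sum_mono)
  then show ?thesis
    unfolding horizon_cost_admissible[OF coded_admissible T]
    by (simp add: add_divide_distrib[symmetric] divide_right_mono)
qed

end

lemma coded_average_cost:
  "average_cost M F Q R r
    \<le> ereal (optimal_cost + (Q + (\<alpha>\<^sup>2 - 1) * S) / (1 + SDR - \<alpha>\<^sup>2) * (P - P * V / (P + V)))"
proof -
  let ?b = "\<lambda>T. base_cost T / real T + (\<Sum>t=1..T. ric_weight (T - t) * gap_var t) / real T"
  have "?b \<longlonglongrightarrow> optimal_cost + (Q + (\<alpha>\<^sup>2 - 1) * S) * ((P - P * V / (P + V)) / (1 + SDR - \<alpha>\<^sup>2))"
    by (intro tendsto_add base_cost_tendsto cesaro_convolution ric_weight_tendsto gap_var_tendsto)
  then have "(\<lambda>T. ereal (?b T)) \<longlonglongrightarrow> ereal (optimal_cost + (Q + (\<alpha>\<^sup>2 - 1) * S) * ((P - P * V / (P + V)) / (1 + SDR - \<alpha>\<^sup>2)))"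
    by (rule tendsto_ereal)
  then have "limsup (\<lambda>T. ereal (?b T)) = ereal (optimal_cost + (Q + (\<alpha>\<^sup>2 - 1) * S) * ((P - P * V / (P + V)) / (1 + SDR - \<alpha>\<^sup>2)))"
    by (rule lim_imp_Limsup[OF sequentially_bot])
  moreover have "average_cost M F Q R r \<le> limsup (\<lambda>T. ereal (?b T))"
    unfolding average_cost_def
    by (intro Limsup_mono eventually_sequentiallyI[of 1] coded_horizon_cost)
  ultimately show ?thesis by simp
qed

text \<open>In closed loop x_{t+1} = (\<alpha> - L_t) x_t + L_t \<epsilon>_t + w_t, where
  \<epsilon>_t is the controller's estimation error, bounded in mean square but possibly correlated
  with x_t. A weighted Young inequality separates the two at the price of a factor
  \<open>1 + \<delta>\<close>, which the squared limit factor, at most 1/\<alpha>^2, can absorb.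
  \<open>stage_recursion_bounded\<close> deals with the last stages.\<close>

lemma coded_stabilized: "stabilized M r"
proof -
  obtain C1 where C1: "\<And>t. err_var t + gap_var t \<le> C1"
  proof -
    have "convergent (\<lambda>t. err_var t + gap_var t)"
      using tendsto_add[OF err_var_tendsto gap_var_tendsto] by (rule convergentI)
    then have "Bseq (\<lambda>t. err_var t + gap_var t)" by (rule convergent_imp_Bseq)
    then obtain B where "\<And>t. \<bar>err_var t + gap_var t\<bar> \<le> B" by (auto simp: Bseq_def)
    then show ?thesis using that by (meson abs_le_D1)
  qed
  have C1_nonneg: "C1 \<ge> 0" using C1[of 0] err_var_nonneg[of 0] gap_var_nonneg[of 0] by linarith
  have \<alpha>2: "\<alpha>\<^sup>2 > 1" using \<alpha>_gt_1 by (simp add: one_less_power)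
  \<comment> \<open>Chosen so that \<open>1 + \<delta>\<close> is the midpoint of 1 and \<alpha>^2,
    which leaves room below \<alpha>^2 for strict contraction.\<close>
  define \<delta> where "\<delta> = (\<alpha>\<^sup>2 - 1) / 2"
  have \<delta>: "\<delta> > 0" using \<alpha>2 by (simp add: \<delta>_def)
  define \<rho> where "\<rho> k = (1 + \<delta>) * (\<alpha> * R / (ric k + R))\<^sup>2" for k
  define C where "C = (1 + 1 / \<delta>) * (\<alpha>\<^sup>2 * C1) + W"
  have C0: "C \<ge> 0" using \<delta> C1_nonneg W_pos by (auto simp: C_def intro!: add_nonneg_nonneg mult_nonneg_nonneg)
  have SR: "S + R > 0" using S_pos R_nonneg by linarith
  have lim: "\<rho> \<longlonglongrightarrow> (1 + \<delta>) * (\<alpha> * R / (S + R))\<^sup>2"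
    unfolding \<rho>_def using SR by (intro tendsto_intros ric_tendsto) simp
  have "(1 + \<delta>) * (\<alpha> * R / (S + R))\<^sup>2 < 1"
  proof -
    have "\<alpha>\<^sup>2 * R * S / (S + R) \<le> S"
      using riccati_fixed_point[OF S_pos R_nonneg S_eq] Q_nonneg by linarith
    then have "\<alpha> * (\<alpha> * R / (S + R)) * S \<le> 1 * S" by (simp add: power2_eq_square)
    then have le1: "\<alpha> * (\<alpha> * R / (S + R)) \<le> 1" using S_pos by (simp only: mult_le_cancel_right_pos)
    have nn: "0 \<le> \<alpha> * R / (S + R)" using \<alpha>_gt_1 R_nonneg SR by simp
    have "(\<alpha> * (\<alpha> * R / (S + R)))\<^sup>2 \<le> 1"
      using le1 nn \<alpha>_gt_1 by (intro power_le_one mult_nonneg_nonneg) auto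
    then have "\<alpha>\<^sup>2 * (\<alpha> * R / (S + R))\<^sup>2 \<le> 1" by (simp only: power_mult_distrib)
    moreover have "1 + \<delta> < \<alpha>\<^sup>2" using \<alpha>2 by (simp add: \<delta>_def field_simps)
    \<comment> \<open>Strict multiplication needs a nonzero square; the second alternative covers
      \<open>R = 0\<close>, the third is excluded by the preceding bound.\<close>
    then have "(1 + \<delta>) * (\<alpha> * R / (S + R))\<^sup>2 < 1 \<or> (\<alpha> * R / (S + R))\<^sup>2 = 0 \<or> \<alpha>\<^sup>2 * (\<alpha> * R / (S + R))\<^sup>2 > 1"
      using mult_strict_right_mono[of "1 + \<delta>" "\<alpha>\<^sup>2" "(\<alpha> * R / (S + R))\<^sup>2"]
      by (metis less_le_trans not_less zero_less_power2 power2_eq_iff_nonneg zero_le_power2 le_less)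
    ultimately show ?thesis by auto
  qed
  then obtain \<rho>1 where \<rho>1: "(1 + \<delta>) * (\<alpha> * R / (S + R))\<^sup>2 < \<rho>1" "\<rho>1 < 1" using dense by blast
  have \<rho>1_nonneg: "0 \<le> \<rho>1"
  proof -
    have "0 \<le> (1 + \<delta>) * (\<alpha> * R / (S + R))\<^sup>2" using \<delta> by simp
    then show ?thesis using \<rho>1 by linarith
  qed
  obtain k0 where k0: "\<And>k. k \<ge> k0 \<Longrightarrow> \<rho> k \<le> \<rho>1"
    using order_tendstoD(2)[OF lim \<rho>1(1)] by (auto simp: eventually_sequentially intro: less_imp_le)
  \<comment> \<open>Whatever the gain, the closed-loop factor lies between 0 and \<alpha>.\<close>
  define \<Lambda> where "\<Lambda> = (1 + \<delta>) * \<alpha>\<^sup>2"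
  have \<Lambda>: "\<Lambda> \<ge> 0" using \<delta> by (simp add: \<Lambda>_def)
  have \<rho>\<Lambda>: "\<rho> k \<le> \<Lambda>" for k
  proof -
    have "ric k + R > 0" using ric_pos[of k] R_nonneg by linarith
    then have "\<alpha> * R / (ric k + R) \<le> \<alpha>" "0 \<le> \<alpha> * R / (ric k + R)"
      using \<alpha>_gt_1 R_nonneg ric_pos[of k] by (auto simp: field_simps)
    then show ?thesis unfolding \<rho>_def \<Lambda>_def using \<delta> by (intro mult_left_mono power_mono) auto
  qed
  \<comment> \<open>The larger of the initial second moment and the equilibrium
    \<open>C / (1 - \<rho>1)\<close> of the contracting recursion.\<close>
  define D where "D = max (\<alpha>\<^sup>2 * P0 + W) (C / (1 - \<rho>1))"
  have D: "C \<le> (1 - \<rho>1) * D"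
  proof -
    have "(1 - \<rho>1) * (C / (1 - \<rho>1)) \<le> (1 - \<rho>1) * D"
      using \<rho>1 by (intro mult_left_mono) (auto simp: D_def)
    then show ?thesis using \<rho>1 by simp
  qed
  have msq_bound: "msq (state (r T) t) \<le> D * (\<Lambda> + 1) ^ k0" if T: "T \<ge> 1" and t: "1 \<le> t" "t \<le> T + 1" for T t
  proof (rule stage_recursion_bounded[where a="\<lambda>t. msq (state (r T) t)" and \<rho>=\<rho> and \<sigma>=\<rho>1 and C=C and T=T])
    note adm = coded_admissible[OF T]
    show "msq (state (r T) 1) \<le> D" using first_state_msq[OF adm] by (simp add: D_def)
    show "0 \<le> msq (state (r T) s)" for s by simp
    fix s assume s: "1 \<le> s" "s \<le> T"
    then have s': "s \<in> {1..T}" by simp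
    let ?x = "state (r T) s" and ?u = "control (r T) s"
    \<comment> \<open>State minus receiver estimate, split into gap and filter error; the factors 1
      match \<open>filt_err_orthogonal\<close>.\<close>
    let ?\<epsilon> = "\<lambda>\<omega>. 1 * gap T s \<omega> + 1 * filt_err s \<omega>"
    have xs: "sqint M ?x" using admissible_state_sqint[OF adm] s by simp
    note gb = gap_bounds[OF T s(2)]
    have gG: "gap T s \<in> borel_measurable (G s)" using gb by (auto simp: gap_def[abs_def] intro: borel_measurable_diff)
    have \<epsilon>s: "sqint M ?\<epsilon>" using gb filt_err_moments by (intro sqint_add sqint_cmult) auto
    have \<epsilon>le: "msq ?\<epsilon> \<le> C1"
      using filt_err_orthogonal[OF gG, of 1 1] gb C1[of s] by simp
    have Rp: "ric (T - s) + R > 0" using ric_pos[of "T - s"] R_nonneg by linarith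
    have L: "L T s = \<alpha> * ric (T - s) / (ric (T - s) + R)" using s by (simp add: lqg_gain_def ctg_Suc_le)
    have aL: "\<alpha> - L T s = \<alpha> * R / (ric (T - s) + R)" unfolding L using Rp by (simp add: field_simps)
    have L2: "(L T s)\<^sup>2 \<le> \<alpha>\<^sup>2"
      unfolding L using Rp \<alpha>_gt_1 ric_pos[of "T - s"] R_nonneg by (intro power_mono) (auto simp: field_simps)
    have split: "(\<alpha> * ?x \<omega> + ?u \<omega>)\<^sup>2 \<le> \<rho> (T - s) * (?x \<omega>)\<^sup>2 + (1 + 1 / \<delta>) * (L T s)\<^sup>2 * (?\<epsilon> \<omega>)\<^sup>2"
      if \<omega>: "\<omega> \<in> space M" for \<omega>
    proof -
      have "\<alpha> * ?x \<omega> + ?u \<omega> = (\<alpha> - L T s) * ?x \<omega> + L T s * ?\<epsilon> \<omega>"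
        using coded_control[OF T s' \<omega>] run_decomposition(1)[OF coded_plant[OF T] \<omega> s(2)]
        by (simp add: algebra_simps)
      also have "\<dots>\<^sup>2 \<le> (1 + \<delta>) * ((\<alpha> - L T s) * ?x \<omega>)\<^sup>2 + (1 + 1 / \<delta>) * (L T s * ?\<epsilon> \<omega>)\<^sup>2"
      proof -
        have "(p + q)\<^sup>2 \<le> (1 + \<delta>) * p\<^sup>2 + (1 + 1 / \<delta>) * q\<^sup>2" for p q :: real
        proof -
          have "(1 + \<delta>) * p\<^sup>2 + (1 + 1 / \<delta>) * q\<^sup>2 - (p + q)\<^sup>2 = (\<delta> * p - q)\<^sup>2 / \<delta>"
            using \<delta> by (simp add: field_simps power2_eq_square)
          moreover have "(\<delta> * p - q)\<^sup>2 / \<delta> \<ge> 0" using \<delta> by simp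
          ultimately show ?thesis by linarith
        qed
        then show ?thesis .
      qed
      also have "\<dots> = \<rho> (T - s) * (?x \<omega>)\<^sup>2 + (1 + 1 / \<delta>) * (L T s)\<^sup>2 * (?\<epsilon> \<omega>)\<^sup>2"
        unfolding power_mult_distrib aL \<rho>_def by (simp add: mult.assoc)
      finally show ?thesis .
    qed
    have "msq (\<lambda>\<omega>. \<alpha> * ?x \<omega> + ?u \<omega>)
        \<le> expectation (\<lambda>\<omega>. \<rho> (T - s) * (?x \<omega>)\<^sup>2 + (1 + 1 / \<delta>) * (L T s)\<^sup>2 * (?\<epsilon> \<omega>)\<^sup>2)"
    proof (rule integral_mono)
      have "sqint M (\<lambda>\<omega>. \<alpha> * ?x \<omega> + ?u \<omega>)" using xs gb by (intro sqint_add sqint_cmult) auto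
      then show "integrable M (\<lambda>\<omega>. (\<alpha> * ?x \<omega> + ?u \<omega>)\<^sup>2)" by (rule sqint_square)
      show "integrable M (\<lambda>\<omega>. \<rho> (T - s) * (?x \<omega>)\<^sup>2 + (1 + 1 / \<delta>) * (L T s)\<^sup>2 * (?\<epsilon> \<omega>)\<^sup>2)"
        using sqint_square[OF xs] sqint_square[OF \<epsilon>s] by (intro Bochner_Integration.integrable_add integrable_mult_right)
    qed (rule split)
    also have "\<dots> = \<rho> (T - s) * msq ?x + (1 + 1 / \<delta>) * (L T s)\<^sup>2 * msq ?\<epsilon>"
      using sqint_square[OF xs] sqint_square[OF \<epsilon>s]
      by (subst Bochner_Integration.integral_add) (auto intro!: integrable_mult_right)
    also have "(1 + 1 / \<delta>) * (L T s)\<^sup>2 * msq ?\<epsilon> \<le> (1 + 1 / \<delta>) * \<alpha>\<^sup>2 * C1"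
      using \<delta> L2 \<epsilon>le by (intro mult_mono) auto
    finally show "msq (state (r T) (Suc s)) \<le> \<rho> (T - s) * msq ?x + C"
      unfolding state_Suc_msq[OF adm s(2)] C_def by (simp add: mult.assoc)
  qed (use k0 \<rho>\<Lambda> \<rho>1 \<rho>1_nonneg \<Lambda> C0 D t in auto)
  \<comment> \<open>Time 0 precedes the recursion and contributes \<open>P0\<close>.\<close>
  define B where "B = max P0 (D * (\<Lambda> + 1) ^ k0)"
  have "(\<integral>\<^sup>+ \<omega>. ennreal ((state (r T) t \<omega>)\<^sup>2) \<partial>M) \<le> ennreal B" if T: "T \<ge> 1" and t: "t \<le> T + 1" for T t
  proof -
    note adm = coded_admissible[OF T]
    have "msq (state (r T) t) \<le> B"
    proof (cases "t = 0")
      case True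
      have "msq (state (r T) 0) = msq (filt_err 0)"
        by (rule msq_cong) (use run_initial[OF coded_plant[OF T]] in simp)
      then show ?thesis using True filt_err_moments(3)[of 0] by (simp add: B_def err_var_def)
    next
      case False
      then show ?thesis using msq_bound[OF T, of t] t by (simp add: B_def)
    qed
    moreover have "sqint M (state (r T) t)" using admissible_state_sqint[OF adm] t by simp
    ultimately show ?thesis by (simp add: nn_integral_sqint ennreal_leI)
  qed
  then show ?thesis unfolding stabilized_def by blast
qed

end

theorem theorem1:
  fixes M :: "'a measure"
    and \<alpha> W V P0 SNR SDR F Q R S P Pbar :: real and KC :: nat
    and x0 :: "'a \<Rightarrow> real" and w v :: "nat \<Rightarrow> 'a \<Rightarrow> real" and n :: "nat \<Rightarrow> nat \<Rightarrow> 'a \<Rightarrow> real"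
    and enc :: "nat \<Rightarrow> nat \<Rightarrow> real \<Rightarrow> nat \<Rightarrow> real"
    and dec :: "nat \<Rightarrow> nat \<Rightarrow> (nat \<Rightarrow> real) \<Rightarrow> real"
    and r :: "nat \<Rightarrow> 'a coded_loop"
  assumes "\<alpha> > 1" and "W > 0" and "V \<ge> 0" and "P0 \<ge> 0" and "SNR > 0" and "SDR > 0" and "KC \<ge> 1"
    and "F \<ge> 0" and "Q \<ge> 0" and "R \<ge> 0"
    and noises: "gaussian_noises M P0 W V SNR KC x0 w v n"
    and gains: "gains_well_defined_nonzero \<alpha> F Q R"
    and scheme: "\<And>T. T \<ge> 1 \<Longrightarrow>
      coding_and_control M \<alpha> W V P0 F Q R KC SDR x0 w v n (enc T) (dec T) T (r T)"
    and power: "\<And>T. T \<ge> 1 \<Longrightarrow> power_constraint M KC T (r T)"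
    and code: "\<And>T. T \<ge> 1 \<Longrightarrow> bounded_distortion_code M KC SDR n (enc T) (dec T) T (r T)"
    and S: "S > 0" "S\<^sup>2 - (Q + (\<alpha>\<^sup>2 - 1) * R) * S - Q * R = 0"
    and P: "P > 0" "P\<^sup>2 - ((\<alpha>\<^sup>2 - 1) * V + W) * P - V * W = 0"
    and Pbar: "Pbar = P * V / (P + V)"
    and "\<alpha>\<^sup>2 < 1 + SDR"
  shows "stabilized M r
    \<and> average_cost M F Q R r
        \<le> observer_cost M \<alpha> W V P0 F Q R x0 w v
          + ereal ((Q + (\<alpha>\<^sup>2 - 1) * S) / (1 + SDR - \<alpha>\<^sup>2) * (P - Pbar))
    \<and> observer_cost M \<alpha> W V P0 F Q R x0 w v = ereal (Q * Pbar + S * (P - Pbar))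
    \<and> (\<forall>q. (\<forall>T\<ge>1. observer_lqg_controlled M \<alpha> W V P0 F Q R x0 w v T (q T)) \<longrightarrow>
          average_cost M F Q R q = observer_cost M \<alpha> W V P0 F Q R x0 w v)
    \<and> kf_pred_mse \<alpha> W V P0 \<longlonglongrightarrow> P
    \<and> kf_filt_mse \<alpha> W V P0 \<longlonglongrightarrow> Pbar"
proof -
  \<comment> \<open>For horizon 1 the only gain is \<alpha> F / (F + R), so a nonzero gain forces
    \<open>F\<close> to be nonzero. This keeps the Riccati iterates off the fixed point 0 that
    exists when \<open>Q = 0\<close>.\<close>
  have "F \<noteq> 0"
  proof -
    have "lqg_gain \<alpha> F Q R 1 1 \<noteq> 0"
      using gains unfolding gains_well_defined_nonzero_def by (metis atLeastAtMost_iff order_refl)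
    then show ?thesis by (auto simp: lqg_gain_def cost_to_go_def)
  qed
  then have "F > 0" using \<open>F \<ge> 0\<close> by simp
  interpret noises: gaussian_noises M P0 W V SNR KC x0 w v n by (rule noises)
  interpret coded_lqg M P0 W V SNR KC x0 w v n \<alpha> F Q R S P SDR enc dec r
    by unfold_locales (use assms \<open>F > 0\<close> in auto)
  show ?thesis
  proof (intro conjI allI impI)
    show "stabilized M r" by (rule coded_stabilized)
    show "observer_cost M \<alpha> W V P0 F Q R x0 w v = ereal (Q * Pbar + S * (P - Pbar))"
      unfolding Pbar by (rule observer_cost_eq)
    show "average_cost M F Q R r \<le> observer_cost M \<alpha> W V P0 F Q R x0 w v
          + ereal ((Q + (\<alpha>\<^sup>2 - 1) * S) / (1 + SDR - \<alpha>\<^sup>2) * (P - Pbar))"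
      using coded_average_cost unfolding Pbar observer_cost_eq by simp
    show "average_cost M F Q R q = observer_cost M \<alpha> W V P0 F Q R x0 w v"
      if "\<forall>T\<ge>1. observer_lqg_controlled M \<alpha> W V P0 F Q R x0 w v T (q T)" for q
      unfolding observer_cost_eq by (rule lqg_controlled_average_cost) (use that in blast)
    show "kf_pred_mse \<alpha> W V P0 \<longlonglongrightarrow> P" using Pt_tendsto .
    show "kf_filt_mse \<alpha> W V P0 \<longlonglongrightarrow> Pbar" unfolding Pbar by (rule kf_filt_mse_tendsto)
  qed
qed

end
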